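(* Let $A$ be a gentle algebra over an algebraically closed field $\Bbbk$ and let $M$ be a finite-dimensional right $A$-module. Then $\mathrm{Ext}_A^{d}(M,A)=0$ for all $d\ge 0$ if and only if $M=0$.
   Context: A gentle algebra is a finite-dimensional algebra $A\cong\Bbbk\mathcal Q/\mathcal I$ such that: every vertex of $\mathcal Q$ is the source of at most two arrows and the target of at most two arrows; for each arrow $\alpha$ there is at most one arrow $\beta$ starting at the target of $\alpha$ with $\alpha\beta\in\mathcal I$ and at most one with $\alpha\beta\notin\mathcal I$; for each arrow $\alpha$ there is at most one arrow $\beta$ ending at the source of $\alpha$ with $\beta\alpha\in\mathcal I$ and at most one with $\beta\alpha\notin\mathcal I$; $\mathcal I$ is admissible and generated by paths of length 2. $\mathrm{Ext}^0_A=\mathrm{Hom}_A$. *)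

theory Defs
  imports
    "Graph_Theory.Arc_Walk"
    "Jordan_Normal_Form.Missing_VectorSpace"
    "HOL-Algebra.Algebra"
begin

hide_const (open) Multiset.mult Wellorder_Constructions.zero

section \<open>Quivers with relations\<close>

text \<open>A finite quiver is a \<^locale>\<open>fin_digraph\<close>. A path is a pair of its source and its list of
  arrows, so that the trivial path at \<open>v\<close> is \<open>(v, [])\<close>. Paths are composed from left to right:
  \<open>\<alpha>\<beta>\<close> is \<open>\<alpha>\<close> followed by \<open>\<beta>\<close>, and right modules are representations of the quiver.\<close>

definition quiver_paths :: "('v, 'e) pre_digraph \<Rightarrow> ('v \<times> 'e list) set" where
  "quiver_paths Q = {(u, p). \<exists>v. pre_digraph.awalk Q u p v}"

definition path_algebra ::
  "('k, 'm) ring_scheme \<Rightarrow> ('v, 'e) pre_digraph \<Rightarrow> ('k, 'v \<times> 'e list \<Rightarrow> 'k) module" where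
  "path_algebra K Q =
    \<lparr>carrier = {f. (\<forall>x. f x \<in> carrier K) \<and> (\<forall>x. x \<notin> quiver_paths Q \<longrightarrow> f x = \<zero>\<^bsub>K\<^esub>) \<and>
                   finite {x. f x \<noteq> \<zero>\<^bsub>K\<^esub>}},
     mult = (\<lambda>f g. \<lambda>(u, p). \<Oplus>\<^bsub>K\<^esub>i\<in>{..length p}.
               f (u, take i p) \<otimes>\<^bsub>K\<^esub> g (pre_digraph.awlast Q u (take i p), drop i p)),
     one = (\<lambda>(u, p). if u \<in> verts Q \<and> p = [] then \<one>\<^bsub>K\<^esub> else \<zero>\<^bsub>K\<^esub>),
     zero = (\<lambda>x. \<zero>\<^bsub>K\<^esub>),
     add = (\<lambda>f g x. f x \<oplus>\<^bsub>K\<^esub> g x),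
     smult = (\<lambda>c f x. c \<otimes>\<^bsub>K\<^esub> f x)\<rparr>"

definition path_elem :: "('k, 'm) ring_scheme \<Rightarrow> 'v \<times> 'e list \<Rightarrow> 'v \<times> 'e list \<Rightarrow> 'k" where
  "path_elem K x = (\<lambda>y. if y = x then \<one>\<^bsub>K\<^esub> else \<zero>\<^bsub>K\<^esub>)"

definition arrow_ideal ::
  "('k, 'm) ring_scheme \<Rightarrow> ('v, 'e) pre_digraph \<Rightarrow> ('v \<times> 'e list \<Rightarrow> 'k) set" where
  "arrow_ideal K Q =
    genideal (path_algebra K Q) ((\<lambda>a. path_elem K (tail Q a, [a])) ` arcs Q)"

text \<open>In \<^term>\<open>ideals_set R\<close> the multiplication is the product of ideals.\<close>

definition admissible_ideal ::
  "('k, 'm) ring_scheme \<Rightarrow> ('v, 'e) pre_digraph \<Rightarrow> ('v \<times> 'e list \<Rightarrow> 'k) set \<Rightarrow> bool" where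
  "admissible_ideal K Q I \<longleftrightarrow>
    ideal I (path_algebra K Q) \<and>
    (\<exists>m::nat. m \<ge> 2 \<and> arrow_ideal K Q [^]\<^bsub>ideals_set (path_algebra K Q)\<^esub> m \<subseteq> I) \<and>
    I \<subseteq> arrow_ideal K Q [^]\<^bsub>ideals_set (path_algebra K Q)\<^esub> (2::nat)"


section \<open>Gentle algebras\<close>

text \<open>The locale \<^locale>\<open>algebra\<close> of HOL-Algebra is about commutative algebras.\<close>

locale assoc_algebra = vectorspace K A + A?: ring A for K and A (structure) +
  assumes smult_mult_left:
      "\<lbrakk>c \<in> carrier K; x \<in> carrier A; y \<in> carrier A\<rbrakk> \<Longrightarrow>
        (c \<odot>\<^bsub>A\<^esub> x) \<otimes>\<^bsub>A\<^esub> y = c \<odot>\<^bsub>A\<^esub> (x \<otimes>\<^bsub>A\<^esub> y)"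
    and smult_mult_right:
      "\<lbrakk>c \<in> carrier K; x \<in> carrier A; y \<in> carrier A\<rbrakk> \<Longrightarrow>
        x \<otimes>\<^bsub>A\<^esub> (c \<odot>\<^bsub>A\<^esub> y) = c \<odot>\<^bsub>A\<^esub> (x \<otimes>\<^bsub>A\<^esub> y)"

definition quotient_algebra :: "('k, 'a) module \<Rightarrow> 'a set \<Rightarrow> ('k, 'a set) module" where
  "quotient_algebra P I =
    \<lparr>carrier = carrier (P Quot I), mult = mult (P Quot I), one = one (P Quot I),
     zero = zero (P Quot I), add = add (P Quot I),
     smult = (\<lambda>c C. \<Union>x\<in>C. I +>\<^bsub>P\<^esub> (c \<odot>\<^bsub>P\<^esub> x))\<rparr>"

definition algebra_iso ::
  "('k, 'm) ring_scheme \<Rightarrow> ('k, 'a) module \<Rightarrow> ('k, 'b) module \<Rightarrow> ('a \<Rightarrow> 'b) set" where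
  "algebra_iso K A B =
    {h \<in> ring_iso A B. \<forall>c\<in>carrier K. \<forall>x\<in>carrier A. h (c \<odot>\<^bsub>A\<^esub> x) = c \<odot>\<^bsub>B\<^esub> h x}"

definition gentle_presentation ::
  "('k, 'm) ring_scheme \<Rightarrow> ('v, 'e) pre_digraph \<Rightarrow> ('v \<times> 'e list \<Rightarrow> 'k) set \<Rightarrow> bool" where
  "gentle_presentation K Q I \<longleftrightarrow>
    fin_digraph Q \<and>
    (\<forall>v\<in>verts Q. card (out_arcs Q v) \<le> 2 \<and> card (in_arcs Q v) \<le> 2) \<and>
    (\<forall>a\<in>arcs Q.
      (\<exists>\<^sub>\<le>\<^sub>1b. b \<in> arcs Q \<and> tail Q b = head Q a \<and> path_elem K (tail Q a, [a, b]) \<in> I) \<and>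
      (\<exists>\<^sub>\<le>\<^sub>1b. b \<in> arcs Q \<and> tail Q b = head Q a \<and> path_elem K (tail Q a, [a, b]) \<notin> I)) \<and>
    (\<forall>a\<in>arcs Q.
      (\<exists>\<^sub>\<le>\<^sub>1b. b \<in> arcs Q \<and> head Q b = tail Q a \<and> path_elem K (tail Q b, [b, a]) \<in> I) \<and>
      (\<exists>\<^sub>\<le>\<^sub>1b. b \<in> arcs Q \<and> head Q b = tail Q a \<and> path_elem K (tail Q b, [b, a]) \<notin> I)) \<and>
    admissible_ideal K Q I \<and>
    (\<exists>S. S \<subseteq> {x \<in> quiver_paths Q. length (snd x) = 2} \<and>
         I = genideal (path_algebra K Q) (path_elem K ` S))"

text \<open>Up to isomorphism, every finite quiver has natural numbers as vertices and arrows.\<close>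

definition gentle_algebra :: "('k, 'm) ring_scheme \<Rightarrow> ('k, 'a) module \<Rightarrow> bool" where
  "gentle_algebra K A \<longleftrightarrow>
    assoc_algebra K A \<and> vectorspace.fin_dim K A \<and>
    (\<exists>(Q :: (nat, nat) pre_digraph) I. gentle_presentation K Q I \<and>
       algebra_iso K A (quotient_algebra (path_algebra K Q) I) \<noteq> {})"


section \<open>Right modules\<close>

text \<open>As in \<^typ>\<open>('a, 'x) module\<close>, the multiplicative part of the underlying ring record is
  ignored.\<close>

record ('a, 'x) right_mod = "'x ring" +
  act :: "'x \<Rightarrow> 'a \<Rightarrow> 'x" (infixl \<open>\<triangleleft>\<index>\<close> 70)

locale right_module = A?: ring A + M?: abelian_group M
  for A :: "('a, 'm) ring_scheme" (structure) and M :: "('a, 'x) right_mod" (structure) +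
  assumes act_closed [simp, intro]:
      "\<lbrakk>x \<in> carrier M; a \<in> carrier A\<rbrakk> \<Longrightarrow> x \<triangleleft>\<^bsub>M\<^esub> a \<in> carrier M"
    and act_add_left:
      "\<lbrakk>x \<in> carrier M; y \<in> carrier M; a \<in> carrier A\<rbrakk> \<Longrightarrow>
        (x \<oplus>\<^bsub>M\<^esub> y) \<triangleleft>\<^bsub>M\<^esub> a = x \<triangleleft>\<^bsub>M\<^esub> a \<oplus>\<^bsub>M\<^esub> y \<triangleleft>\<^bsub>M\<^esub> a"
    and act_add_right:
      "\<lbrakk>x \<in> carrier M; a \<in> carrier A; b \<in> carrier A\<rbrakk> \<Longrightarrow>
        x \<triangleleft>\<^bsub>M\<^esub> (a \<oplus>\<^bsub>A\<^esub> b) = x \<triangleleft>\<^bsub>M\<^esub> a \<oplus>\<^bsub>M\<^esub> x \<triangleleft>\<^bsub>M\<^esub> b"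
    and act_mult:
      "\<lbrakk>x \<in> carrier M; a \<in> carrier A; b \<in> carrier A\<rbrakk> \<Longrightarrow>
        x \<triangleleft>\<^bsub>M\<^esub> (a \<otimes>\<^bsub>A\<^esub> b) = (x \<triangleleft>\<^bsub>M\<^esub> a) \<triangleleft>\<^bsub>M\<^esub> b"
    and act_one [simp]:
      "x \<in> carrier M \<Longrightarrow> x \<triangleleft>\<^bsub>M\<^esub> \<one>\<^bsub>A\<^esub> = x"

definition regular_module :: "('a, 'm) ring_scheme \<Rightarrow> ('a, 'a) right_mod" where
  "regular_module A =
    \<lparr>carrier = carrier A, mult = mult A, one = one A, zero = zero A, add = add A,
     act = mult A\<rparr>"

definition underlying_vectorspace ::
  "('k, 'a) module \<Rightarrow> ('a, 'x) right_mod \<Rightarrow> ('k, 'x) module" where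
  "underlying_vectorspace A M =
    \<lparr>carrier = carrier M, mult = mult M, one = one M, zero = zero M, add = add M,
     smult = (\<lambda>c x. x \<triangleleft>\<^bsub>M\<^esub> (c \<odot>\<^bsub>A\<^esub> \<one>\<^bsub>A\<^esub>))\<rparr>"

text \<open>Homomorphisms are extensional, so that equality of homomorphisms is equality on the
  carrier.\<close>

definition rmod_hom ::
  "('a, 'm) ring_scheme \<Rightarrow> ('a, 'x) right_mod \<Rightarrow> ('a, 'y) right_mod \<Rightarrow> ('x \<Rightarrow> 'y) set" where
  "rmod_hom A M N =
    {f \<in> carrier M \<rightarrow>\<^sub>E carrier N.
       (\<forall>x\<in>carrier M. \<forall>y\<in>carrier M. f (x \<oplus>\<^bsub>M\<^esub> y) = f x \<oplus>\<^bsub>N\<^esub> f y) \<and>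
       (\<forall>x\<in>carrier M. \<forall>a\<in>carrier A. f (x \<triangleleft>\<^bsub>M\<^esub> a) = f x \<triangleleft>\<^bsub>N\<^esub> a)}"

definition rmod_ker :: "('a, 'x) right_mod \<Rightarrow> ('a, 'y) right_mod \<Rightarrow> ('x \<Rightarrow> 'y) \<Rightarrow> 'x set" where
  "rmod_ker M N f = {x \<in> carrier M. f x = \<zero>\<^bsub>N\<^esub>}"

definition hom_group ::
  "('a, 'm) ring_scheme \<Rightarrow> ('a, 'x) right_mod \<Rightarrow> ('a, 'y) right_mod \<Rightarrow> ('x \<Rightarrow> 'y) monoid" where
  "hom_group A M N =
    \<lparr>carrier = rmod_hom A M N,
     mult = (\<lambda>f g. \<lambda>x\<in>carrier M. f x \<oplus>\<^bsub>N\<^esub> g x),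
     one = (\<lambda>x\<in>carrier M. \<zero>\<^bsub>N\<^esub>)\<rparr>"


section \<open>Free resolutions and Ext\<close>

definition free_module :: "('a, 'm) ring_scheme \<Rightarrow> ('a, 'x) right_mod \<Rightarrow> bool" where
  "free_module A F \<longleftrightarrow> right_module A F \<and>
    (\<exists>B. B \<subseteq> carrier F \<and>
      (\<forall>x\<in>carrier F. \<exists>!c. c \<in> B \<rightarrow>\<^sub>E carrier A \<and> finite {b \<in> B. c b \<noteq> \<zero>\<^bsub>A\<^esub>} \<and>
         x = (\<Oplus>\<^bsub>F\<^esub>b\<in>{b \<in> B. c b \<noteq> \<zero>\<^bsub>A\<^esub>}. b \<triangleleft>\<^bsub>F\<^esub> c b)))"

text \<open>\<open>\<cdots> \<rightarrow> F 2 \<rightarrow> F 1 \<rightarrow> F 0 \<rightarrow> M \<rightarrow> 0\<close> with differentials \<open>d n : F (n + 1) \<rightarrow> F n\<close> and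
  augmentation \<open>\<epsilon> : F 0 \<rightarrow> M\<close>. Free modules are projective, so this is a projective resolution
  of \<open>M\<close>, which is what is needed to compute \<open>Ext\<close>; freeness, unlike the lifting property of
  projective modules, does not quantify over modules of other types.\<close>

definition free_resolution ::
  "('a, 'm) ring_scheme \<Rightarrow> ('a, 'x) right_mod \<Rightarrow>
   (nat \<Rightarrow> ('a, 'f) right_mod) \<times> (nat \<Rightarrow> 'f \<Rightarrow> 'f) \<times> ('f \<Rightarrow> 'x) \<Rightarrow> bool" where
  "free_resolution A M = (\<lambda>(F, d, \<epsilon>).
    (\<forall>n. free_module A (F n)) \<and>
    (\<forall>n. d n \<in> rmod_hom A (F (Suc n)) (F n)) \<and>
    \<epsilon> \<in> rmod_hom A (F 0) M \<and>
    \<epsilon> ` carrier (F 0) = carrier M \<and>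
    d 0 ` carrier (F 1) = rmod_ker (F 0) M \<epsilon> \<and>
    (\<forall>n. d (Suc n) ` carrier (F (Suc (Suc n))) = rmod_ker (F (Suc n)) (F n) (d n)))"

text \<open>The index type of the standard free resolution: generators of \<open>F 0\<close> are elements
  of \<open>M\<close>, generators of \<open>F (n + 1)\<close> are formal linear combinations of generators of \<open>F n\<close>.
  It is only used to have a type that is large enough for a free resolution of every module
  (lemma \<open>free_resolution_exists\<close> below).\<close>

datatype ('x, 'a) gen = Elt 'x | Comb "(('x, 'a) gen \<times> 'a) list"

definition chosen_resolution ::
  "('a, 'm) ring_scheme \<Rightarrow> ('a, 'x) right_mod \<Rightarrow>
   (nat \<Rightarrow> ('a, ('x, 'a) gen \<Rightarrow> 'a) right_mod) \<times>
   (nat \<Rightarrow> (('x, 'a) gen \<Rightarrow> 'a) \<Rightarrow> (('x, 'a) gen \<Rightarrow> 'a)) \<times> ((('x, 'a) gen \<Rightarrow> 'a) \<Rightarrow> 'x)" where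
  "chosen_resolution A M = (SOME R. free_resolution A M R)"

text \<open>\<open>Ext\<close> is the cohomology of the complex \<open>0 \<rightarrow> Hom(F 0, N) \<rightarrow> Hom(F 1, N) \<rightarrow> \<cdots>\<close>.\<close>

definition cocycles ::
  "('a, 'm) ring_scheme \<Rightarrow> (nat \<Rightarrow> ('a, 'f) right_mod) \<Rightarrow> (nat \<Rightarrow> 'f \<Rightarrow> 'f) \<Rightarrow>
   ('a, 'y) right_mod \<Rightarrow> nat \<Rightarrow> ('f \<Rightarrow> 'y) set" where
  "cocycles A F d N n =
    {f \<in> rmod_hom A (F n) N.
       compose (carrier (F (Suc n))) f (d n) = \<one>\<^bsub>hom_group A (F (Suc n)) N\<^esub>}"

fun coboundaries ::
  "('a, 'm) ring_scheme \<Rightarrow> (nat \<Rightarrow> ('a, 'f) right_mod) \<Rightarrow> (nat \<Rightarrow> 'f \<Rightarrow> 'f) \<Rightarrow>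
   ('a, 'y) right_mod \<Rightarrow> nat \<Rightarrow> ('f \<Rightarrow> 'y) set" where
  "coboundaries A F d N 0 = {\<one>\<^bsub>hom_group A (F 0) N\<^esub>}"
| "coboundaries A F d N (Suc n) =
    (\<lambda>f. compose (carrier (F (Suc n))) f (d n)) ` rmod_hom A (F n) N"

definition Ext ::
  "('a, 'm) ring_scheme \<Rightarrow> nat \<Rightarrow> ('a, 'x) right_mod \<Rightarrow> ('a, 'y) right_mod \<Rightarrow>
   ((('x, 'a) gen \<Rightarrow> 'a) \<Rightarrow> 'y) set monoid" where
  "Ext A n M N =
    (case chosen_resolution A M of (F, d, _) \<Rightarrow>
      (hom_group A (F n) N)\<lparr>carrier := cocycles A F d N n\<rparr> Mod coboundaries A F d N n)"


section \<open>The path algebra is a ring\<close>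

lemma (in pre_digraph) awlast_append': "awlast u (p @ q) = awlast (awlast u p) q"
  by (auto simp: awalk_verts_conv)

lemma (in wf_digraph) quiver_paths_split:
  assumes "i \<le> length p"
  shows "(u, p) \<in> quiver_paths G \<longleftrightarrow>
    (u, take i p) \<in> quiver_paths G \<and> (awlast u (take i p), drop i p) \<in> quiver_paths G"
proof -
  have "awalk u p v \<longleftrightarrow> awalk u (take i p) (awlast u (take i p)) \<and>
      awalk (awlast u (take i p)) (drop i p) v" for v
    using awalk_append_iff[of u "take i p" "drop i p" v] by simp
  then have "(\<exists>v. awalk u p v) \<longleftrightarrow>
      awalk u (take i p) (awlast u (take i p)) \<and> (\<exists>v. awalk (awlast u (take i p)) (drop i p) v)"
    by simp
  also have "awalk u (take i p) (awlast u (take i p)) \<longleftrightarrow> (\<exists>v. awalk u (take i p) v)"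
    using awalkE[of u "take i p"] by metis
  finally show ?thesis by (simp add: quiver_paths_def)
qed

lemma (in abelian_monoid) finsum_triangle:
  fixes h :: "nat \<Rightarrow> nat \<Rightarrow> 'a" and n :: nat
  assumes "\<And>j i. h j i \<in> carrier G"
  shows "(\<Oplus>i\<in>{..n}. \<Oplus>j\<in>{..i}. h j i) = (\<Oplus>j\<in>{..n}. \<Oplus>k\<in>{..n - j}. h j (j + k))"
proof (induction n)
  case 0
  show ?case using assms by simp
next
  case (Suc n)
  have c: "(\<lambda>j. \<Oplus>k\<in>{..m - j}. h j (j + k)) \<in> S \<rightarrow> carrier G" for m S
    using assms by (auto intro!: finsum_closed)
  have c': "(\<lambda>j. h j m) \<in> S \<rightarrow> carrier G" for m S using assms by auto
  have swap: "a \<oplus> (b \<oplus> d) = a \<oplus> d \<oplus> b"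
    if "a \<in> carrier G" "b \<in> carrier G" "d \<in> carrier G" for a b d
    using that by (simp add: a_ac)
  have s: "(\<Oplus>k\<in>{..Suc n - j}. h j (j + k)) = (\<Oplus>k\<in>{..n - j}. h j (j + k)) \<oplus> h j (Suc n)"
    if "j \<le> n" for j
  proof -
    have j: "Suc n - j = Suc (n - j)" "j + Suc (n - j) = Suc n" using that by auto
    have "(\<Oplus>k\<in>{..Suc n - j}. h j (j + k)) =
        h j (j + Suc (n - j)) \<oplus> (\<Oplus>k\<in>{..n - j}. h j (j + k))"
      unfolding j(1) using assms by (intro finsum_Suc) auto
    also have "\<dots> = (\<Oplus>k\<in>{..n - j}. h j (j + k)) \<oplus> h j (Suc n)"
      unfolding j(2) using assms by (intro a_comm finsum_closed) auto
    finally show ?thesis .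
  qed
  have "(\<Oplus>j\<in>{..Suc n}. \<Oplus>k\<in>{..Suc n - j}. h j (j + k)) =
      h (Suc n) (Suc n) \<oplus> (\<Oplus>j\<in>{..n}. \<Oplus>k\<in>{..Suc n - j}. h j (j + k))"
    using c[of "Suc n" "{..Suc n}"] assms by (subst finsum_Suc) auto
  also have "(\<Oplus>j\<in>{..n}. \<Oplus>k\<in>{..Suc n - j}. h j (j + k)) =
      (\<Oplus>j\<in>{..n}. (\<Oplus>k\<in>{..n - j}. h j (j + k)) \<oplus> h j (Suc n))"
    using assms by (intro finsum_cong') (auto simp: s intro!: finsum_closed a_closed)
  also have "\<dots> = (\<Oplus>j\<in>{..n}. \<Oplus>k\<in>{..n - j}. h j (j + k)) \<oplus> (\<Oplus>j\<in>{..n}. h j (Suc n))"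
    by (rule finsum_addf[OF c c'])
  also have "(\<Oplus>j\<in>{..n}. \<Oplus>k\<in>{..n - j}. h j (j + k)) = (\<Oplus>i\<in>{..n}. \<Oplus>j\<in>{..i}. h j i)"
    using Suc.IH by simp
  also have "h (Suc n) (Suc n) \<oplus> ((\<Oplus>i\<in>{..n}. \<Oplus>j\<in>{..i}. h j i) \<oplus> (\<Oplus>j\<in>{..n}. h j (Suc n)))
      = (h (Suc n) (Suc n) \<oplus> (\<Oplus>j\<in>{..n}. h j (Suc n))) \<oplus> (\<Oplus>i\<in>{..n}. \<Oplus>j\<in>{..i}. h j i)"
    using assms by (intro swap) (auto intro!: finsum_closed)
  also have "h (Suc n) (Suc n) \<oplus> (\<Oplus>j\<in>{..n}. h j (Suc n)) = (\<Oplus>j\<in>{..Suc n}. h j (Suc n))"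
    using c'[of "Suc n"] by (intro finsum_Suc[symmetric])
  also have "\<dots> \<oplus> (\<Oplus>i\<in>{..n}. \<Oplus>j\<in>{..i}. h j i) = (\<Oplus>i\<in>{..Suc n}. \<Oplus>j\<in>{..i}. h j i)"
    using assms by (intro finsum_Suc[symmetric]) (auto intro!: finsum_closed)
  finally show ?case by simp
qed

lemma path_algebra_ring:
  fixes K :: "('k, 'm) ring_scheme" and Q :: "('v, 'e) pre_digraph"
  assumes "ring K" "fin_digraph Q"
  shows "ring (path_algebra K Q)"
proof -
  interpret ring K by fact
  interpret fin_digraph Q by fact
  let ?P = "path_algebra K Q"
  let ?z = "\<zero>\<^bsub>K\<^esub>"
  let ?w = "\<lambda>u p i. awlast u (take i p)"
  have val: "f x \<in> carrier K" if "f \<in> carrier ?P" for f x using that by (cases x) (simp add: path_algebra_def)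
  have out: "f x = ?z" if "f \<in> carrier ?P" "x \<notin> quiver_paths Q" for f x
    using that by (cases x) (simp add: path_algebra_def)
  have fin: "finite {x. f x \<noteq> ?z}" if "f \<in> carrier ?P" for f
    using that by (simp add: path_algebra_def)
  have I: "f \<in> carrier ?P" if "\<And>x. f x \<in> carrier K" "\<And>x. x \<notin> quiver_paths Q \<Longrightarrow> f x = ?z"
      "finite {x. f x \<noteq> ?z}" for f
    using that by (simp add: path_algebra_def)
  have mult: "(f \<otimes>\<^bsub>?P\<^esub> g) (u, p) =
      (\<Oplus>\<^bsub>K\<^esub>i\<in>{..length p}. f (u, take i p) \<otimes>\<^bsub>K\<^esub> g (?w u p i, drop i p))" for f g u p
    by (simp add: path_algebra_def)
  have add: "(f \<oplus>\<^bsub>?P\<^esub> g) x = f x \<oplus>\<^bsub>K\<^esub> g x" for f g x by (simp add: path_algebra_def)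
  have one: "\<one>\<^bsub>?P\<^esub> (u, p) = (if u \<in> verts Q \<and> p = [] then \<one>\<^bsub>K\<^esub> else ?z)" for u p
    by (simp add: path_algebra_def)
  have zero: "\<zero>\<^bsub>?P\<^esub> = (\<lambda>x. ?z)" by (simp add: path_algebra_def)
  have mult_closed: "f \<otimes>\<^bsub>?P\<^esub> g \<in> carrier ?P" if f: "f \<in> carrier ?P" and g: "g \<in> carrier ?P" for f g
  proof (rule I)
    have z: "f (u, take i p) \<otimes>\<^bsub>K\<^esub> g (?w u p i, drop i p) = ?z"
      if "i \<le> length p" "f (u, take i p) = ?z \<or> g (?w u p i, drop i p) = ?z" for u p i
      using that val[OF f] val[OF g] by auto
    show "(f \<otimes>\<^bsub>?P\<^esub> g) x \<in> carrier K" for x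
      using val[OF f] val[OF g] by (cases x) (auto simp: mult intro!: finsum_closed)
    show "(f \<otimes>\<^bsub>?P\<^esub> g) x = ?z" if x: "x \<notin> quiver_paths Q" for x
    proof (cases x)
      case (Pair u p)
      have "f (u, take i p) = ?z \<or> g (?w u p i, drop i p) = ?z" if "i \<le> length p" for i
        using quiver_paths_split[OF that] x out[OF f] out[OF g] Pair by blast
      then show ?thesis
        unfolding Pair mult using z by (intro add.finprod_one_eqI) auto
    qed
    have "{x. (f \<otimes>\<^bsub>?P\<^esub> g) x \<noteq> ?z} \<subseteq>
        (\<lambda>((u, p), (v, q)). (u, p @ q)) ` ({x. f x \<noteq> ?z} \<times> {x. g x \<noteq> ?z})"
    proof
      fix x assume x: "x \<in> {x. (f \<otimes>\<^bsub>?P\<^esub> g) x \<noteq> ?z}"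
      obtain u p where up: "x = (u, p)" by fastforce
      have "\<exists>i\<le>length p. f (u, take i p) \<noteq> ?z \<and> g (?w u p i, drop i p) \<noteq> ?z"
      proof (rule ccontr)
        assume "\<not> ?thesis"
        then have "(f \<otimes>\<^bsub>?P\<^esub> g) (u, p) = ?z"
          unfolding mult using z by (intro add.finprod_one_eqI) auto
        with x up show False by simp
      qed
      then obtain i where "f (u, take i p) \<noteq> ?z" "g (?w u p i, drop i p) \<noteq> ?z" by blast
      then have "((u, take i p), (?w u p i, drop i p)) \<in> {x. f x \<noteq> ?z} \<times> {x. g x \<noteq> ?z}" by simp
      from imageI[OF this, of "\<lambda>((u, p), (v, q)). (u, p @ q)"]
      show "x \<in> (\<lambda>((u, p), (v, q)). (u, p @ q)) ` ({x. f x \<noteq> ?z} \<times> {x. g x \<noteq> ?z})"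
        by (simp add: up)
    qed
    then show "finite {x. (f \<otimes>\<^bsub>?P\<^esub> g) x \<noteq> ?z}"
      by (rule finite_subset) (simp add: fin[OF f] fin[OF g])
  qed
  show ?thesis
  proof (rule ringI)
    show "abelian_group ?P"
    proof (rule abelian_groupI)
      fix f assume f: "f \<in> carrier ?P"
      have "(\<lambda>x. \<ominus>\<^bsub>K\<^esub> f x) \<in> carrier ?P"
      proof (rule I)
        have "{x. \<ominus>\<^bsub>K\<^esub> f x \<noteq> ?z} \<subseteq> {x. f x \<noteq> ?z}" by auto
        then show "finite {x. \<ominus>\<^bsub>K\<^esub> f x \<noteq> ?z}" using fin[OF f] by (rule finite_subset)
      qed (use val[OF f] out[OF f] in auto)
      moreover have "(\<lambda>x. \<ominus>\<^bsub>K\<^esub> f x) \<oplus>\<^bsub>?P\<^esub> f = \<zero>\<^bsub>?P\<^esub>"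
        using val[OF f] by (simp add: fun_eq_iff add zero l_neg)
      ultimately show "\<exists>g\<in>carrier ?P. g \<oplus>\<^bsub>?P\<^esub> f = \<zero>\<^bsub>?P\<^esub>" by blast
    next
      fix f g assume f: "f \<in> carrier ?P" and g: "g \<in> carrier ?P"
      show "f \<oplus>\<^bsub>?P\<^esub> g \<in> carrier ?P"
      proof (rule I)
        have "{x. (f \<oplus>\<^bsub>?P\<^esub> g) x \<noteq> ?z} \<subseteq> {x. f x \<noteq> ?z} \<union> {x. g x \<noteq> ?z}" by (auto simp: add)
        then show "finite {x. (f \<oplus>\<^bsub>?P\<^esub> g) x \<noteq> ?z}"
          by (rule finite_subset) (simp add: fin[OF f] fin[OF g])
      qed (use val[OF f] val[OF g] out[OF f] out[OF g] in \<open>auto simp: add\<close>)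
    qed (auto simp: fun_eq_iff add zero val a_ac intro!: I)
    show "Group.monoid ?P"
    proof (rule monoidI)
      show "\<one>\<^bsub>?P\<^esub> \<in> carrier ?P"
      proof (rule I)
        have "{x. \<one>\<^bsub>?P\<^esub> x \<noteq> ?z} \<subseteq> verts Q \<times> {[]}" by (auto simp: one split: if_splits)
        then show "finite {x. \<one>\<^bsub>?P\<^esub> x \<noteq> ?z}" by (rule finite_subset) simp
        show "\<one>\<^bsub>?P\<^esub> x = ?z" if "x \<notin> quiver_paths Q" for x
          using that by (cases x) (auto simp: one quiver_paths_def awalk_Nil_iff)
      qed (auto simp: one split: prod.splits)
    next
      fix f g h assume f: "f \<in> carrier ?P" and g: "g \<in> carrier ?P" and h: "h \<in> carrier ?P"
      show "f \<otimes>\<^bsub>?P\<^esub> g \<otimes>\<^bsub>?P\<^esub> h = f \<otimes>\<^bsub>?P\<^esub> (g \<otimes>\<^bsub>?P\<^esub> h)"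
      proof
        fix x show "(f \<otimes>\<^bsub>?P\<^esub> g \<otimes>\<^bsub>?P\<^esub> h) x = (f \<otimes>\<^bsub>?P\<^esub> (g \<otimes>\<^bsub>?P\<^esub> h)) x"
        proof (cases x)
          case (Pair u p)
          define t where "t j i = f (u, take j p) \<otimes>\<^bsub>K\<^esub>
              g (?w u p j, take (i - j) (drop j p)) \<otimes>\<^bsub>K\<^esub> h (?w u p i, drop i p)" for j i
          have tc: "t j i \<in> carrier K" for j i
            using val[OF f] val[OF g] val[OF h] by (simp add: t_def)
          have "(f \<otimes>\<^bsub>?P\<^esub> g \<otimes>\<^bsub>?P\<^esub> h) (u, p) = (\<Oplus>\<^bsub>K\<^esub>i\<in>{..length p}. \<Oplus>\<^bsub>K\<^esub>j\<in>{..i}. t j i)"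
            unfolding mult
          proof (rule finsum_cong')
            fix i assume "i \<in> {..length p}"
            then have i: "i \<le> length p" by simp
            have "(\<Oplus>\<^bsub>K\<^esub>j\<in>{..length (take i p)}. f (u, take j (take i p)) \<otimes>\<^bsub>K\<^esub>
                   g (?w u (take i p) j, drop j (take i p))) \<otimes>\<^bsub>K\<^esub> h (?w u p i, drop i p)
               = (\<Oplus>\<^bsub>K\<^esub>j\<in>{..length (take i p)}. f (u, take j (take i p)) \<otimes>\<^bsub>K\<^esub>
                   g (?w u (take i p) j, drop j (take i p)) \<otimes>\<^bsub>K\<^esub> h (?w u p i, drop i p))"
              using val[OF f] val[OF g] val[OF h] by (intro finsum_ldistr) auto
            also have "\<dots> = (\<Oplus>\<^bsub>K\<^esub>j\<in>{..i}. t j i)"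
              using i tc by (intro finsum_cong') (auto simp: t_def min_absorb1 drop_take)
            finally show "(\<Oplus>\<^bsub>K\<^esub>j\<in>{..length (take i p)}. f (u, take j (take i p)) \<otimes>\<^bsub>K\<^esub>
                   g (?w u (take i p) j, drop j (take i p))) \<otimes>\<^bsub>K\<^esub> h (?w u p i, drop i p)
               = (\<Oplus>\<^bsub>K\<^esub>j\<in>{..i}. t j i)" .
          qed (use tc in \<open>auto intro!: finsum_closed\<close>)
          also have "\<dots> = (\<Oplus>\<^bsub>K\<^esub>j\<in>{..length p}. \<Oplus>\<^bsub>K\<^esub>k\<in>{..length p - j}. t j (j + k))"
            by (rule finsum_triangle[OF tc])
          also have "\<dots> = (f \<otimes>\<^bsub>?P\<^esub> (g \<otimes>\<^bsub>?P\<^esub> h)) (u, p)"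
            unfolding mult
          proof (rule finsum_cong')
            fix j assume "j \<in> {..length p}"
            then have j: "j \<le> length p" by simp
            have w: "awlast (?w u p j) (take k (drop j p)) = ?w u p (j + k)" for k
              unfolding take_add awlast_append' ..
            have "(\<Oplus>\<^bsub>K\<^esub>k\<in>{..length p - j}. t j (j + k)) =
                (\<Oplus>\<^bsub>K\<^esub>k\<in>{..length p - j}. f (u, take j p) \<otimes>\<^bsub>K\<^esub> (g (?w u p j, take k (drop j p)) \<otimes>\<^bsub>K\<^esub>
                   h (awlast (?w u p j) (take k (drop j p)), drop k (drop j p))))"
              using val[OF f] val[OF g] val[OF h]
              by (intro finsum_cong') (auto simp: t_def w m_assoc add.commute)
            also have "\<dots> = f (u, take j p) \<otimes>\<^bsub>K\<^esub> (\<Oplus>\<^bsub>K\<^esub>k\<in>{..length p - j}. g (?w u p j, take k (drop j p)) \<otimes>\<^bsub>K\<^esub>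
                   h (awlast (?w u p j) (take k (drop j p)), drop k (drop j p)))"
              using val[OF f] val[OF g] val[OF h] by (intro finsum_rdistr[symmetric]) auto
            finally show "(\<Oplus>\<^bsub>K\<^esub>k\<in>{..length p - j}. t j (j + k)) = f (u, take j p) \<otimes>\<^bsub>K\<^esub>
                (\<Oplus>\<^bsub>K\<^esub>k\<in>{..length (drop j p)}. g (?w u p j, take k (drop j p)) \<otimes>\<^bsub>K\<^esub>
                   h (awlast (?w u p j) (take k (drop j p)), drop k (drop j p)))"
              by simp
          qed (use val[OF f] val[OF g] val[OF h] in \<open>auto intro!: finsum_closed m_closed\<close>)
          finally show ?thesis using Pair by simp
        qed
      qed
    next
      fix f assume f: "f \<in> carrier ?P"
      show "\<one>\<^bsub>?P\<^esub> \<otimes>\<^bsub>?P\<^esub> f = f"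
      proof
        fix x show "(\<one>\<^bsub>?P\<^esub> \<otimes>\<^bsub>?P\<^esub> f) x = f x"
        proof (cases x)
          case (Pair u p)
          have "(\<one>\<^bsub>?P\<^esub> \<otimes>\<^bsub>?P\<^esub> f) (u, p) =
              (\<Oplus>\<^bsub>K\<^esub>i\<in>{..length p}. if 0 = i then (if u \<in> verts Q then f (u, p) else ?z) else ?z)"
            unfolding mult using val[OF f] by (intro finsum_cong') (auto simp: one)
          also have "\<dots> = (if u \<in> verts Q then f (u, p) else ?z)"
            using val[OF f] finsum_singleton[of 0 "{..length p}" "\<lambda>_. if u \<in> verts Q then f (u, p) else ?z"]
            by auto
          also have "\<dots> = f (u, p)"
            using out[OF f, of "(u, p)"] by (auto simp: quiver_paths_def awalk_def)
          finally show ?thesis using Pair by simp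
        qed
      qed
      show "f \<otimes>\<^bsub>?P\<^esub> \<one>\<^bsub>?P\<^esub> = f"
      proof
        fix x show "(f \<otimes>\<^bsub>?P\<^esub> \<one>\<^bsub>?P\<^esub>) x = f x"
        proof (cases x)
          case (Pair u p)
          have "(f \<otimes>\<^bsub>?P\<^esub> \<one>\<^bsub>?P\<^esub>) (u, p) = (\<Oplus>\<^bsub>K\<^esub>i\<in>{..length p}.
              if length p = i then (if awlast u p \<in> verts Q then f (u, p) else ?z) else ?z)"
            unfolding mult using val[OF f] by (intro finsum_cong') (auto simp: one)
          also have "\<dots> = (if awlast u p \<in> verts Q then f (u, p) else ?z)"
            using val[OF f] finsum_singleton[of "length p" "{..length p}"
                "\<lambda>_. if awlast u p \<in> verts Q then f (u, p) else ?z"]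
            by auto
          also have "\<dots> = f (u, p)"
          proof (cases "(u, p) \<in> quiver_paths Q")
            case True
            then obtain v where "awalk u p v" by (auto simp: quiver_paths_def)
            then have "awlast u p \<in> verts Q" using awalk_last_in_verts by (metis awalkE)
            then show ?thesis by simp
          qed (use out[OF f] in auto)
          finally show ?thesis using Pair by simp
        qed
      qed
    qed (rule mult_closed)
  next
    fix f g h assume f: "f \<in> carrier ?P" and g: "g \<in> carrier ?P" and h: "h \<in> carrier ?P"
    note v = val[OF f] val[OF g] val[OF h]
    show "(f \<oplus>\<^bsub>?P\<^esub> g) \<otimes>\<^bsub>?P\<^esub> h = f \<otimes>\<^bsub>?P\<^esub> h \<oplus>\<^bsub>?P\<^esub> g \<otimes>\<^bsub>?P\<^esub> h"
    proof
      fix x show "((f \<oplus>\<^bsub>?P\<^esub> g) \<otimes>\<^bsub>?P\<^esub> h) x = (f \<otimes>\<^bsub>?P\<^esub> h \<oplus>\<^bsub>?P\<^esub> g \<otimes>\<^bsub>?P\<^esub> h) x"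
      proof (cases x)
        case (Pair u p)
        have "((f \<oplus>\<^bsub>?P\<^esub> g) \<otimes>\<^bsub>?P\<^esub> h) (u, p) = (\<Oplus>\<^bsub>K\<^esub>i\<in>{..length p}. f (u, take i p) \<otimes>\<^bsub>K\<^esub> h (?w u p i, drop i p) \<oplus>\<^bsub>K\<^esub> g (u, take i p) \<otimes>\<^bsub>K\<^esub> h (?w u p i, drop i p))"
          unfolding mult using v by (intro finsum_cong') (auto simp: add l_distr)
        also have "\<dots> = (f \<otimes>\<^bsub>?P\<^esub> h \<oplus>\<^bsub>?P\<^esub> g \<otimes>\<^bsub>?P\<^esub> h) (u, p)"
          unfolding mult add using v by (intro finsum_addf) auto
        finally show ?thesis using Pair by simp
      qed
    qed
    show "h \<otimes>\<^bsub>?P\<^esub> (f \<oplus>\<^bsub>?P\<^esub> g) = h \<otimes>\<^bsub>?P\<^esub> f \<oplus>\<^bsub>?P\<^esub> h \<otimes>\<^bsub>?P\<^esub> g"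
    proof
      fix x show "(h \<otimes>\<^bsub>?P\<^esub> (f \<oplus>\<^bsub>?P\<^esub> g)) x = (h \<otimes>\<^bsub>?P\<^esub> f \<oplus>\<^bsub>?P\<^esub> h \<otimes>\<^bsub>?P\<^esub> g) x"
      proof (cases x)
        case (Pair u p)
        have "(h \<otimes>\<^bsub>?P\<^esub> (f \<oplus>\<^bsub>?P\<^esub> g)) (u, p) = (\<Oplus>\<^bsub>K\<^esub>i\<in>{..length p}. h (u, take i p) \<otimes>\<^bsub>K\<^esub> f (?w u p i, drop i p) \<oplus>\<^bsub>K\<^esub> h (u, take i p) \<otimes>\<^bsub>K\<^esub> g (?w u p i, drop i p))"
          unfolding mult using v by (intro finsum_cong') (auto simp: add r_distr)
        also have "\<dots> = (h \<otimes>\<^bsub>?P\<^esub> f \<oplus>\<^bsub>?P\<^esub> h \<otimes>\<^bsub>?P\<^esub> g) (u, p)"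
          unfolding mult add using v by (intro finsum_addf) auto
        finally show ?thesis using Pair by simp
      qed
    qed
  qed
qed


section \<open>Existence of free resolutions\<close>

definition free_on :: "('a, 'm) ring_scheme \<Rightarrow> 'g set \<Rightarrow> ('a, 'g \<Rightarrow> 'a) right_mod" where
  "free_on A B =
    \<lparr>carrier = {f. (\<forall>g. f g \<in> carrier A) \<and> {g. f g \<noteq> \<zero>\<^bsub>A\<^esub>} \<subseteq> B \<and> finite {g. f g \<noteq> \<zero>\<^bsub>A\<^esub>}},
     mult = undefined, one = undefined, zero = (\<lambda>g. \<zero>\<^bsub>A\<^esub>),
     add = (\<lambda>f h g. f g \<oplus>\<^bsub>A\<^esub> h g), act = (\<lambda>f a g. f g \<otimes>\<^bsub>A\<^esub> a)\<rparr>"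

definition unit_vec :: "('a, 'm) ring_scheme \<Rightarrow> 'g \<Rightarrow> 'g \<Rightarrow> 'a" where
  "unit_vec A b = (\<lambda>g. if g = b then \<one>\<^bsub>A\<^esub> else \<zero>\<^bsub>A\<^esub>)"

lemma right_module_free_on:
  assumes "ring A"
  shows "right_module A (free_on A (B :: 'g set))"
proof -
  interpret ring A by fact
  have fin_add: "finite {g. f g \<oplus>\<^bsub>A\<^esub> h g \<noteq> \<zero>\<^bsub>A\<^esub>}"
    if "finite {g. f g \<noteq> \<zero>\<^bsub>A\<^esub>}" "finite {g. h g \<noteq> \<zero>\<^bsub>A\<^esub>}" for f h :: "'g \<Rightarrow> 'a"
    by (rule finite_subset[OF _ finite_UnI[OF that]]) auto
  have "abelian_group (free_on A B)"
  proof (rule abelian_groupI)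
    fix x assume x: "x \<in> carrier (free_on A B)"
    let ?y = "\<lambda>g. \<ominus>\<^bsub>A\<^esub> x g"
    have s: "{g. ?y g \<noteq> \<zero>\<^bsub>A\<^esub>} \<subseteq> {g. x g \<noteq> \<zero>\<^bsub>A\<^esub>}" by auto
    have "?y \<in> carrier (free_on A B)"
      using x finite_subset[OF s] s by (auto simp: free_on_def)
    moreover have "?y \<oplus>\<^bsub>free_on A B\<^esub> x = \<zero>\<^bsub>free_on A B\<^esub>"
      using x by (auto simp: free_on_def l_neg)
    ultimately show "\<exists>y\<in>carrier (free_on A B). y \<oplus>\<^bsub>free_on A B\<^esub> x = \<zero>\<^bsub>free_on A B\<^esub>"
      by blast
  next
    fix x y assume x: "x \<in> carrier (free_on A B)" and y: "y \<in> carrier (free_on A B)"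
    have "{g. x g \<oplus>\<^bsub>A\<^esub> y g \<noteq> \<zero>\<^bsub>A\<^esub>} \<subseteq> {g. x g \<noteq> \<zero>\<^bsub>A\<^esub>} \<union> {g. y g \<noteq> \<zero>\<^bsub>A\<^esub>}" by auto
    with x y fin_add[of x y] show "x \<oplus>\<^bsub>free_on A B\<^esub> y \<in> carrier (free_on A B)"
      by (auto simp: free_on_def)
  qed (auto simp: free_on_def a_ac)
  moreover have "right_module_axioms A (free_on A B)"
  proof
    fix x a assume x: "x \<in> carrier (free_on A B)" and a: "a \<in> carrier A"
    have s: "{g. x g \<otimes>\<^bsub>A\<^esub> a \<noteq> \<zero>\<^bsub>A\<^esub>} \<subseteq> {g. x g \<noteq> \<zero>\<^bsub>A\<^esub>}" using a by auto
    show "x \<triangleleft>\<^bsub>free_on A B\<^esub> a \<in> carrier (free_on A B)"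
      using x a finite_subset[OF s] s by (auto simp: free_on_def)
  qed (auto simp: free_on_def l_distr r_distr m_assoc)
  ultimately show ?thesis
    using assms by (simp add: right_module_def)
qed

lemma free_on_finsum:
  assumes "ring A" "t \<in> S \<rightarrow> carrier (free_on A B)"
  shows "(\<Oplus>\<^bsub>free_on A B\<^esub>s\<in>S. t s) g = (\<Oplus>\<^bsub>A\<^esub>s\<in>S. t s g)"
proof -
  interpret ring A by fact
  interpret F: right_module A "free_on A B" by (rule right_module_free_on) fact
  show ?thesis using assms(2)
  proof (induction S rule: infinite_finite_induct)
    case (insert s S)
    have *: "(\<lambda>s. t s g) \<in> S \<rightarrow> carrier A" "t s g \<in> carrier A"
      using insert.prems by (auto simp: free_on_def Pi_def)
    have "t \<in> S \<rightarrow> carrier (free_on A B)" using insert.prems by auto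
    with insert * show ?case
      by (subst F.M.finsum_insert; (simp add: Pi_def)?) (simp add: free_on_def)
  qed (auto simp: F.M.finsum_infinite, auto simp: free_on_def)
qed

lemma unit_vec_in: "ring A \<Longrightarrow> b \<in> B \<Longrightarrow> unit_vec A b \<in> carrier (free_on A B)"
proof -
  assume "ring A" "b \<in> B"
  interpret ring A by fact
  have s: "{g. unit_vec A b g \<noteq> \<zero>\<^bsub>A\<^esub>} \<subseteq> {b}" by (auto simp: unit_vec_def)
  have "finite {g. unit_vec A b g \<noteq> \<zero>\<^bsub>A\<^esub>}" using s by (rule finite_subset) simp
  moreover have "unit_vec A b g \<in> carrier A" for g by (simp add: unit_vec_def)
  ultimately show ?thesis using s \<open>b \<in> B\<close> by (auto simp: free_on_def)
qed

lemma (in right_module) act_zero [simp]: "x \<in> carrier M \<Longrightarrow> x \<triangleleft>\<^bsub>M\<^esub> \<zero>\<^bsub>A\<^esub> = \<zero>\<^bsub>M\<^esub>"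
proof -
  assume x: "x \<in> carrier M"
  have "x \<triangleleft>\<^bsub>M\<^esub> \<zero>\<^bsub>A\<^esub> \<oplus>\<^bsub>M\<^esub> x \<triangleleft>\<^bsub>M\<^esub> \<zero>\<^bsub>A\<^esub> = x \<triangleleft>\<^bsub>M\<^esub> \<zero>\<^bsub>A\<^esub>"
    using act_add_right[OF x A.zero_closed A.zero_closed] by simp
  then show ?thesis using x by simp
qed

lemma (in right_module) zero_act [simp]: "a \<in> carrier A \<Longrightarrow> \<zero>\<^bsub>M\<^esub> \<triangleleft>\<^bsub>M\<^esub> a = \<zero>\<^bsub>M\<^esub>"
proof -
  assume a: "a \<in> carrier A"
  have "\<zero>\<^bsub>M\<^esub> \<triangleleft>\<^bsub>M\<^esub> a \<oplus>\<^bsub>M\<^esub> \<zero>\<^bsub>M\<^esub> \<triangleleft>\<^bsub>M\<^esub> a = \<zero>\<^bsub>M\<^esub> \<triangleleft>\<^bsub>M\<^esub> a"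
    using act_add_left[OF M.zero_closed M.zero_closed a] by simp
  then show ?thesis using a by simp
qed

lemma free_module_free_on:
  assumes "ring A"
  shows "free_module A (free_on A (B :: 'g set))"
proof -
  interpret ring A by fact
  let ?F = "free_on A B"
  interpret F: right_module A ?F by (rule right_module_free_on) fact
  let ?E = "unit_vec A ` B"
  have E: "?E \<subseteq> carrier ?F" using unit_vec_in[OF assms] by auto
  have uniq: "\<exists>!c. c \<in> ?E \<rightarrow>\<^sub>E carrier A \<and> finite {b \<in> ?E. c b \<noteq> \<zero>\<^bsub>A\<^esub>} \<and>
         x = (\<Oplus>\<^bsub>?F\<^esub>b\<in>{b \<in> ?E. c b \<noteq> \<zero>\<^bsub>A\<^esub>}. b \<triangleleft>\<^bsub>?F\<^esub> c b)" (is "\<exists>!c. ?P c")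
    if x: "x \<in> carrier ?F" for x
  proof (cases "\<one>\<^bsub>A\<^esub> = \<zero>\<^bsub>A\<^esub>")
    case True
    then have A0: "carrier A = {\<zero>\<^bsub>A\<^esub>}"
      using one_zeroD by blast
    have x0: "x = \<zero>\<^bsub>?F\<^esub>" using x by (auto simp: free_on_def A0)
    show ?thesis
    proof (rule ex1I)
      have "{b \<in> ?E. (\<lambda>e\<in>?E. \<zero>\<^bsub>A\<^esub>) b \<noteq> \<zero>\<^bsub>A\<^esub>} = {}" by auto
      then show "?P (\<lambda>e\<in>?E. \<zero>\<^bsub>A\<^esub>)"
        by (simp only:) (auto simp: x0)
    next
      fix c assume "?P c"
      then have "c \<in> ?E \<rightarrow>\<^sub>E {\<zero>\<^bsub>A\<^esub>}" by (simp add: A0)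
      then show "c = (\<lambda>e\<in>?E. \<zero>\<^bsub>A\<^esub>)" by (force simp: PiE_def extensional_def)
    qed
  next
    case False
    have inj: "unit_vec A b = unit_vec A b' \<longleftrightarrow> b = b'" for b b' :: 'g
      using False by (auto simp: unit_vec_def fun_eq_iff)
    have key: "(\<Oplus>\<^bsub>?F\<^esub>b\<in>{b \<in> ?E. c b \<noteq> \<zero>\<^bsub>A\<^esub>}. b \<triangleleft>\<^bsub>?F\<^esub> c b) g
          = (if g \<in> B then c (unit_vec A g) else \<zero>\<^bsub>A\<^esub>)"
      if c: "c \<in> ?E \<rightarrow>\<^sub>E carrier A" "finite {b \<in> ?E. c b \<noteq> \<zero>\<^bsub>A\<^esub>}" for c g
    proof -
      let ?S = "{b \<in> ?E. c b \<noteq> \<zero>\<^bsub>A\<^esub>}"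
      have cE: "c e \<in> carrier A" if "e \<in> ?E" for e using c(1) that by (rule PiE_mem)
      have "(\<Oplus>\<^bsub>?F\<^esub>b\<in>?S. b \<triangleleft>\<^bsub>?F\<^esub> c b) g = (\<Oplus>\<^bsub>A\<^esub>b\<in>?S. (b \<triangleleft>\<^bsub>?F\<^esub> c b) g)"
      proof (rule free_on_finsum[OF assms], rule Pi_I)
        fix b assume "b \<in> ?S"
        with E cE show "b \<triangleleft>\<^bsub>?F\<^esub> c b \<in> carrier ?F" by auto
      qed
      also have "\<dots> = (\<Oplus>\<^bsub>A\<^esub>b\<in>?S. if unit_vec A g = b then c b else \<zero>\<^bsub>A\<^esub>)"
      proof (rule finsum_cong')
        fix b assume b: "b \<in> ?S"
        then obtain h where h: "b = unit_vec A h" by auto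
        have "c b \<in> carrier A" using b cE by auto
        then show "(b \<triangleleft>\<^bsub>?F\<^esub> c b) g = (if unit_vec A g = b then c b else \<zero>\<^bsub>A\<^esub>)"
          by (simp add: h inj) (simp add: free_on_def unit_vec_def)
      qed (use cE in auto)
      also have "\<dots> = (if g \<in> B then c (unit_vec A g) else \<zero>\<^bsub>A\<^esub>)"
      proof (cases "unit_vec A g \<in> ?S")
        case True
        then have "g \<in> B" using inj by auto
        have "(\<Oplus>\<^bsub>A\<^esub>b\<in>?S. if unit_vec A g = b then c b else \<zero>\<^bsub>A\<^esub>) = c (unit_vec A g)"
          using finsum_singleton[of "unit_vec A g" ?S c] True c(2) cE by auto
        then show ?thesis using \<open>g \<in> B\<close> by simp
      next
        case n: False
        have "(\<Oplus>\<^bsub>A\<^esub>b\<in>?S. if unit_vec A g = b then c b else \<zero>\<^bsub>A\<^esub>) = (\<Oplus>\<^bsub>A\<^esub>b\<in>?S. \<zero>\<^bsub>A\<^esub>)"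
          using n by (intro finsum_cong') auto
        then show ?thesis using n inj by auto
      qed
      finally show ?thesis .
    qed
    define c where "c = (\<lambda>e\<in>?E. x (THE b. e = unit_vec A b))"
    have c_unit: "c (unit_vec A b) = x b" if "b \<in> B" for b
      using that by (simp add: c_def inj)
    have out: "x b = \<zero>\<^bsub>A\<^esub>" if "b \<notin> B" for b using x that by (auto simp: free_on_def)
    have xc: "x b \<in> carrier A" for b using x by (simp add: free_on_def)
    have "{b \<in> ?E. c b \<noteq> \<zero>\<^bsub>A\<^esub>} \<subseteq> unit_vec A ` {b. x b \<noteq> \<zero>\<^bsub>A\<^esub>}"
      using c_unit by auto
    then have fin: "finite {b \<in> ?E. c b \<noteq> \<zero>\<^bsub>A\<^esub>}"
      by (rule finite_subset) (use x in \<open>simp add: free_on_def\<close>)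
    have cP: "c \<in> ?E \<rightarrow>\<^sub>E carrier A" by (auto simp: c_def xc)
    show ?thesis
    proof (rule ex1I)
      have "x = (\<Oplus>\<^bsub>?F\<^esub>b\<in>{b \<in> ?E. c b \<noteq> \<zero>\<^bsub>A\<^esub>}. b \<triangleleft>\<^bsub>?F\<^esub> c b)"
        using out by (auto simp: fun_eq_iff key[OF cP fin] c_unit)
      with cP fin show "?P c" by blast
    next
      fix c' assume c': "?P c'"
      show "c' = c"
      proof
        fix e
        show "c' e = c e"
        proof (cases "e \<in> ?E")
          case True
          then obtain b where b: "b \<in> B" "e = unit_vec A b" by auto
          have "x b = c' (unit_vec A b)" using c' key[of c' b] b by auto
          then show ?thesis using b c_unit by simp
        next
          case e: False
          have "c' e = undefined" using c' e by (blast intro: PiE_arb)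
          moreover have "c e = undefined" using cP e by (rule PiE_arb)
          ultimately show ?thesis by simp
        qed
      qed
    qed
  qed
  show ?thesis
    unfolding free_module_def
    by (intro conjI exI[of _ ?E] ballI) (rule F.right_module_axioms, rule E, rule uniq)
qed

definition free_ext ::
  "('a, 'm) ring_scheme \<Rightarrow> ('a, 'x) right_mod \<Rightarrow> 'g set \<Rightarrow> ('g \<Rightarrow> 'x) \<Rightarrow> ('g \<Rightarrow> 'a) \<Rightarrow> 'x" where
  "free_ext A N B t =
    (\<lambda>f\<in>carrier (free_on A B). \<Oplus>\<^bsub>N\<^esub>g\<in>{g. f g \<noteq> \<zero>\<^bsub>A\<^esub>}. t g \<triangleleft>\<^bsub>N\<^esub> f g)"

lemma free_ext_superset:
  assumes "right_module A N" "t \<in> B \<rightarrow> carrier N" "f \<in> carrier (free_on A B)"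
    and "finite S" "S \<subseteq> B" "{g. f g \<noteq> \<zero>\<^bsub>A\<^esub>} \<subseteq> S"
  shows "free_ext A N B t f = (\<Oplus>\<^bsub>N\<^esub>g\<in>S. t g \<triangleleft>\<^bsub>N\<^esub> f g)"
proof -
  interpret right_module A N by fact
  have f: "f g \<in> carrier A" for g using assms(3) by (simp add: free_on_def)
  have t: "t g \<in> carrier N" if "g \<in> S" for g using assms(2,5) that by auto
  have "(\<Oplus>\<^bsub>N\<^esub>g\<in>{g. f g \<noteq> \<zero>\<^bsub>A\<^esub>}. t g \<triangleleft>\<^bsub>N\<^esub> f g) = (\<Oplus>\<^bsub>N\<^esub>g\<in>S. t g \<triangleleft>\<^bsub>N\<^esub> f g)"
    by (rule M.add.finprod_mono_neutral_cong_left) (use assms f t in auto)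
  then show ?thesis using assms(3) by (simp add: free_ext_def)
qed

lemma free_ext_unit_vec:
  assumes "right_module A N" "t \<in> B \<rightarrow> carrier N" "b \<in> B"
  shows "free_ext A N B t (unit_vec A b) = t b"
proof -
  interpret right_module A N by fact
  have t: "t b \<in> carrier N" using assms by auto
  have "free_ext A N B t (unit_vec A b) = (\<Oplus>\<^bsub>N\<^esub>g\<in>{b}. t g \<triangleleft>\<^bsub>N\<^esub> unit_vec A b g)"
    using assms A.ring_axioms
    by (intro free_ext_superset unit_vec_in) (auto simp: unit_vec_def split: if_splits)
  also have "\<dots> = t b" using t by (simp add: unit_vec_def)
  finally show ?thesis .
qed

lemma (in right_module) finsum_act:
  assumes "finite S" "t \<in> S \<rightarrow> carrier M" "a \<in> carrier A"
  shows "(\<Oplus>\<^bsub>M\<^esub>s\<in>S. t s) \<triangleleft>\<^bsub>M\<^esub> a = (\<Oplus>\<^bsub>M\<^esub>s\<in>S. t s \<triangleleft>\<^bsub>M\<^esub> a)"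
  using assms
proof (induction S)
  case (insert s S)
  then have "t \<in> S \<rightarrow> carrier M" "t s \<in> carrier M" by auto
  with insert show ?case by (simp add: act_add_left Pi_def)
qed simp

lemma free_ext_hom:
  assumes "right_module A N" "t \<in> B \<rightarrow> carrier N"
  shows "free_ext A N B t \<in> rmod_hom A (free_on A B) N"
proof -
  interpret right_module A N by fact
  let ?F = "free_on A B"
  interpret F: right_module A ?F by (rule right_module_free_on) (rule A.ring_axioms)
  note sup = free_ext_superset[OF assms]
  have carr: "f g \<in> carrier A" if "f \<in> carrier ?F" for f g using that by (simp add: free_on_def)
  have t: "t g \<in> carrier N" if "g \<in> B" for g using assms(2) that by auto
  have supp: "finite {g. f g \<noteq> \<zero>\<^bsub>A\<^esub>}" "{g. f g \<noteq> \<zero>\<^bsub>A\<^esub>} \<subseteq> B" if "f \<in> carrier ?F" for f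
    using that by (auto simp: free_on_def)
  show ?thesis unfolding rmod_hom_def
  proof (intro CollectI conjI ballI)
    show "free_ext A N B t \<in> carrier ?F \<rightarrow>\<^sub>E carrier N"
    proof (rule PiE_I)
      fix f assume f: "f \<in> carrier ?F"
      then show "free_ext A N B t f \<in> carrier N"
        using carr[OF f] t supp(2)[OF f] by (auto simp: free_ext_def intro!: M.finsum_closed)
    qed (simp add: free_ext_def)
  next
    fix x y assume x: "x \<in> carrier ?F" and y: "y \<in> carrier ?F"
    let ?S = "{g. x g \<noteq> \<zero>\<^bsub>A\<^esub>} \<union> {g. y g \<noteq> \<zero>\<^bsub>A\<^esub>}"
    have S: "finite ?S" "?S \<subseteq> B" using supp[OF x] supp[OF y] by auto
    have xy: "(x \<oplus>\<^bsub>?F\<^esub> y) g = x g \<oplus>\<^bsub>A\<^esub> y g" for g by (simp add: free_on_def)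
    have "free_ext A N B t (x \<oplus>\<^bsub>?F\<^esub> y) = (\<Oplus>\<^bsub>N\<^esub>g\<in>?S. t g \<triangleleft>\<^bsub>N\<^esub> (x \<oplus>\<^bsub>?F\<^esub> y) g)"
      using x y S by (intro sup) (auto simp: xy)
    also have "\<dots> = (\<Oplus>\<^bsub>N\<^esub>g\<in>?S. t g \<triangleleft>\<^bsub>N\<^esub> x g \<oplus>\<^bsub>N\<^esub> t g \<triangleleft>\<^bsub>N\<^esub> y g)"
    proof (rule M.finsum_cong')
      fix g assume "g \<in> ?S"
      then have "t g \<in> carrier N" using S t by blast
      then show "t g \<triangleleft>\<^bsub>N\<^esub> (x \<oplus>\<^bsub>?F\<^esub> y) g = t g \<triangleleft>\<^bsub>N\<^esub> x g \<oplus>\<^bsub>N\<^esub> t g \<triangleleft>\<^bsub>N\<^esub> y g"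
        using carr[OF x] carr[OF y] by (simp add: xy act_add_right)
    next
      show "(\<lambda>g. t g \<triangleleft>\<^bsub>N\<^esub> x g \<oplus>\<^bsub>N\<^esub> t g \<triangleleft>\<^bsub>N\<^esub> y g) \<in> ?S \<rightarrow> carrier N"
        using S t carr[OF x] carr[OF y] by blast
    qed simp
    also have "\<dots> = (\<Oplus>\<^bsub>N\<^esub>g\<in>?S. t g \<triangleleft>\<^bsub>N\<^esub> x g) \<oplus>\<^bsub>N\<^esub> (\<Oplus>\<^bsub>N\<^esub>g\<in>?S. t g \<triangleleft>\<^bsub>N\<^esub> y g)"
      using S t carr[OF x] carr[OF y] by (intro M.finsum_addf) blast+
    also have "\<dots> = free_ext A N B t x \<oplus>\<^bsub>N\<^esub> free_ext A N B t y"
      using sup[OF x S] sup[OF y S] by auto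
    finally show "free_ext A N B t (x \<oplus>\<^bsub>?F\<^esub> y) = free_ext A N B t x \<oplus>\<^bsub>N\<^esub> free_ext A N B t y" .
  next
    fix x a assume x: "x \<in> carrier ?F" and a: "a \<in> carrier A"
    let ?S = "{g. x g \<noteq> \<zero>\<^bsub>A\<^esub>}"
    note S = supp[OF x]
    have xa: "(x \<triangleleft>\<^bsub>?F\<^esub> a) g = x g \<otimes>\<^bsub>A\<^esub> a" for g by (simp add: free_on_def)
    have tS: "t g \<in> carrier N" if "g \<in> ?S" for g using that S(2) t by blast
    have "free_ext A N B t (x \<triangleleft>\<^bsub>?F\<^esub> a) = (\<Oplus>\<^bsub>N\<^esub>g\<in>?S. t g \<triangleleft>\<^bsub>N\<^esub> (x \<triangleleft>\<^bsub>?F\<^esub> a) g)"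
      using x a S by (intro sup) (auto simp: xa)
    also have "\<dots> = (\<Oplus>\<^bsub>N\<^esub>g\<in>?S. (t g \<triangleleft>\<^bsub>N\<^esub> x g) \<triangleleft>\<^bsub>N\<^esub> a)"
      using tS carr[OF x] a by (intro M.finsum_cong') (auto simp: xa act_mult)
    also have "\<dots> = (\<Oplus>\<^bsub>N\<^esub>g\<in>?S. t g \<triangleleft>\<^bsub>N\<^esub> x g) \<triangleleft>\<^bsub>N\<^esub> a"
      using tS carr[OF x] a S by (intro finsum_act[symmetric]) auto
    also have "\<dots> = free_ext A N B t x \<triangleleft>\<^bsub>N\<^esub> a" using x by (simp add: free_ext_def)
    finally show "free_ext A N B t (x \<triangleleft>\<^bsub>?F\<^esub> a) = free_ext A N B t x \<triangleleft>\<^bsub>N\<^esub> a" .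
  qed
qed

definition is_submod :: "('a, 'm) ring_scheme \<Rightarrow> ('a, 'x) right_mod \<Rightarrow> 'x set \<Rightarrow> bool" where
  "is_submod A M S \<longleftrightarrow> S \<subseteq> carrier M \<and> \<zero>\<^bsub>M\<^esub> \<in> S \<and> (\<forall>x\<in>S. \<forall>y\<in>S. x \<oplus>\<^bsub>M\<^esub> y \<in> S) \<and>
     (\<forall>x\<in>S. \<forall>a\<in>carrier A. x \<triangleleft>\<^bsub>M\<^esub> a \<in> S)"

lemma is_submod_ker:
  assumes "right_module A M" "right_module A N" "f \<in> rmod_hom A M N"
  shows "is_submod A M (rmod_ker M N f)"
proof -
  interpret M: right_module A M by fact
  interpret N: right_module A N by fact
  have c: "f \<zero>\<^bsub>M\<^esub> \<in> carrier N" using assms(3) by (auto simp: rmod_hom_def)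
  have "f \<zero>\<^bsub>M\<^esub> = f (\<zero>\<^bsub>M\<^esub> \<triangleleft>\<^bsub>M\<^esub> \<zero>\<^bsub>A\<^esub>)" by simp
  also have "\<dots> = f \<zero>\<^bsub>M\<^esub> \<triangleleft>\<^bsub>N\<^esub> \<zero>\<^bsub>A\<^esub>"
    using assms(3) M.A.zero_closed M.M.zero_closed unfolding rmod_hom_def by blast
  also have "\<dots> = \<zero>\<^bsub>N\<^esub>" using c by simp
  finally show ?thesis
    using assms(3) by (auto simp: is_submod_def rmod_ker_def rmod_hom_def)
qed

lemma is_submod_finsum:
  assumes "right_module A M" "is_submod A M S" "t \<in> T \<rightarrow> S"
  shows "(\<Oplus>\<^bsub>M\<^esub>s\<in>T. t s) \<in> S"
proof -
  interpret M: right_module A M by fact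
  have S: "S \<subseteq> carrier M" using assms by (simp add: is_submod_def)
  show ?thesis using assms(3)
  proof (induction T rule: infinite_finite_induct)
    case (insert s T)
    have "(\<Oplus>\<^bsub>M\<^esub>s\<in>insert s T. t s) = t s \<oplus>\<^bsub>M\<^esub> (\<Oplus>\<^bsub>M\<^esub>s\<in>T. t s)"
      using insert S by (intro M.M.finsum_insert) auto
    with insert assms(2) show ?case by (auto simp: is_submod_def)
  qed (use assms(2) in \<open>auto simp: M.M.finsum_infinite is_submod_def\<close>)
qed

lemma resolution_step:
  fixes A :: "('a, 'm) ring_scheme" and B :: "('x, 'a) gen set"
  assumes "ring A" "is_submod A (free_on A B) S"
  shows "\<exists>(B' :: ('x, 'a) gen set) d. d \<in> rmod_hom A (free_on A B') (free_on A B) \<and>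
           d ` carrier (free_on A B') = S"
proof -
  interpret F: right_module A "free_on A B" by (rule right_module_free_on) fact
  define val :: "(('x, 'a) gen \<times> 'a) list \<Rightarrow> ('x, 'a) gen \<Rightarrow> 'a"
    where "val l = (\<lambda>g. case map_of l g of None \<Rightarrow> \<zero>\<^bsub>A\<^esub> | Some a \<Rightarrow> a)" for l
  define t where "t g = (case g of Comb l \<Rightarrow> val l | Elt _ \<Rightarrow> undefined)" for g
  define B' where "B' = {g. \<exists>l. g = Comb l \<and> val l \<in> S}"
  have SF: "S \<subseteq> carrier (free_on A B)" using assms by (simp add: is_submod_def)
  have tS: "t \<in> B' \<rightarrow> S" by (auto simp: B'_def t_def)
  then have t: "t \<in> B' \<rightarrow> carrier (free_on A B)" using SF by blast
  let ?d = "free_ext A (free_on A B) B' t"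
  have "?d f \<in> S" if f: "f \<in> carrier (free_on A B')" for f
  proof -
    have "{g. f g \<noteq> \<zero>\<^bsub>A\<^esub>} \<subseteq> B'" "\<And>g. f g \<in> carrier A" using f by (auto simp: free_on_def)
    then have "(\<lambda>g. t g \<triangleleft>\<^bsub>free_on A B\<^esub> f g) \<in> {g. f g \<noteq> \<zero>\<^bsub>A\<^esub>} \<rightarrow> S"
      using tS assms(2) by (auto simp: is_submod_def Pi_def)
    from is_submod_finsum[OF F.right_module_axioms assms(2) this]
    show ?thesis using f by (simp add: free_ext_def)
  qed
  moreover have "s \<in> ?d ` carrier (free_on A B')" if s: "s \<in> S" for s
  proof -
    have "finite {g. s g \<noteq> \<zero>\<^bsub>A\<^esub>}" using s SF by (auto simp: free_on_def)
    then obtain xs where xs: "set xs = {g. s g \<noteq> \<zero>\<^bsub>A\<^esub>}" using finite_list by blast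
    let ?l = "map (\<lambda>g. (g, s g)) xs"
    have val: "val ?l = s"
      by (auto simp: val_def map_of_map_restrict restrict_map_def xs fun_eq_iff)
    then have B': "Comb ?l \<in> B'" using s by (auto simp: B'_def)
    then have "?d (unit_vec A (Comb ?l)) = s"
      using free_ext_unit_vec[OF F.right_module_axioms t B'] val by (simp add: t_def)
    then show ?thesis using unit_vec_in[OF assms(1) B'] by (intro image_eqI[of s]) auto
  qed
  ultimately have "?d ` carrier (free_on A B') = S" by blast
  with free_ext_hom[OF F.right_module_axioms t] show ?thesis by blast
qed

lemma free_resolution_exists:
  fixes A :: "('a, 'm) ring_scheme" and M :: "('a, 'x) right_mod"
  assumes "right_module A M"
  shows "\<exists>R :: (nat \<Rightarrow> ('a, ('x, 'a) gen \<Rightarrow> 'a) right_mod) \<times>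
      (nat \<Rightarrow> (('x, 'a) gen \<Rightarrow> 'a) \<Rightarrow> (('x, 'a) gen \<Rightarrow> 'a)) \<times> ((('x, 'a) gen \<Rightarrow> 'a) \<Rightarrow> 'x).
    free_resolution A M R"
proof -
  interpret right_module A M by fact
  note A = A.ring_axioms
  define B0 :: "('x, 'a) gen set" where "B0 = Elt ` carrier M"
  define t :: "('x, 'a) gen \<Rightarrow> 'x" where "t g = (case g of Elt x \<Rightarrow> x | Comb _ \<Rightarrow> undefined)" for g
  have t: "t \<in> B0 \<rightarrow> carrier M" by (auto simp: B0_def t_def)
  define \<epsilon> where "\<epsilon> = free_ext A M B0 t"
  have \<epsilon>: "\<epsilon> \<in> rmod_hom A (free_on A B0) M"
    unfolding \<epsilon>_def by (rule free_ext_hom[OF assms t])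
  have "x \<in> \<epsilon> ` carrier (free_on A B0)" if "x \<in> carrier M" for x
  proof -
    have "Elt x \<in> B0" using that by (simp add: B0_def)
    from free_ext_unit_vec[OF assms t this] unit_vec_in[OF A this]
    show ?thesis by (force simp: \<epsilon>_def t_def)
  qed
  then have surj: "\<epsilon> ` carrier (free_on A B0) = carrier M"
    using \<epsilon> by (auto simp: rmod_hom_def)
  let ?P = "\<lambda>(n::nat) (B, S). is_submod A (free_on A B) S \<and>
              (n = 0 \<longrightarrow> B = B0 \<and> S = rmod_ker (free_on A B0) M \<epsilon>)"
  let ?Q = "\<lambda>(n::nat) (B, S) (B', S'). \<exists>d \<in> rmod_hom A (free_on A B') (free_on A B).
              d ` carrier (free_on A B') = S \<and> S' = rmod_ker (free_on A B') (free_on A B) d"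
  have "\<exists>s. \<forall>n. ?P n (s n) \<and> ?Q n (s n) (s (Suc n))"
  proof (rule dependent_nat_choice)
    show "\<exists>s. ?P 0 s"
      using is_submod_ker[OF right_module_free_on[OF A] assms \<epsilon>] by auto
  next
    fix s n assume P: "?P n s"
    obtain B S where s: "s = (B, S)" by fastforce
    with P obtain B' :: "('x, 'a) gen set" and d where d: "d \<in> rmod_hom A (free_on A B') (free_on A B)"
      "d ` carrier (free_on A B') = S"
      using resolution_step[OF A, of B S] by auto
    let ?s = "(B', rmod_ker (free_on A B') (free_on A B) d)"
    have "?P (Suc n) ?s"
      using is_submod_ker[OF right_module_free_on[OF A] right_module_free_on[OF A] d(1)] by simp
    moreover have "?Q n s ?s" using d s by auto
    ultimately show "\<exists>s'. ?P (Suc n) s' \<and> ?Q n s s'" by blast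
  qed
  then obtain s where "\<forall>n. ?P n (s n) \<and> ?Q n (s n) (s (Suc n))" by (rule exE)
  then have s: "?P n (s n)" "?Q n (s n) (s (Suc n))" for n by simp_all
  define F where "F n = free_on A (fst (s n))" for n
  have "\<forall>n. \<exists>d. d \<in> rmod_hom A (F (Suc n)) (F n) \<and> d ` carrier (F (Suc n)) = snd (s n) \<and>
          snd (s (Suc n)) = rmod_ker (F (Suc n)) (F n) d"
  proof
    fix n
    show "\<exists>d. d \<in> rmod_hom A (F (Suc n)) (F n) \<and> d ` carrier (F (Suc n)) = snd (s n) \<and>
          snd (s (Suc n)) = rmod_ker (F (Suc n)) (F n) d"
      using s(2)[of n] by (auto simp: F_def split_beta)
  qed
  then obtain d where d: "\<And>n. d n \<in> rmod_hom A (F (Suc n)) (F n)"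
      "\<And>n. d n ` carrier (F (Suc n)) = snd (s n)"
      "\<And>n. snd (s (Suc n)) = rmod_ker (F (Suc n)) (F n) (d n)"
    by metis
  have F0: "F 0 = free_on A B0" "snd (s 0) = rmod_ker (F 0) M \<epsilon>"
    using s(1)[of 0] by (auto simp: F_def split_beta)
  have free: "free_module A (F n)" for n unfolding F_def by (rule free_module_free_on[OF A])
  have "free_resolution A M (F, d, \<epsilon>)"
    using free d \<epsilon> surj F0 by (simp add: free_resolution_def)
  then show ?thesis by blast
qed

end

theory Submission
  imports Defs
begin

text \<open>Suppose that \<open>Ext\<^sup>d(M, A) = 0\<close> for all \<open>d\<close>. The modules \<open>N\<close> with \<open>Ext\<^sup>d(M, N) = 0\<close> for all
  \<open>d\<close> are closed under direct summands, finite direct sums and cokernels of monomorphisms. So they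
  include \<open>eA\<close> for the idempotents \<open>e\<close> of the vertices and, by the exact sequences
  \<open>0 \<rightarrow> bA \<rightarrow> eA \<rightarrow> aA \<rightarrow> 0\<close> with \<open>ab\<close> a relation, \<open>aA\<close> for every arrow \<open>a\<close> that does not lie on an
  oriented cycle with full relations.

  Every simple module embeds into some \<open>A / Y\<close> where \<open>Y\<close> is a right ideal in this class. For the
  simple module at \<open>w\<close> take \<open>Y = rad(eA)\<close> if no arrow out of \<open>w\<close> lies on a full cycle. Otherwise
  let \<open>a\<close> be the predecessor, in its cycle, of such an arrow out of \<open>w\<close>. If no arrow \<open>b\<close> out of
  \<open>w\<close> with \<open>ab \<noteq> 0\<close> lies on a full cycle, take for \<open>Y\<close> the radical of \<open>aA\<close>. If some \<open>b\<close> does, with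
  predecessor \<open>a'\<close>, take \<open>Y = (a' - a)A\<close>; this is isomorphic to \<open>eA\<close>, and the class of \<open>a'\<close> spans
  the simple module. As \<open>Hom(M, A / Y) = 0\<close>, the module \<open>M\<close> has no simple quotient, so \<open>M = M J\<close> for
  the nilpotent arrow ideal \<open>J\<close>, and \<open>M = 0\<close>.\<close>

section \<open>Linear maps out of free modules\<close>

text \<open>All coefficient modules are right ideals of \<open>A\<close> or quotients of
  \<open>A\<close> by them. A cochain with values in a right ideal is a cochain with values in
  \<open>A\<close> whose image lies there, so each use of a long exact sequence becomes an explicit
  lift and correction of such cochains. Hom(M, A) = 0 by itself only excludes simple quotients of
  \<open>M\<close> that embed into \<open>A\<close>. Passing to A / Y reaches the remaining simple
  modules, since Hom(M, A / Y) sits between Hom(M, A) and Ext^1(M, Y); the price is that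
  \<open>Y\<close> has to belong to the class. The obstacle is an arrow a on a full cycle: the exact
  sequences for aA run around the cycle for ever, aA has infinite projective dimension, and an
  induction along the relations never starts. The element a' - a gets round this. By gentleness
  every arrow out of \<open>w\<close> is killed by exactly one of a and a', so left multiplication
  by a' - a is injective on eA although neither a nor a' is injective there.\<close>

definition rlin :: "('a, 'm) ring_scheme \<Rightarrow> ('a, 'x) right_mod \<Rightarrow> ('a, 'y) right_mod \<Rightarrow> ('x \<Rightarrow> 'y) \<Rightarrow> bool" where
  "rlin A M N f \<longleftrightarrow> f \<in> carrier M \<rightarrow> carrier N \<and>
     (\<forall>x\<in>carrier M. \<forall>y\<in>carrier M. f (x \<oplus>\<^bsub>M\<^esub> y) = f x \<oplus>\<^bsub>N\<^esub> f y) \<and>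
     (\<forall>x\<in>carrier M. \<forall>a\<in>carrier A. f (x \<triangleleft>\<^bsub>M\<^esub> a) = f x \<triangleleft>\<^bsub>N\<^esub> a)"

lemma rmod_hom_imp_rlin: "f \<in> rmod_hom A M N \<Longrightarrow> rlin A M N f"
  by (auto simp: rmod_hom_def rlin_def)

lemma rlin_cong:
  assumes "right_module A M" "rlin A M N f" "\<And>x. x \<in> carrier M \<Longrightarrow> g x = f x"
  shows "rlin A M N g"
proof -
  interpret right_module A M by fact
  show ?thesis using assms(2,3) by (auto simp: rlin_def Pi_def)
qed

text \<open>The way back from \<open>rlin\<close> to the extensional maps of
  \<open>rmod_hom\<close>. Values of an \<open>rlin\<close> map off the carrier are arbitrary, so
  sums and composites remain plain lambda terms until an extensional map is required.\<close>

lemma restrict_in_rmod_hom: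
  assumes "right_module A M" "rlin A M N f"
  shows "restrict f (carrier M) \<in> rmod_hom A M N"
proof -
  interpret right_module A M by fact
  show ?thesis using assms(2) by (auto simp: rlin_def rmod_hom_def)
qed

lemma rlin_compose: "rlin A L M f \<Longrightarrow> rlin A M N g \<Longrightarrow> rlin A L N (\<lambda>x. g (f x))"
  by (auto simp: rlin_def Pi_def)

lemma rlin_zero:
  assumes "right_module A M" "right_module A N" "rlin A M N f"
  shows "f \<zero>\<^bsub>M\<^esub> = \<zero>\<^bsub>N\<^esub>"
proof -
  interpret M: right_module A M by fact
  interpret N: right_module A N by fact
  have "f \<zero>\<^bsub>M\<^esub> \<in> carrier N" using assms(3) by (auto simp: rlin_def)
  moreover have "f \<zero>\<^bsub>M\<^esub> = f \<zero>\<^bsub>M\<^esub> \<oplus>\<^bsub>N\<^esub> f \<zero>\<^bsub>M\<^esub>"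
    using assms(3) M.M.zero_closed unfolding rlin_def by (metis M.M.l_zero)
  ultimately show ?thesis by simp
qed

lemma rlin_add:
  assumes "right_module A M" "right_module A N" "rlin A M N f" "rlin A M N g"
  shows "rlin A M N (\<lambda>x. f x \<oplus>\<^bsub>N\<^esub> g x)"
proof -
  interpret M: right_module A M by fact
  interpret N: right_module A N by fact
  show ?thesis using assms(3,4)
    by (auto simp: rlin_def Pi_def N.act_add_left N.M.a_ac)
qed

lemma (in right_module) minus_act:
  assumes "x \<in> carrier M" "a \<in> carrier A"
  shows "(\<ominus>\<^bsub>M\<^esub> x) \<triangleleft>\<^bsub>M\<^esub> a = \<ominus>\<^bsub>M\<^esub> (x \<triangleleft>\<^bsub>M\<^esub> a)"
proof -
  have "(\<ominus>\<^bsub>M\<^esub> x) \<triangleleft>\<^bsub>M\<^esub> a \<oplus>\<^bsub>M\<^esub> x \<triangleleft>\<^bsub>M\<^esub> a = \<zero>\<^bsub>M\<^esub>"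
    using assms by (simp add: act_add_left[symmetric] M.l_neg)
  then show ?thesis using assms by (simp add: M.minus_equality)
qed

lemma rlin_uminus:
  assumes "right_module A M" "right_module A N" "rlin A M N f"
  shows "rlin A M N (\<lambda>x. \<ominus>\<^bsub>N\<^esub> f x)"
proof -
  interpret M: right_module A M by fact
  interpret N: right_module A N by fact
  show ?thesis using assms(3)
    by (auto simp: rlin_def Pi_def N.minus_act N.M.minus_add N.M.a_comm)
qed

lemma rlin_diff:
  assumes "right_module A M" "right_module A N" "rlin A M N f" "rlin A M N g"
  shows "rlin A M N (\<lambda>x. f x \<ominus>\<^bsub>N\<^esub> g x)"
  unfolding a_minus_def by (intro rlin_add rlin_uminus assms)

text \<open>Projectivity of free modules, stated for relations. \<open>P\<close> behaves like a
  submodule of F x N that projects onto \<open>F\<close>: values related to the basis elements are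
  chosen and extended linearly, and closure of \<open>P\<close> under sums and action carries the
  relation to all of \<open>F\<close>. Lifting through a surjection and lifting modulo a right ideal
  are both instances, without any quotient module.\<close>

lemma free_module_lift:
  fixes A :: "('a, 'm) ring_scheme" and F :: "('a, 'x) right_mod" and N :: "('a, 'y) right_mod"
  assumes "free_module A F" "right_module A N"
    and zero: "P \<zero>\<^bsub>F\<^esub> \<zero>\<^bsub>N\<^esub>"
    and add: "\<And>x y m n. \<lbrakk>x \<in> carrier F; y \<in> carrier F; m \<in> carrier N; n \<in> carrier N; P x m; P y n\<rbrakk> \<Longrightarrow>
        P (x \<oplus>\<^bsub>F\<^esub> y) (m \<oplus>\<^bsub>N\<^esub> n)"
    and act: "\<And>x m a. \<lbrakk>x \<in> carrier F; m \<in> carrier N; a \<in> carrier A; P x m\<rbrakk> \<Longrightarrow>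
        P (x \<triangleleft>\<^bsub>F\<^esub> a) (m \<triangleleft>\<^bsub>N\<^esub> a)"
    and ex: "\<And>x. x \<in> carrier F \<Longrightarrow> \<exists>n\<in>carrier N. P x n"
  shows "\<exists>g. rlin A F N g \<and> (\<forall>x\<in>carrier F. P x (g x))"
proof -
  interpret F: right_module A F using assms(1) by (simp add: free_module_def)
  interpret N: right_module A N by fact
  let ?s = "\<lambda>B c. {b \<in> B. c b \<noteq> \<zero>\<^bsub>A\<^esub>}"
  obtain B where "B \<subseteq> carrier F \<and> (\<forall>x\<in>carrier F. \<exists>!c. c \<in> B \<rightarrow>\<^sub>E carrier A \<and>
      finite (?s B c) \<and> x = (\<Oplus>\<^bsub>F\<^esub>b\<in>?s B c. b \<triangleleft>\<^bsub>F\<^esub> c b))"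
    using assms(1) unfolding free_module_def by (elim conjE exE) (rule that, rule conjI)
  then have B: "B \<subseteq> carrier F" and uniq: "\<And>x. x \<in> carrier F \<Longrightarrow>
      \<exists>!c. c \<in> B \<rightarrow>\<^sub>E carrier A \<and> finite (?s B c) \<and> x = (\<Oplus>\<^bsub>F\<^esub>b\<in>?s B c. b \<triangleleft>\<^bsub>F\<^esub> c b)"
    by simp_all
  define C where "C x = (THE c. c \<in> B \<rightarrow>\<^sub>E carrier A \<and> finite (?s B c) \<and>
      x = (\<Oplus>\<^bsub>F\<^esub>b\<in>?s B c. b \<triangleleft>\<^bsub>F\<^esub> c b))" for x
  have C: "C x \<in> B \<rightarrow>\<^sub>E carrier A" "finite (?s B (C x))"
      "(\<Oplus>\<^bsub>F\<^esub>b\<in>?s B (C x). b \<triangleleft>\<^bsub>F\<^esub> C x b) = x" if "x \<in> carrier F" for x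
    using theI'[OF uniq[OF that]] unfolding C_def by auto
  have CA: "C x b \<in> carrier A" if "x \<in> carrier F" "b \<in> B" for x b
    using C(1)[OF that(1)] that(2) by (rule PiE_mem)
  obtain t where t: "\<And>b. b \<in> B \<Longrightarrow> t b \<in> carrier N" "\<And>b. b \<in> B \<Longrightarrow> P b (t b)"
    using ex B by (metis subsetD)
  have BF: "b \<in> carrier F" if "b \<in> B" for b using B that by auto
  \<comment> \<open>Coordinates may cancel in a sum or under the action, so supports can shrink.
    Hence all sums are compared over an arbitrary finite superset of the support.\<close>
  have supF: "(\<Oplus>\<^bsub>F\<^esub>b\<in>?s B c. b \<triangleleft>\<^bsub>F\<^esub> c b) = (\<Oplus>\<^bsub>F\<^esub>b\<in>S. b \<triangleleft>\<^bsub>F\<^esub> c b)"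
    if "finite S" "S \<subseteq> B" "?s B c \<subseteq> S" "\<And>b. b \<in> S \<Longrightarrow> c b \<in> carrier A" for c S
    by (rule F.M.add.finprod_mono_neutral_cong_left) (use that BF in auto)
  have supN: "(\<Oplus>\<^bsub>N\<^esub>b\<in>?s B c. t b \<triangleleft>\<^bsub>N\<^esub> c b) = (\<Oplus>\<^bsub>N\<^esub>b\<in>S. t b \<triangleleft>\<^bsub>N\<^esub> c b)"
    if "finite S" "S \<subseteq> B" "?s B c \<subseteq> S" "\<And>b. b \<in> S \<Longrightarrow> c b \<in> carrier A" for c S
    by (rule N.M.add.finprod_mono_neutral_cong_left) (use that t in auto)
  have C_eq: "C x = c" if "x \<in> carrier F" "c \<in> B \<rightarrow>\<^sub>E carrier A" "finite S" "S \<subseteq> B" "?s B c \<subseteq> S"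
      "x = (\<Oplus>\<^bsub>F\<^esub>b\<in>S. b \<triangleleft>\<^bsub>F\<^esub> c b)" for x c S
  proof -
    have "finite (?s B c)" using that finite_subset by blast
    moreover have "c b \<in> carrier A" if "b \<in> S" for b
      using \<open>c \<in> B \<rightarrow>\<^sub>E carrier A\<close> \<open>S \<subseteq> B\<close> that by (auto simp: PiE_iff)
    then have "x = (\<Oplus>\<^bsub>F\<^esub>b\<in>?s B c. b \<triangleleft>\<^bsub>F\<^esub> c b)" using supF[of S c] that by simp
    ultimately show ?thesis
      unfolding C_def using that(2) by (intro the1_equality uniq that(1)) simp_all
  qed
  define g where "g x = (\<Oplus>\<^bsub>N\<^esub>b\<in>?s B (C x). t b \<triangleleft>\<^bsub>N\<^esub> C x b)" for x
  have Pg: "P x (g x)" if x: "x \<in> carrier F" for x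
  proof -
    have "P (\<Oplus>\<^bsub>F\<^esub>b\<in>S. b \<triangleleft>\<^bsub>F\<^esub> C x b) (\<Oplus>\<^bsub>N\<^esub>b\<in>S. t b \<triangleleft>\<^bsub>N\<^esub> C x b)" if "finite S" "S \<subseteq> B" for S
      using that
    proof (induction S)
      case (insert b S)
      have c: "C x b' \<in> carrier A" if "b' \<in> insert b S" for b' using CA[OF x] that insert.prems by blast
      have b: "b' \<in> carrier F" "t b' \<in> carrier N" if "b' \<in> insert b S" for b'
        using BF t insert.prems that by auto
      have "P (b \<triangleleft>\<^bsub>F\<^esub> C x b \<oplus>\<^bsub>F\<^esub> (\<Oplus>\<^bsub>F\<^esub>b\<in>S. b \<triangleleft>\<^bsub>F\<^esub> C x b))
              (t b \<triangleleft>\<^bsub>N\<^esub> C x b \<oplus>\<^bsub>N\<^esub> (\<Oplus>\<^bsub>N\<^esub>b\<in>S. t b \<triangleleft>\<^bsub>N\<^esub> C x b))"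
        using insert b c t by (intro add act F.M.finsum_closed N.M.finsum_closed) auto
      then show ?case using insert b c by (simp add: Pi_def)
    qed (simp add: zero)
    from this[OF C(2)[OF x]] show ?thesis using C(3)[OF x] by (simp add: g_def)
  qed
  have "rlin A F N g" unfolding rlin_def
  proof (intro conjI ballI)
    show "g \<in> carrier F \<rightarrow> carrier N"
      using t CA by (auto simp: g_def intro!: N.M.finsum_closed)
  next
    fix x y assume x: "x \<in> carrier F" and y: "y \<in> carrier F"
    let ?S = "?s B (C x) \<union> ?s B (C y)" and ?c = "\<lambda>b\<in>B. C x b \<oplus>\<^bsub>A\<^esub> C y b"
    have S: "finite ?S" "?S \<subseteq> B" using C(2) x y by auto
    have c: "?c \<in> B \<rightarrow>\<^sub>E carrier A" using CA x y by auto
    have sub: "?s B ?c \<subseteq> ?S" using CA x y by auto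
    have cS: "C x b \<in> carrier A" "C y b \<in> carrier A" if "b \<in> ?S" for b using CA x y that by auto
    have "x \<oplus>\<^bsub>F\<^esub> y = (\<Oplus>\<^bsub>F\<^esub>b\<in>?S. b \<triangleleft>\<^bsub>F\<^esub> C x b) \<oplus>\<^bsub>F\<^esub> (\<Oplus>\<^bsub>F\<^esub>b\<in>?S. b \<triangleleft>\<^bsub>F\<^esub> C y b)"
      using supF[OF S, of "C x", OF _ cS(1)] supF[OF S, of "C y", OF _ cS(2)] C(3)[OF x] C(3)[OF y] by simp
    also have "\<dots> = (\<Oplus>\<^bsub>F\<^esub>b\<in>?S. b \<triangleleft>\<^bsub>F\<^esub> C x b \<oplus>\<^bsub>F\<^esub> b \<triangleleft>\<^bsub>F\<^esub> C y b)"
      using BF CA[OF x] CA[OF y] by (intro F.M.finsum_addf[symmetric]) auto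
    also have "\<dots> = (\<Oplus>\<^bsub>F\<^esub>b\<in>?S. b \<triangleleft>\<^bsub>F\<^esub> ?c b)"
      using BF CA[OF x] CA[OF y] by (intro F.M.finsum_cong') (auto simp: F.act_add_right)
    finally have Cxy: "C (x \<oplus>\<^bsub>F\<^esub> y) = ?c" by (rule C_eq[OF F.M.a_closed[OF x y] c S sub])
    have "g (x \<oplus>\<^bsub>F\<^esub> y) = (\<Oplus>\<^bsub>N\<^esub>b\<in>?S. t b \<triangleleft>\<^bsub>N\<^esub> ?c b)"
      unfolding g_def Cxy by (rule supN[OF S sub]) (rule PiE_mem[OF c], use S in blast)
    also have "\<dots> = (\<Oplus>\<^bsub>N\<^esub>b\<in>?S. t b \<triangleleft>\<^bsub>N\<^esub> C x b \<oplus>\<^bsub>N\<^esub> t b \<triangleleft>\<^bsub>N\<^esub> C y b)"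
      using t CA[OF x] CA[OF y] by (intro N.M.finsum_cong') (auto simp: N.act_add_right)
    also have "\<dots> = (\<Oplus>\<^bsub>N\<^esub>b\<in>?S. t b \<triangleleft>\<^bsub>N\<^esub> C x b) \<oplus>\<^bsub>N\<^esub> (\<Oplus>\<^bsub>N\<^esub>b\<in>?S. t b \<triangleleft>\<^bsub>N\<^esub> C y b)"
      using t CA[OF x] CA[OF y] by (intro N.M.finsum_addf) auto
    also have "\<dots> = g x \<oplus>\<^bsub>N\<^esub> g y"
      using supN[OF S, of "C x", OF _ cS(1)] supN[OF S, of "C y", OF _ cS(2)] by (simp add: g_def)
    finally show "g (x \<oplus>\<^bsub>F\<^esub> y) = g x \<oplus>\<^bsub>N\<^esub> g y" .
  next
    fix x a assume x: "x \<in> carrier F" and a: "a \<in> carrier A"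
    let ?S = "?s B (C x)" and ?c = "\<lambda>b\<in>B. C x b \<otimes>\<^bsub>A\<^esub> a"
    have S: "finite ?S" "?S \<subseteq> B" using C(2) x by auto
    have c: "?c \<in> B \<rightarrow>\<^sub>E carrier A" using CA x a by auto
    have sub: "?s B ?c \<subseteq> ?S" using CA x a by auto
    have "x \<triangleleft>\<^bsub>F\<^esub> a = (\<Oplus>\<^bsub>F\<^esub>b\<in>?S. b \<triangleleft>\<^bsub>F\<^esub> C x b) \<triangleleft>\<^bsub>F\<^esub> a" using C(3)[OF x] by simp
    also have "\<dots> = (\<Oplus>\<^bsub>F\<^esub>b\<in>?S. (b \<triangleleft>\<^bsub>F\<^esub> C x b) \<triangleleft>\<^bsub>F\<^esub> a)"
      using BF CA[OF x] a S by (intro F.finsum_act) auto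
    also have "\<dots> = (\<Oplus>\<^bsub>F\<^esub>b\<in>?S. b \<triangleleft>\<^bsub>F\<^esub> ?c b)"
      using BF CA[OF x] a by (intro F.M.finsum_cong') (auto simp: F.act_mult)
    finally have Cxa: "C (x \<triangleleft>\<^bsub>F\<^esub> a) = ?c" by (rule C_eq[OF F.act_closed[OF x a] c S sub])
    have "g (x \<triangleleft>\<^bsub>F\<^esub> a) = (\<Oplus>\<^bsub>N\<^esub>b\<in>?S. t b \<triangleleft>\<^bsub>N\<^esub> ?c b)"
      unfolding g_def Cxa by (rule supN[OF S sub]) (rule PiE_mem[OF c], use S in blast)
    also have "\<dots> = (\<Oplus>\<^bsub>N\<^esub>b\<in>?S. (t b \<triangleleft>\<^bsub>N\<^esub> C x b) \<triangleleft>\<^bsub>N\<^esub> a)"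
      using t CA[OF x] a by (intro N.M.finsum_cong') (auto simp: N.act_mult)
    also have "\<dots> = g x \<triangleleft>\<^bsub>N\<^esub> a"
      unfolding g_def using t CA[OF x] a S by (intro N.finsum_act[symmetric]) auto
    finally show "g (x \<triangleleft>\<^bsub>F\<^esub> a) = g x \<triangleleft>\<^bsub>N\<^esub> a" .
  qed
  with Pg show ?thesis by blast
qed

section \<open>Right ideals with vanishing Ext\<close>

definition right_ideal :: "('a, 'm) ring_scheme \<Rightarrow> 'a set \<Rightarrow> bool" where
  "right_ideal A Z \<longleftrightarrow> Z \<subseteq> carrier A \<and> \<zero>\<^bsub>A\<^esub> \<in> Z \<and> (\<forall>x\<in>Z. \<forall>y\<in>Z. x \<oplus>\<^bsub>A\<^esub> y \<in> Z) \<and>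
     (\<forall>x\<in>Z. \<forall>a\<in>carrier A. x \<otimes>\<^bsub>A\<^esub> a \<in> Z)"

context ring
begin

lemma right_idealD:
  assumes "right_ideal R Z"
  shows "Z \<subseteq> carrier R" "x \<in> Z \<Longrightarrow> x \<in> carrier R" "\<zero> \<in> Z"
    "\<lbrakk>x \<in> Z; y \<in> Z\<rbrakk> \<Longrightarrow> x \<oplus> y \<in> Z" "\<lbrakk>x \<in> Z; a \<in> carrier R\<rbrakk> \<Longrightarrow> x \<otimes> a \<in> Z"
  using assms by (auto simp: right_ideal_def)

lemma right_ideal_uminus:
  assumes "right_ideal R Z" "x \<in> Z"
  shows "\<ominus> x \<in> Z"
proof -
  have "x \<in> carrier R" "x \<otimes> (\<ominus> \<one>) \<in> Z"
    using right_idealD(2,5)[OF assms(1)] assms(2) by simp_all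
  then show ?thesis by (simp add: r_minus)
qed

lemma right_ideal_minus: "right_ideal R Z \<Longrightarrow> x \<in> Z \<Longrightarrow> y \<in> Z \<Longrightarrow> x \<ominus> y \<in> Z"
  unfolding a_minus_def by (intro right_idealD(4) right_ideal_uminus)

lemma right_ideal_carrier: "right_ideal R (carrier R)"
  by (simp add: right_ideal_def)

lemma right_ideal_image:
  assumes "right_ideal R Z" "a \<in> carrier R"
  shows "right_ideal R ((\<otimes>) a ` Z)"
  unfolding right_ideal_def
proof (intro conjI ballI)
  show "(\<otimes>) a ` Z \<subseteq> carrier R" using assms right_idealD(2) by blast
  show "\<zero> \<in> (\<otimes>) a ` Z" using assms right_idealD(3) by (intro image_eqI[of _ _ \<zero>]) auto
next
  fix x y assume "x \<in> (\<otimes>) a ` Z" "y \<in> (\<otimes>) a ` Z"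
  then obtain z w where *: "z \<in> Z" "w \<in> Z" "x = a \<otimes> z" "y = a \<otimes> w" by blast
  then have "x \<oplus> y = a \<otimes> (z \<oplus> w)"
    using assms right_idealD(2)[OF assms(1)] by (simp add: r_distr)
  then show "x \<oplus> y \<in> (\<otimes>) a ` Z" using * right_idealD(4)[OF assms(1)] by blast
next
  fix x b assume "x \<in> (\<otimes>) a ` Z" "b \<in> carrier R"
  then obtain z where *: "z \<in> Z" "x = a \<otimes> z" by blast
  then have "x \<otimes> b = a \<otimes> (z \<otimes> b)"
    using assms right_idealD(2)[OF assms(1)] \<open>b \<in> carrier R\<close> by (simp add: m_assoc)
  then show "x \<otimes> b \<in> (\<otimes>) a ` Z"
    using * right_idealD(5)[OF assms(1)] \<open>b \<in> carrier R\<close> by blast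
qed

lemma right_module_regular: "right_module R (regular_module R)"
proof -
  have "abelian_group (regular_module R)"
    by (rule abelian_groupI) (auto simp: regular_module_def a_ac intro: bexI[of _ "\<ominus> _"] l_neg)
  moreover have "right_module_axioms R (regular_module R)"
    by unfold_locales (auto simp: regular_module_def l_distr r_distr m_assoc)
  ultimately show ?thesis by (simp add: right_module_def ring_axioms)
qed

end

lemma regular_module_simps [simp]:
  "carrier (regular_module A) = carrier A" "add (regular_module A) = add A"
  "zero (regular_module A) = zero A" "act (regular_module A) = mult A"
  by (simp_all add: regular_module_def)

lemma a_minus_regular_module [simp]: "x \<ominus>\<^bsub>regular_module A\<^esub> y = x \<ominus>\<^bsub>A\<^esub> y"
  by (simp add: a_minus_def a_inv_def m_inv_def regular_module_def)

text \<open>Homomorphisms between right ideals, as functions on elements of \<open>A\<close>, so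
  that a right ideal never has to be made into a module record of its own.\<close>

definition ideal_lin :: "('a, 'm) ring_scheme \<Rightarrow> 'a set \<Rightarrow> 'a set \<Rightarrow> ('a \<Rightarrow> 'a) \<Rightarrow> bool" where
  "ideal_lin A Z W h \<longleftrightarrow> h \<in> Z \<rightarrow> W \<and> (\<forall>x\<in>Z. \<forall>y\<in>Z. h (x \<oplus>\<^bsub>A\<^esub> y) = h x \<oplus>\<^bsub>A\<^esub> h y) \<and>
     (\<forall>x\<in>Z. \<forall>a\<in>carrier A. h (x \<otimes>\<^bsub>A\<^esub> a) = h x \<otimes>\<^bsub>A\<^esub> a)"

text \<open>An arbitrary free resolution is fixed, so everything proved here applies to the
  unspecified one that \<open>chosen_resolution\<close> picks.\<close>

locale resolution = A?: ring A + M?: right_module A M for A (structure) and M (structure) +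
  fixes F d \<epsilon>
  assumes res: "free_resolution A M (F, d, \<epsilon>)"
begin

abbreviation "Reg \<equiv> regular_module A"

lemma F_free: "free_module A (F n)" and F_module: "right_module A (F n)"
  and d_lin: "rlin A (F (Suc n)) (F n) (d n)" and \<epsilon>_lin: "rlin A (F 0) M \<epsilon>"
  using res by (auto simp: free_resolution_def free_module_def intro: rmod_hom_imp_rlin)

lemma d_closed: "y \<in> carrier (F (Suc n)) \<Longrightarrow> d n y \<in> carrier (F n)"
  using d_lin[of n] by (auto simp: rlin_def)

lemma d_d: "y \<in> carrier (F (Suc (Suc n))) \<Longrightarrow> d n (d (Suc n) y) = \<zero>\<^bsub>F n\<^esub>"
proof -
  assume y: "y \<in> carrier (F (Suc (Suc n)))"
  have "d (Suc n) ` carrier (F (Suc (Suc n))) = rmod_ker (F (Suc n)) (F n) (d n)"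
    using res by (simp add: free_resolution_def)
  then have "d (Suc n) y \<in> rmod_ker (F (Suc n)) (F n) (d n)" using y by blast
  then show ?thesis by (simp add: rmod_ker_def)
qed

lemma \<epsilon>_d: "y \<in> carrier (F 1) \<Longrightarrow> \<epsilon> (d 0 y) = \<zero>\<^bsub>M\<^esub>"
  using res by (auto simp: free_resolution_def rmod_ker_def)

lemma exact: "y \<in> carrier (F (Suc n)) \<Longrightarrow> d n y = \<zero>\<^bsub>F n\<^esub> \<Longrightarrow>
    \<exists>z\<in>carrier (F (Suc (Suc n))). y = d (Suc n) z"
  using res by (auto simp: free_resolution_def rmod_ker_def image_iff set_eq_iff)

lemma exact0: "y \<in> carrier (F 0) \<Longrightarrow> \<epsilon> y = \<zero>\<^bsub>M\<^esub> \<Longrightarrow> \<exists>z\<in>carrier (F (Suc 0)). y = d 0 z"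
  using res by (auto simp: free_resolution_def rmod_ker_def image_iff set_eq_iff)

lemma \<epsilon>_surj: "x \<in> carrier M \<Longrightarrow> \<exists>y\<in>carrier (F 0). x = \<epsilon> y"
  using res by (auto simp: free_resolution_def)

text \<open>Cocycles with coefficients in the right ideal \<open>Z\<close>, encoded as maps into the
  regular module with image in \<open>Z\<close>. Changing the ideal thus changes a condition and not
  a type.\<close>

definition cocyc :: "nat \<Rightarrow> 'a set \<Rightarrow> ('d \<Rightarrow> 'a) \<Rightarrow> bool" where
  "cocyc n Z f \<longleftrightarrow> rlin A (F n) Reg f \<and> (\<forall>y\<in>carrier (F n). f y \<in> Z) \<and>
     (\<forall>y\<in>carrier (F (Suc n)). f (d n y) = \<zero>)"

text \<open>In degree 0 there is nothing to bound with, so being a coboundary means being zero;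
  acyclicity of \<open>Z\<close> therefore includes Hom(M, Z) = 0.\<close>

definition bdry :: "nat \<Rightarrow> 'a set \<Rightarrow> ('d \<Rightarrow> 'a) \<Rightarrow> bool" where
  "bdry n Z f \<longleftrightarrow> (case n of 0 \<Rightarrow> \<forall>y\<in>carrier (F 0). f y = \<zero>
     | Suc m \<Rightarrow> \<exists>k. rlin A (F m) Reg k \<and> (\<forall>y\<in>carrier (F m). k y \<in> Z) \<and>
         (\<forall>y\<in>carrier (F n). f y = k (d m y)))"

text \<open>\<open>Ext\<^sup>n(M, Z) = 0\<close> for all \<open>n\<close>.\<close>

definition acyclic_ideal :: "'a set \<Rightarrow> bool" where
  "acyclic_ideal Z \<longleftrightarrow> (\<forall>n f. cocyc n Z f \<longrightarrow> bdry n Z f)"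

lemma bdry_cong: "bdry n Z f \<Longrightarrow> (\<And>y. y \<in> carrier (F n) \<Longrightarrow> g y = f y) \<Longrightarrow> bdry n Z g"
  by (cases n) (auto simp: bdry_def)

lemma bdry_mono: "bdry n Z f \<Longrightarrow> Z \<subseteq> W \<Longrightarrow> bdry n W f"
  by (cases n) (auto simp: bdry_def)

lemma bdry_add:
  assumes "right_ideal A Z" "bdry n Z f" "bdry n Z g"
  shows "bdry n Z (\<lambda>y. f y \<oplus> g y)"
proof (cases n)
  case (Suc m)
  obtain k l where "rlin A (F m) Reg k" "\<forall>y\<in>carrier (F m). k y \<in> Z" "\<forall>y\<in>carrier (F n). f y = k (d m y)"
      "rlin A (F m) Reg l" "\<forall>y\<in>carrier (F m). l y \<in> Z" "\<forall>y\<in>carrier (F n). g y = l (d m y)"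
    using assms(2,3) Suc by (auto simp: bdry_def)
  then show ?thesis
    using rlin_add[OF F_module right_module_regular, of m k l] A.right_idealD(4)[OF assms(1)]
    unfolding bdry_def Suc by (auto intro!: exI[of _ "\<lambda>y. k y \<oplus> l y"])
qed (use assms in \<open>auto simp: bdry_def\<close>)

lemma rlin_ideal_lin:
  assumes "rlin A L Reg f" "\<And>y. y \<in> carrier L \<Longrightarrow> f y \<in> Z" "ideal_lin A Z W h" "W \<subseteq> carrier A"
  shows "rlin A L Reg (\<lambda>y. h (f y))"
  using assms by (auto simp: rlin_def ideal_lin_def Pi_iff subset_iff)

lemma ideal_lin_zero:
  assumes "right_ideal A Z" "ideal_lin A Z W h" "W \<subseteq> carrier A"
  shows "h \<zero> = \<zero>"
proof -
  have z: "\<zero> \<in> Z" by (rule A.right_idealD(3)[OF assms(1)])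
  then have "h \<zero> \<in> carrier A" using assms(2,3) by (auto simp: ideal_lin_def)
  moreover have "h (\<zero> \<otimes> \<zero>) = h \<zero> \<otimes> \<zero>"
    using assms(2) z A.zero_closed unfolding ideal_lin_def by blast
  ultimately show ?thesis by simp
qed

lemma bdry_map:
  assumes "right_ideal A Z" "bdry n Z f" "ideal_lin A Z W h" "W \<subseteq> carrier A"
  shows "bdry n W (\<lambda>y. h (f y))"
proof (cases n)
  case 0
  then show ?thesis using assms ideal_lin_zero[OF assms(1,3,4)] by (auto simp: bdry_def)
next
  case (Suc m)
  then obtain k where k: "rlin A (F m) Reg k" "\<And>y. y \<in> carrier (F m) \<Longrightarrow> k y \<in> Z"
      "\<forall>y\<in>carrier (F n). f y = k (d m y)"
    using assms(2) by (auto simp: bdry_def)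
  then show ?thesis
    using rlin_ideal_lin[OF k(1,2) assms(3,4)] assms(3)
    unfolding bdry_def Suc by (auto intro!: exI[of _ "\<lambda>y. h (k y)"] simp: ideal_lin_def)
qed

lemma cocyc_map:
  assumes "right_ideal A Z" "cocyc n Z f" "ideal_lin A Z W h" "W \<subseteq> carrier A"
  shows "cocyc n W (\<lambda>y. h (f y))"
  using assms rlin_ideal_lin[of "F n" f Z W h] ideal_lin_zero[OF assms(1,3,4)]
  by (auto simp: cocyc_def ideal_lin_def)

lemma ideal_lin_mult:
  assumes "right_ideal A Z" "a \<in> carrier A"
  shows "ideal_lin A Z ((\<otimes>) a ` Z) ((\<otimes>) a)"
  using A.right_idealD(2)[OF assms(1)] assms(2) by (auto simp: ideal_lin_def r_distr m_assoc)

section \<open>Closure properties of the class of acyclic right ideals\<close>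

lemma acyclic_ideal_zero: "acyclic_ideal {\<zero>}"
  unfolding acyclic_ideal_def
proof (intro allI impI)
  fix n f assume f: "cocyc n {\<zero>} f"
  show "bdry n {\<zero>} f"
  proof (cases n)
    case (Suc m)
    have "rlin A (F m) Reg (\<lambda>_. \<zero>)" by (simp add: rlin_def)
    then show ?thesis using f Suc by (auto simp: bdry_def cocyc_def intro!: exI[of _ "\<lambda>_. \<zero>"])
  qed (use f in \<open>auto simp: bdry_def cocyc_def\<close>)
qed

text \<open>eA is a direct summand of \<open>A\<close>. Left multiplication by e fixes a cocycle
  with values in eA and moves a bounding cochain from \<open>A\<close> into eA.\<close>

lemma acyclic_ideal_idem:
  assumes "acyclic_ideal (carrier A)" "e \<in> carrier A" "e \<otimes> e = e"
  shows "acyclic_ideal ((\<otimes>) e ` carrier A)"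
  unfolding acyclic_ideal_def
proof (intro allI impI)
  fix n f assume f: "cocyc n ((\<otimes>) e ` carrier A) f"
  then have "cocyc n (carrier A) f" using assms(2) by (auto simp: cocyc_def)
  then have "bdry n (carrier A) f" using assms(1) by (auto simp: acyclic_ideal_def)
  from bdry_map[OF right_ideal_carrier this ideal_lin_mult[OF right_ideal_carrier assms(2)]]
  have "bdry n ((\<otimes>) e ` carrier A) (\<lambda>y. e \<otimes> f y)" using assms(2) by auto
  then show "bdry n ((\<otimes>) e ` carrier A) f"
  proof (rule bdry_cong)
    fix y assume "y \<in> carrier (F n)"
    then obtain a where "a \<in> carrier A" "f y = e \<otimes> a" using f by (auto simp: cocyc_def)
    then show "f y = e \<otimes> f y" using assms(2,3) by (simp add: m_assoc[symmetric])
  qed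
qed

text \<open>For the exact sequence 0 -> N -> Z -> aZ -> 0, where \<open>N\<close> is the annihilator
  of a in \<open>Z\<close>, the group Ext^n(M, aZ) sits between Ext^n(M, Z) and Ext^(n+1)(M, N). The
  proof chases cochains through these terms.\<close>

lemma acyclic_ideal_mult_image:
  assumes Z: "right_ideal A Z" and a: "a \<in> carrier A"
    and "acyclic_ideal Z" "acyclic_ideal {z \<in> Z. a \<otimes> z = \<zero>}"
  shows "acyclic_ideal ((\<otimes>) a ` Z)"
  unfolding acyclic_ideal_def
proof (intro allI impI)
  fix n f assume f: "cocyc n ((\<otimes>) a ` Z) f"
  note ZD = A.right_idealD[OF Z]
  let ?N = "{z \<in> Z. a \<otimes> z = \<zero>}"
  have flin: "rlin A (F n) Reg f" using f by (simp add: cocyc_def)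
  have f0: "f \<zero>\<^bsub>F n\<^esub> = \<zero>" using rlin_zero[OF F_module right_module_regular flin] by simp
  \<comment> \<open>\<open>g\<close> lifts the cocycle \<open>f\<close> through the surjection from
    \<open>Z\<close> to aZ.\<close>
  have "\<exists>g. rlin A (F n) Reg g \<and> (\<forall>y\<in>carrier (F n). g y \<in> Z \<and> a \<otimes> g y = f y)"
  proof (rule free_module_lift[OF F_free right_module_regular], goal_cases)
    case 1 show ?case using ZD(3) a f0 by simp
  next
    case (2 x y m n)
    then show ?case using ZD(4) a flin by (auto simp: rlin_def r_distr)
  next
    case (3 x m b)
    then show ?case using ZD(5) a flin by (auto simp: rlin_def m_assoc[symmetric])
  next
    case (4 x)
    then show ?case using f ZD(2) by (fastforce simp: cocyc_def)
  qed
  then obtain g where g: "rlin A (F n) Reg g" "\<And>y. y \<in> carrier (F n) \<Longrightarrow> g y \<in> Z"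
      "\<And>y. y \<in> carrier (F n) \<Longrightarrow> a \<otimes> g y = f y" by blast
  have g0: "g \<zero>\<^bsub>F n\<^esub> = \<zero>" using rlin_zero[OF F_module right_module_regular g(1)] by simp
  \<comment> \<open>The connecting homomorphism: a kills g (d n y) because \<open>f\<close> vanishes
    on boundaries, so \<open>g\<close> after \<open>d n\<close> takes values in the
    annihilator.\<close>
  have "cocyc (Suc n) ?N (\<lambda>y. g (d n y))"
    using rlin_compose[OF d_lin g(1)] g d_closed d_d g0 f by (auto simp: cocyc_def)
  then have "bdry (Suc n) ?N (\<lambda>y. g (d n y))" using assms(4) by (auto simp: acyclic_ideal_def)
  then obtain k where k: "rlin A (F n) Reg k" "\<And>y. y \<in> carrier (F n) \<Longrightarrow> k y \<in> ?N"
      "\<And>y. y \<in> carrier (F (Suc n)) \<Longrightarrow> g (d n y) = k (d n y)" by (auto simp: bdry_def)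
  have kc: "k y \<in> carrier A" "g y \<in> carrier A" if "y \<in> carrier (F n)" for y
    using k(2) g(2) that ZD(2) by auto
  \<comment> \<open>Subtracting \<open>k\<close> makes the lift a cocycle in \<open>Z\<close>. Its
    image in aZ is unchanged, since a kills the values of \<open>k\<close>.\<close>
  have "rlin A (F n) Reg (\<lambda>y. g y \<ominus> k y)"
    using rlin_diff[OF F_module right_module_regular g(1) k(1)] by simp
  moreover have "g y \<ominus> k y \<in> Z" if "y \<in> carrier (F n)" for y
    using A.right_ideal_minus[OF Z] g(2) k(2) that by auto
  ultimately have "cocyc n Z (\<lambda>y. g y \<ominus> k y)"
    using k(3) kc d_closed by (auto simp: cocyc_def a_minus_def A.r_neg)
  then have "bdry n Z (\<lambda>y. g y \<ominus> k y)" using assms(3) by (auto simp: acyclic_ideal_def)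
  from bdry_map[OF Z this ideal_lin_mult[OF Z a]] right_idealD(1)[OF right_ideal_image[OF Z a]]
  have "bdry n ((\<otimes>) a ` Z) (\<lambda>y. a \<otimes> (g y \<ominus> k y))" by simp
  then show "bdry n ((\<otimes>) a ` Z) f"
  proof (rule bdry_cong)
    fix y assume y: "y \<in> carrier (F n)"
    have "a \<otimes> (g y \<ominus> k y) = a \<otimes> g y \<ominus> a \<otimes> k y"
      using kc[OF y] a by (simp add: a_minus_def r_distr A.r_minus)
    also have "\<dots> = f y"
      using g(3)[OF y] k(2)[OF y] flin y by (auto simp: a_minus_def rlin_def Pi_iff)
    finally show "f y = a \<otimes> (g y \<ominus> k y)" by simp
  qed
qed

text \<open>A cocycle in \<open>V\<close> is the sum of its images under \<open>p\<close> and
  \<open>q\<close>. Each image is a coboundary in its own ideal and therefore in \<open>V\<close>.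
  The intended case is a direct sum with its two projections.\<close>

lemma acyclic_ideal_sum:
  assumes V: "right_ideal A V" and Z: "right_ideal A Z" "acyclic_ideal Z"
    and W: "right_ideal A W" "acyclic_ideal W"
    and "Z \<subseteq> V" "W \<subseteq> V"
    and p: "ideal_lin A V Z p" and q: "ideal_lin A V W q"
    and pq: "\<And>x. x \<in> V \<Longrightarrow> x = p x \<oplus> q x"
  shows "acyclic_ideal V"
  unfolding acyclic_ideal_def
proof (intro allI impI)
  fix n f assume f: "cocyc n V f"
  have "bdry n Z (\<lambda>y. p (f y))" "bdry n W (\<lambda>y. q (f y))"
    using cocyc_map[OF V f p] cocyc_map[OF V f q] Z W right_idealD(1)
    by (auto simp: acyclic_ideal_def)
  then have "bdry n V (\<lambda>y. p (f y) \<oplus> q (f y))"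
    using bdry_add[OF V] bdry_mono assms(6,7) by blast
  then show "bdry n V f"
    by (rule bdry_cong) (use f pq in \<open>auto simp: cocyc_def\<close>)
qed

text \<open>\<open>h\<close> represents a homomorphism from \<open>M\<close> to \<open>A / Y\<close>. As \<open>Ext\<^sup>1(M, Y)\<close> vanishes, it lifts
  to a homomorphism from \<open>M\<close> to \<open>A\<close>.\<close>

lemma hom_quotient_eq_0:
  assumes "acyclic_ideal (carrier A)" and Y: "right_ideal A Y" "acyclic_ideal Y"
    and h: "\<And>x. x \<in> carrier M \<Longrightarrow> h x \<in> carrier A" "h \<zero>\<^bsub>M\<^esub> = \<zero>"
    "\<And>x y. x \<in> carrier M \<Longrightarrow> y \<in> carrier M \<Longrightarrow> h (x \<oplus>\<^bsub>M\<^esub> y) = h x \<oplus> h y"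
    "\<And>x a. x \<in> carrier M \<Longrightarrow> a \<in> carrier A \<Longrightarrow> h x \<otimes> a \<ominus> h (x \<triangleleft>\<^bsub>M\<^esub> a) \<in> Y"
    and x: "x \<in> carrier M"
  shows "h x \<in> Y"
proof -
  note YD = A.right_idealD[OF Y(1)]
  have \<epsilon>c: "\<epsilon> y \<in> carrier M" if "y \<in> carrier (F 0)" for y
    using \<epsilon>_lin that by (auto simp: rlin_def)
  have \<epsilon>0: "\<epsilon> \<zero>\<^bsub>F 0\<^esub> = \<zero>\<^bsub>M\<^esub>" by (rule rlin_zero[OF F_module M.right_module_axioms \<epsilon>_lin])
  \<comment> \<open>The map from \<open>F 0\<close> to A / Y induced by \<open>h\<close> after
    \<epsilon> is lifted along the projection from \<open>A\<close>; the relation passed to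
    \<open>free_module_lift\<close> is congruence modulo \<open>Y\<close>.\<close>
  have "\<exists>g. rlin A (F 0) Reg g \<and> (\<forall>y\<in>carrier (F 0). g y \<ominus> h (\<epsilon> y) \<in> Y)"
  proof (rule free_module_lift[OF F_free right_module_regular], goal_cases)
    case 1 show ?case using YD(3) h(2) \<epsilon>0 by (simp add: a_minus_def)
  next
    case (2 x y m n)
    have c: "m \<in> carrier A" "n \<in> carrier A" "h (\<epsilon> x) \<in> carrier A" "h (\<epsilon> y) \<in> carrier A"
      using 2 h(1) \<epsilon>c by auto
    have "(m \<oplus> n) \<ominus> (h (\<epsilon> x) \<oplus> h (\<epsilon> y)) = (m \<ominus> h (\<epsilon> x)) \<oplus> (n \<ominus> h (\<epsilon> y))"
      using c by (simp add: a_minus_def A.minus_add A.a_ac)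
    then show ?case using 2 YD(4) \<epsilon>_lin h(3) \<epsilon>c by (auto simp: rlin_def)
  next
    case (3 x m a)
    have c: "m \<in> carrier A" "h (\<epsilon> x) \<in> carrier A" "h (\<epsilon> x \<triangleleft>\<^bsub>M\<^esub> a) \<in> carrier A"
      using 3 h(1) \<epsilon>c by auto
    have "m \<otimes> a \<ominus> h (\<epsilon> x \<triangleleft>\<^bsub>M\<^esub> a) =
        (m \<ominus> h (\<epsilon> x)) \<otimes> a \<oplus> (h (\<epsilon> x) \<otimes> a \<ominus> h (\<epsilon> x \<triangleleft>\<^bsub>M\<^esub> a))"
      using c 3 by (simp add: a_minus_def l_distr A.l_minus A.a_ac A.r_neg2)
    moreover have "h (\<epsilon> x) \<otimes> a \<ominus> h (\<epsilon> x \<triangleleft>\<^bsub>M\<^esub> a) \<in> Y" using 3 h(4) \<epsilon>c by auto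
    ultimately show ?case using 3 YD(4,5) \<epsilon>_lin by (auto simp: rlin_def)
  next
    case (4 y)
    then show ?case using h(1) \<epsilon>c YD(3) by (intro bexI[of _ "h (\<epsilon> y)"]) (auto simp: a_minus_def A.r_neg)
  qed
  then obtain g where g: "rlin A (F 0) Reg g" "\<And>y. y \<in> carrier (F 0) \<Longrightarrow> g y \<ominus> h (\<epsilon> y) \<in> Y" by blast
  have gc: "g y \<in> carrier A" if "y \<in> carrier (F 0)" for y
    using g(1) that by (auto simp: rlin_def)
  have g0: "g \<zero>\<^bsub>F 0\<^esub> = \<zero>" using rlin_zero[OF F_module right_module_regular g(1)] by simp
  \<comment> \<open>Since \<epsilon> kills the image of \<open>d 0\<close>, the lift maps it into
    \<open>Y\<close>. This yields the class in Ext^1(M, Y) that obstructs a lift of \<open>h\<close>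
    to \<open>A\<close>.\<close>
  have "g (d 0 y) \<in> Y" if "y \<in> carrier (F (Suc 0))" for y
    using g(2)[OF d_closed[OF that]] \<epsilon>_d[of y] that h(2) gc[OF d_closed[OF that]]
    by (simp add: a_minus_def)
  then have "cocyc (Suc 0) Y (\<lambda>y. g (d 0 y))"
    using rlin_compose[OF d_lin g(1)] d_d g0 by (auto simp: cocyc_def)
  then have "bdry (Suc 0) Y (\<lambda>y. g (d 0 y))" using Y(2) by (auto simp: acyclic_ideal_def)
  then obtain k where k: "rlin A (F 0) Reg k" "\<And>y. y \<in> carrier (F 0) \<Longrightarrow> k y \<in> Y"
      "\<And>y. y \<in> carrier (F (Suc 0)) \<Longrightarrow> g (d 0 y) = k (d 0 y)" by (auto simp: bdry_def)
  have kc: "k y \<in> carrier A" if "y \<in> carrier (F 0)" for y using k(2) that YD(2) by auto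
  have "rlin A (F 0) Reg (\<lambda>y. g y \<ominus> k y)"
    using rlin_diff[OF F_module right_module_regular g(1) k(1)] by simp
  \<comment> \<open>g - k kills the image of \<open>d 0\<close> and so represents a homomorphism
    from \<open>M\<close> to \<open>A\<close>. Acyclicity in degree 0 says Hom(M, A) = 0, hence g =
    k has values in \<open>Y\<close>.\<close>
  then have "cocyc 0 (carrier A) (\<lambda>y. g y \<ominus> k y)"
    using k(3) kc gc d_closed by (auto simp: cocyc_def a_minus_def A.r_neg)
  then have "bdry 0 (carrier A) (\<lambda>y. g y \<ominus> k y)" using assms(1) by (auto simp: acyclic_ideal_def)
  then have gk: "g y = k y" if "y \<in> carrier (F 0)" for y
    using that gc kc by (auto simp: bdry_def)
  obtain y where y: "y \<in> carrier (F 0)" "x = \<epsilon> y" using \<epsilon>_surj x by blast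
  have c: "g y \<in> carrier A" "h x \<in> carrier A" using gc y h(1) x by auto
  have "h x = g y \<ominus> (g y \<ominus> h x)"
    using c by (simp add: a_minus_def A.minus_add A.r_neg A.r_neg2)
  moreover have "g y \<ominus> (g y \<ominus> h x) \<in> Y"
    by (rule right_ideal_minus[OF Y(1)]) (use g(2) k(2) gk y in simp_all)
  ultimately show ?thesis by simp
qed

end

section \<open>Vanishing of Ext in terms of cocycles\<close>

lemma rmod_hom_iff: "f \<in> rmod_hom A M N \<longleftrightarrow> rlin A M N f \<and> f \<in> extensional (carrier M)"
  by (auto simp: rmod_hom_def rlin_def PiE_def)

context resolution
begin

lemma cocycles_iff:
  "f \<in> cocycles A F d N n \<longleftrightarrow> rlin A (F n) N f \<and> f \<in> extensional (carrier (F n)) \<and>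
     (\<forall>y\<in>carrier (F (Suc n)). f (d n y) = \<zero>\<^bsub>N\<^esub>)"
  by (auto simp: cocycles_def rmod_hom_iff hom_group_def compose_def restrict_def fun_eq_iff)

lemma zero_in_coboundaries:
  assumes "right_module A N"
  shows "(\<lambda>y\<in>carrier (F n). \<zero>\<^bsub>N\<^esub>) \<in> coboundaries A F d N n"
proof (cases n)
  case (Suc m)
  interpret N: right_module A N by fact
  interpret Fm: right_module A "F m" by (rule F_module)
  have "(\<lambda>y\<in>carrier (F m). \<zero>\<^bsub>N\<^esub>) \<in> rmod_hom A (F m) N"
    by (rule restrict_in_rmod_hom[OF F_module]) (simp add: rlin_def)
  moreover have "(\<lambda>y\<in>carrier (F n). \<zero>\<^bsub>N\<^esub>) =
      compose (carrier (F (Suc m))) (\<lambda>y\<in>carrier (F m). \<zero>\<^bsub>N\<^esub>) (d m)"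
    using d_closed[of _ m] by (auto simp: compose_def restrict_def Suc)
  ultimately show ?thesis unfolding Suc coboundaries.simps by (auto intro: image_eqI)
qed (simp add: hom_group_def)

lemma group_cocycles:
  assumes "right_module A N"
  shows "group (hom_group A (F n) N\<lparr>carrier := cocycles A F d N n\<rparr>)"
proof -
  interpret N: right_module A N by fact
  interpret Fn: right_module A "F n" by (rule F_module)
  have val: "f y \<in> carrier N" if "f \<in> cocycles A F d N n" "y \<in> carrier (F n)" for f y
    using that by (auto simp: cocycles_iff rlin_def)
  show ?thesis
  proof (rule groupI)
    fix f g assume fg: "f \<in> carrier (hom_group A (F n) N\<lparr>carrier := cocycles A F d N n\<rparr>)"
      "g \<in> carrier (hom_group A (F n) N\<lparr>carrier := cocycles A F d N n\<rparr>)"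
    have "rlin A (F n) N (\<lambda>y. f y \<oplus>\<^bsub>N\<^esub> g y)"
      using fg by (intro rlin_add F_module assms) (auto simp: cocycles_iff)
    then have "rlin A (F n) N (\<lambda>y\<in>carrier (F n). f y \<oplus>\<^bsub>N\<^esub> g y)"
      by (rule rlin_cong[OF F_module]) simp
    then show "f \<otimes>\<^bsub>hom_group A (F n) N\<lparr>carrier := cocycles A F d N n\<rparr>\<^esub> g
        \<in> carrier (hom_group A (F n) N\<lparr>carrier := cocycles A F d N n\<rparr>)"
      using fg d_closed by (auto simp: cocycles_iff hom_group_def)
  next
    have "rlin A (F n) N (\<lambda>y\<in>carrier (F n). \<zero>\<^bsub>N\<^esub>)"
      by (rule rlin_cong[OF F_module, where f = "\<lambda>_. \<zero>\<^bsub>N\<^esub>"]) (auto simp: rlin_def)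
    then show "\<one>\<^bsub>hom_group A (F n) N\<lparr>carrier := cocycles A F d N n\<rparr>\<^esub>
        \<in> carrier (hom_group A (F n) N\<lparr>carrier := cocycles A F d N n\<rparr>)"
      using d_closed by (auto simp: cocycles_iff hom_group_def)
  next
    fix f assume f: "f \<in> carrier (hom_group A (F n) N\<lparr>carrier := cocycles A F d N n\<rparr>)"
    have "rlin A (F n) N (\<lambda>y. \<ominus>\<^bsub>N\<^esub> f y)"
      using f by (intro rlin_uminus F_module assms) (auto simp: cocycles_iff)
    then have "rlin A (F n) N (\<lambda>y\<in>carrier (F n). \<ominus>\<^bsub>N\<^esub> f y)"
      by (rule rlin_cong[OF F_module]) simp
    then have "(\<lambda>y\<in>carrier (F n). \<ominus>\<^bsub>N\<^esub> f y) \<in> cocycles A F d N n"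
      using f d_closed by (auto simp: cocycles_iff)
    then show "\<exists>g\<in>carrier (hom_group A (F n) N\<lparr>carrier := cocycles A F d N n\<rparr>).
        g \<otimes>\<^bsub>hom_group A (F n) N\<lparr>carrier := cocycles A F d N n\<rparr>\<^esub> f =
        \<one>\<^bsub>hom_group A (F n) N\<lparr>carrier := cocycles A F d N n\<rparr>\<^esub>"
      using val f by (intro bexI[of _ "\<lambda>y\<in>carrier (F n). \<ominus>\<^bsub>N\<^esub> f y"])
        (auto simp: hom_group_def fun_eq_iff N.M.l_neg)
    show "\<one>\<^bsub>hom_group A (F n) N\<lparr>carrier := cocycles A F d N n\<rparr>\<^esub> \<otimes>\<^bsub>hom_group A (F n) N\<lparr>carrier := cocycles A F d N n\<rparr>\<^esub> f = f"
      using val f by (auto simp: hom_group_def fun_eq_iff cocycles_iff extensional_def)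
  qed (use val in \<open>auto simp: hom_group_def fun_eq_iff N.M.a_assoc\<close>)
qed

lemma trivial_quotient_iff:
  assumes "right_module A N" "coboundaries A F d N n \<subseteq> cocycles A F d N n"
  shows "trivial_group (hom_group A (F n) N\<lparr>carrier := cocycles A F d N n\<rparr> Mod coboundaries A F d N n)
    \<longleftrightarrow> cocycles A F d N n \<subseteq> coboundaries A F d N n" (is "trivial_group (?G Mod ?B) \<longleftrightarrow> ?Z \<subseteq> _")
proof
  interpret G: group ?G by (rule group_cocycles) fact
  show "?Z \<subseteq> ?B" if triv: "trivial_group (?G Mod ?B)"
  proof
    fix f assume f: "f \<in> ?Z"
    have one: "\<one>\<^bsub>?G\<^esub> \<in> ?B" using zero_in_coboundaries[OF assms(1)] by (simp add: hom_group_def)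
    have "?B #>\<^bsub>?G\<^esub> f \<in> carrier (?G Mod ?B)" using f by (auto simp: FactGroup_def RCOSETS_def)
    then have "?B #>\<^bsub>?G\<^esub> f = ?B" using triv by (simp add: trivial_group_def)
    \<comment> \<open>The coset of \<open>f\<close> equals the unit of the quotient, which is the
      set of coboundaries itself, and it contains \<open>f\<close>.\<close>
    moreover have "\<one>\<^bsub>?G\<^esub> \<otimes>\<^bsub>?G\<^esub> f \<in> ?B #>\<^bsub>?G\<^esub> f" using one unfolding r_coset_def by blast
    moreover have "\<one>\<^bsub>?G\<^esub> \<otimes>\<^bsub>?G\<^esub> f = f" using f by (intro G.l_one) simp
    ultimately show "f \<in> ?B" by simp
  qed
  show "trivial_group (?G Mod ?B)" if "?Z \<subseteq> ?B"
  proof -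
    \<comment> \<open>Both inclusions make the coboundaries the whole group, so normality is that of
      a group in itself.\<close>
    have B: "?B = carrier ?G" using that assms(2) by simp
    have "group (?G Mod carrier ?G)" by (rule normal.factorgroup_is_group[OF G.normal_self])
    moreover have "carrier ?G #>\<^bsub>?G\<^esub> f = carrier ?G" if "f \<in> carrier ?G" for f
      by (rule G.coset_join2[OF that G.subgroup_self that])
    then have "carrier (?G Mod carrier ?G) = {\<one>\<^bsub>?G Mod carrier ?G\<^esub>}"
      using G.one_closed by (auto simp: carrier_FactGroup)
    ultimately show ?thesis unfolding B trivial_group_def by blast
  qed
qed

lemma coboundaries_subset:
  assumes "right_module A N"
  shows "coboundaries A F d N n \<subseteq> cocycles A F d N n"
proof (cases n)
  case 0
  interpret G: group "hom_group A (F n) N\<lparr>carrier := cocycles A F d N n\<rparr>"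
    by (rule group_cocycles) fact
  show ?thesis using G.one_closed 0 by simp
next
  case (Suc m)
  show ?thesis
  proof
    fix f assume "f \<in> coboundaries A F d N n"
    then obtain k where k: "rlin A (F m) N k" "f = compose (carrier (F n)) k (d m)"
      unfolding Suc coboundaries.simps by (auto dest: rmod_hom_imp_rlin)
    have "rlin A (F n) N f" unfolding k(2) Suc
      by (rule rlin_cong[OF F_module rlin_compose[OF d_lin k(1)]]) (simp add: compose_def)
    moreover have "k \<zero>\<^bsub>F m\<^esub> = \<zero>\<^bsub>N\<^esub>" by (rule rlin_zero[OF F_module assms k(1)])
    ultimately show "f \<in> cocycles A F d N n"
      using d_d[of _ m] d_closed[of _ n] by (auto simp: cocycles_iff k(2) compose_def Suc)
  qed
qed

text \<open>\<open>cocycles\<close> and \<open>coboundaries\<close> consist of extensional maps,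
  while \<open>cocyc\<close> and \<open>bdry\<close> only look at the carrier. A cocycle is
  restricted, bounded there, and compared with the original on the carrier.\<close>

lemma acyclic_ideal_carrier:
  assumes "\<And>n. cocycles A F d Reg n \<subseteq> coboundaries A F d Reg n"
  shows "acyclic_ideal (carrier A)"
  unfolding acyclic_ideal_def
proof (intro allI impI)
  fix n f assume f: "cocyc n (carrier A) f"
  let ?f = "restrict f (carrier (F n))"
  have "?f \<in> rmod_hom A (F n) Reg"
    using f by (intro restrict_in_rmod_hom[OF F_module]) (simp add: cocyc_def)
  then have "?f \<in> cocycles A F d Reg n"
    using f d_closed by (auto simp: cocycles_iff cocyc_def rmod_hom_iff)
  then have f': "?f \<in> coboundaries A F d Reg n" using assms by blast
  show "bdry n (carrier A) f"
  proof (cases n)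
    case 0
    have "?f = (\<lambda>y\<in>carrier (F n). \<zero>)" using f' 0 by (simp add: hom_group_def)
    then have "f y = \<zero>" if "y \<in> carrier (F 0)" for y
      using that 0 by (metis restrict_apply')
    then show ?thesis using 0 by (simp add: bdry_def)
  next
    case (Suc m)
    then obtain k where k: "rlin A (F m) Reg k" "?f = compose (carrier (F n)) k (d m)"
      using f' by (auto dest: rmod_hom_imp_rlin)
    have "f y = k (d m y)" if "y \<in> carrier (F n)" for y
      using fun_cong[OF k(2), of y] that by (simp add: compose_def)
    then show ?thesis using k(1) Suc unfolding bdry_def by (auto simp: rlin_def)
  qed
qed

text \<open>A resolution of the zero module is an exact complex of free modules that ends at
  \<open>F 0\<close>, hence contractible. The equation d s d = d says that \<open>s\<close> splits
  \<open>d n\<close> over its image; such maps are built degree by degree.\<close>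

lemma partial_splitting:
  assumes "carrier M = {\<zero>\<^bsub>M\<^esub>}"
  shows "\<exists>s. rlin A (F n) (F (Suc n)) s \<and> (\<forall>y\<in>carrier (F (Suc n)). d n (s (d n y)) = d n y)"
proof (induction n)
  case 0
  have \<epsilon>0: "\<epsilon> y = \<zero>\<^bsub>M\<^esub>" if "y \<in> carrier (F 0)" for y
    using \<epsilon>_lin assms that by (auto simp: rlin_def)
  have "\<exists>s. rlin A (F 0) (F (Suc 0)) s \<and> (\<forall>y\<in>carrier (F 0). d 0 (s y) = y)"
  proof (rule free_module_lift[OF F_free F_module], goal_cases)
    case 1 show ?case by (rule rlin_zero[OF F_module F_module d_lin])
  next
    case (4 y)
    then show ?case using exact0[OF 4 \<epsilon>0[OF 4]] by metis
  qed (use d_lin[of 0] in \<open>simp_all add: rlin_def\<close>)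
  then show ?case using d_closed by blast
next
  case (Suc n)
  interpret F: right_module A "F (Suc n)" by (rule F_module)
  interpret F0: right_module A "F n" by (rule F_module)
  obtain s where s: "rlin A (F n) (F (Suc n)) s"
      "\<And>y. y \<in> carrier (F (Suc n)) \<Longrightarrow> d n (s (d n y)) = d n y" using Suc.IH by blast
  \<comment> \<open>1 - s d is a projection onto the kernel of \<open>d n\<close>. By exactness it
    lifts through \<open>d (Suc n)\<close>, and the lift is the next splitting.\<close>
  define r where "r y = y \<ominus>\<^bsub>F (Suc n)\<^esub> s (d n y)" for y
  have "rlin A (F (Suc n)) (F (Suc n)) (\<lambda>y. y)" by (simp add: rlin_def)
  then have r: "rlin A (F (Suc n)) (F (Suc n)) r"
    unfolding r_def by (intro rlin_diff F_module rlin_compose[OF d_lin s(1)])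
  have sc: "s (d n y) \<in> carrier (F (Suc n))" if "y \<in> carrier (F (Suc n))" for y
    using that s(1) d_closed by (auto simp: rlin_def)
  have dr: "d n (r y) = \<zero>\<^bsub>F n\<^esub>" if y: "y \<in> carrier (F (Suc n))" for y
  proof -
    have rc: "r y \<in> carrier (F (Suc n))" using r y by (auto simp: rlin_def)
    have "d n (r y) \<oplus>\<^bsub>F n\<^esub> d n (s (d n y)) = d n (r y \<oplus>\<^bsub>F (Suc n)\<^esub> s (d n y))"
      using d_lin[of n] rc sc[OF y] by (simp add: rlin_def)
    also have "r y \<oplus>\<^bsub>F (Suc n)\<^esub> s (d n y) = y"
      using y sc[OF y] by (simp add: r_def a_minus_def F.M.a_assoc F.M.l_neg)
    finally have *: "d n (r y) \<oplus>\<^bsub>F n\<^esub> d n y = d n y" using s(2)[OF y] by simp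
    then show ?thesis using d_closed[OF rc] d_closed[OF y] F0.M.add.r_cancel_one by simp
  qed
  have "\<exists>t. rlin A (F (Suc n)) (F (Suc (Suc n))) t \<and> (\<forall>y\<in>carrier (F (Suc n)). d (Suc n) (t y) = r y)"
  proof (rule free_module_lift[OF F_free F_module], goal_cases)
    case 1
    show ?case using rlin_zero[OF F_module F_module d_lin] rlin_zero[OF F_module F_module r] by simp
  next
    case (4 y)
    then have "r y \<in> carrier (F (Suc n))" using r by (auto simp: rlin_def)
    then show ?case using exact[OF _ dr[OF 4]] by metis
  qed (use d_lin[of "Suc n"] r in \<open>simp_all add: rlin_def\<close>)
  then obtain t where t: "rlin A (F (Suc n)) (F (Suc (Suc n))) t"
      "\<And>y. y \<in> carrier (F (Suc n)) \<Longrightarrow> d (Suc n) (t y) = r y" by blast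
  \<comment> \<open>On boundaries \<open>r\<close> is the identity because d d = 0, so d t d = r d =
    d.\<close>
  have "r (d (Suc n) y) = d (Suc n) y" if "y \<in> carrier (F (Suc (Suc n)))" for y
    using d_closed[OF that] d_d[OF that] rlin_zero[OF F_module F_module s(1)]
    by (simp add: r_def a_minus_def)
  then show ?case using t d_closed by (intro exI[of _ t]) auto
qed

text \<open>In degree 0 the map \<open>d 0\<close> is onto because \<epsilon> is zero, so a cocycle
  vanishes. In higher degrees y - s (d y) lies in the kernel of \<open>d\<close>, which is the image
  of the next differential, where \<open>f\<close> vanishes. Thus f = f s d is the coboundary of f
  s.\<close>

lemma cocycles_subset_of_zero:
  assumes "carrier M = {\<zero>\<^bsub>M\<^esub>}" "right_module A N"
  shows "cocycles A F d N n \<subseteq> coboundaries A F d N n"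
proof
  fix f assume f: "f \<in> cocycles A F d N n"
  interpret N: right_module A N by fact
  show "f \<in> coboundaries A F d N n"
  proof (cases n)
    case 0
    have "f y = \<zero>\<^bsub>N\<^esub>" if y: "y \<in> carrier (F 0)" for y
    proof -
      have "\<epsilon> y = \<zero>\<^bsub>M\<^esub>" using \<epsilon>_lin assms y by (auto simp: rlin_def)
      then show ?thesis using exact0[OF y] f 0 by (auto simp: cocycles_iff)
    qed
    then show ?thesis using f 0 by (auto simp: hom_group_def cocycles_iff fun_eq_iff extensional_def)
  next
    case (Suc m)
    interpret F: right_module A "F n" by (rule F_module)
    interpret F0: right_module A "F m" by (rule F_module)
    obtain s where s: "rlin A (F m) (F (Suc m)) s"
      "\<And>y. y \<in> carrier (F (Suc m)) \<Longrightarrow> d m (s (d m y)) = d m y"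
      using partial_splitting[OF assms(1)] by blast
    let ?g = "\<lambda>y. f (s y)"
    have flin: "rlin A (F n) N f" using f by (simp add: cocycles_iff)
    have g: "restrict ?g (carrier (F m)) \<in> rmod_hom A (F m) N"
      using rlin_compose[OF s(1), of N f] flin Suc by (intro restrict_in_rmod_hom[OF F_module]) simp
    have "f y = f (s (d m y))" if y: "y \<in> carrier (F n)" for y
    proof -
      let ?r = "y \<ominus>\<^bsub>F n\<^esub> s (d m y)"
      have sc: "s (d m y) \<in> carrier (F n)" using s(1) d_closed y Suc by (auto simp: rlin_def)
      have rc: "?r \<in> carrier (F n)" using sc y by simp
      have y': "?r \<oplus>\<^bsub>F n\<^esub> s (d m y) = y"
        using y sc by (simp add: a_minus_def F.M.a_assoc F.M.l_neg)
      have "d m ?r \<oplus>\<^bsub>F m\<^esub> d m (s (d m y)) = d m (?r \<oplus>\<^bsub>F n\<^esub> s (d m y))"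
        using d_lin[of m] rc sc by (simp add: rlin_def Suc)
      then have "d m ?r \<oplus>\<^bsub>F m\<^esub> d m y = d m y" using s(2)[of y] y y' Suc by simp
      then have "d m ?r = \<zero>\<^bsub>F m\<^esub>"
        using d_closed[of _ m] y rc Suc F0.M.add.r_cancel_one by simp
      then obtain z where "z \<in> carrier (F (Suc n))" "?r = d n z"
        using exact[of ?r m] rc Suc by auto
      then have "f ?r = \<zero>\<^bsub>N\<^esub>" using f by (simp add: cocycles_iff)
      moreover have "f (?r \<oplus>\<^bsub>F n\<^esub> s (d m y)) = f ?r \<oplus>\<^bsub>N\<^esub> f (s (d m y))"
        using flin rc sc by (simp add: rlin_def)
      moreover have "f (s (d m y)) \<in> carrier N" using flin sc by (auto simp: rlin_def)
      ultimately show ?thesis using y' by simp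
    qed
    then have "f = compose (carrier (F (Suc m))) (restrict ?g (carrier (F m))) (d m)"
      using f d_closed[of _ m] Suc
      by (auto simp: compose_def restrict_def cocycles_iff fun_eq_iff extensional_def)
    then show ?thesis using g unfolding Suc coboundaries.simps by (rule image_eqI)
  qed
qed

end

lemma chosen_resolution_locale:
  fixes A :: "('a, 'm) ring_scheme" and M :: "('a, 'x) right_mod"
  assumes "right_module A M" "chosen_resolution A M = (F, d, \<epsilon>)"
  shows "resolution A M F d \<epsilon>"
proof -
  interpret right_module A M by fact
  have "free_resolution A M (chosen_resolution A M)"
    unfolding chosen_resolution_def by (rule someI_ex[OF free_resolution_exists[OF assms(1)]])
  then show ?thesis
    unfolding assms(2) by unfold_locales
qed

lemma trivial_Ext_iff:
  assumes "right_module A M" "right_module A N" "chosen_resolution A M = (F, d, \<epsilon>)"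
  shows "trivial_group (Ext A n M N) \<longleftrightarrow> cocycles A F d N n \<subseteq> coboundaries A F d N n"
proof -
  interpret resolution A M F d \<epsilon> by (rule chosen_resolution_locale) fact+
  show ?thesis
    unfolding Ext_def assms(3) prod.case
    by (rule trivial_quotient_iff[OF assms(2) coboundaries_subset[OF assms(2)]])
qed

section \<open>Coordinates with respect to the nonzero paths\<close>

definition good_paths :: "('v, 'e) pre_digraph \<Rightarrow> ('e \<Rightarrow> 'e \<Rightarrow> bool) \<Rightarrow> ('v \<times> 'e list) set" where
  "good_paths Q bad = {x \<in> quiver_paths Q. successively (\<lambda>a b. \<not> bad a b) (snd x)}"

text \<open>\<open>bad a b\<close> says that the path \<open>ab\<close> is zero in \<open>A\<close>, and \<open>\<rho> x z\<close> is the coefficient of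
  \<open>x\<close> at the path \<open>z\<close> with respect to the basis of \<open>A\<close> that consists of the nonzero paths.\<close>

locale path_coords = K: field K + A: ring A + V: assoc_algebra K A + Q: fin_digraph Q
  for K :: "('k, 'c) ring_scheme" and A :: "('k, 'a) module" (structure)
    and Q :: "('v, 'e) pre_digraph" +
  fixes bad :: "'e \<Rightarrow> 'e \<Rightarrow> bool" and \<rho> :: "'a \<Rightarrow> 'v \<times> 'e list \<Rightarrow> 'k"
  assumes \<rho>_inj: "inj_on \<rho> (carrier A)"
    and \<rho>_range: "\<rho> ` carrier A = {f. (\<forall>z. f z \<in> carrier K) \<and>
      (\<forall>z. z \<notin> good_paths Q bad \<longrightarrow> f z = \<zero>\<^bsub>K\<^esub>) \<and> finite {z. f z \<noteq> \<zero>\<^bsub>K\<^esub>}}"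
    and \<rho>_add: "\<lbrakk>x \<in> carrier A; y \<in> carrier A\<rbrakk> \<Longrightarrow> \<rho> (x \<oplus> y) z = \<rho> x z \<oplus>\<^bsub>K\<^esub> \<rho> y z"
    and \<rho>_smult: "\<lbrakk>c \<in> carrier K; x \<in> carrier A\<rbrakk> \<Longrightarrow> \<rho> (c \<odot>\<^bsub>A\<^esub> x) z = c \<otimes>\<^bsub>K\<^esub> \<rho> x z"
    and \<rho>_mult: "\<lbrakk>x \<in> carrier A; y \<in> carrier A; (u, p) \<in> good_paths Q bad\<rbrakk> \<Longrightarrow>
      \<rho> (x \<otimes> y) (u, p) =
        (\<Oplus>\<^bsub>K\<^esub>i\<in>{..length p}. \<rho> x (u, take i p) \<otimes>\<^bsub>K\<^esub> \<rho> y (Q.awlast u (take i p), drop i p))"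
begin

abbreviation "Good \<equiv> good_paths Q bad"

lemma \<rho>_closed [simp, intro]: "x \<in> carrier A \<Longrightarrow> \<rho> x z \<in> carrier K"
  and \<rho>_out: "x \<in> carrier A \<Longrightarrow> z \<notin> Good \<Longrightarrow> \<rho> x z = \<zero>\<^bsub>K\<^esub>"
  and \<rho>_finite: "x \<in> carrier A \<Longrightarrow> finite {z. \<rho> x z \<noteq> \<zero>\<^bsub>K\<^esub>}"
  using imageI[of x "carrier A" \<rho>] unfolding \<rho>_range by blast+

lemma \<rho>_eqI:
  assumes "x \<in> carrier A" "y \<in> carrier A" "\<And>u p. (u, p) \<in> Good \<Longrightarrow> \<rho> x (u, p) = \<rho> y (u, p)"
  shows "x = y"
proof (rule inj_onD[OF \<rho>_inj])
  show "\<rho> x = \<rho> y"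
  proof
    fix z show "\<rho> x z = \<rho> y z"
      using assms \<rho>_out[of x z] \<rho>_out[of y z] by (cases z; cases "z \<in> Good") auto
  qed
qed (use assms in auto)

lemma \<rho>_zero [simp]: "\<rho> \<zero> z = \<zero>\<^bsub>K\<^esub>"
  using \<rho>_add[of \<zero> \<zero> z] by simp

lemma \<rho>_uminus: "x \<in> carrier A \<Longrightarrow> \<rho> (\<ominus> x) z = \<ominus>\<^bsub>K\<^esub> \<rho> x z"
  using \<rho>_add[of "\<ominus> x" x z] by (simp add: A.l_neg K.minus_equality)

lemma \<rho>_minus: "x \<in> carrier A \<Longrightarrow> y \<in> carrier A \<Longrightarrow> \<rho> (x \<ominus> y) z = \<rho> x z \<ominus>\<^bsub>K\<^esub> \<rho> y z"
  by (simp add: a_minus_def \<rho>_add \<rho>_uminus)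

definition elt :: "('v \<times> 'e list \<Rightarrow> 'k) \<Rightarrow> 'a" where
  "elt f = inv_into (carrier A) \<rho> f"

lemma elt:
  assumes "\<And>z. f z \<in> carrier K" "\<And>z. z \<notin> Good \<Longrightarrow> f z = \<zero>\<^bsub>K\<^esub>" "finite {z. f z \<noteq> \<zero>\<^bsub>K\<^esub>}"
  shows "elt f \<in> carrier A" "\<rho> (elt f) = f"
proof -
  have "f \<in> \<rho> ` carrier A" unfolding \<rho>_range using assms by blast
  then show "elt f \<in> carrier A" "\<rho> (elt f) = f"
    unfolding elt_def by (auto intro: inv_into_into f_inv_into_f)
qed

lemma elt_filter:
  assumes "x \<in> carrier A"
  shows "elt (\<lambda>z. if P z then \<rho> x z else \<zero>\<^bsub>K\<^esub>) \<in> carrier A" (is "elt ?f \<in> _")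
    and "\<rho> (elt (\<lambda>z. if P z then \<rho> x z else \<zero>\<^bsub>K\<^esub>)) = (\<lambda>z. if P z then \<rho> x z else \<zero>\<^bsub>K\<^esub>)"
proof -
  have "finite {z. ?f z \<noteq> \<zero>\<^bsub>K\<^esub>}"
    by (rule finite_subset[OF _ \<rho>_finite[OF assms]]) auto
  then show "elt ?f \<in> carrier A" "\<rho> (elt ?f) = ?f"
    using assms \<rho>_out by (auto intro!: elt)
qed

definition pel :: "'v \<times> 'e list \<Rightarrow> 'a" where
  "pel z = elt (path_elem K z)"

lemma pel:
  assumes "z \<in> Good"
  shows "pel z \<in> carrier A" "\<rho> (pel z) = path_elem K z"
proof -
  have "finite {y. path_elem K z y \<noteq> \<zero>\<^bsub>K\<^esub>}"
    by (rule finite_subset[of _ "{z}"]) (auto simp: path_elem_def)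
  then show "pel z \<in> carrier A" "\<rho> (pel z) = path_elem K z"
    unfolding pel_def using assms by (auto intro!: elt simp: path_elem_def)
qed

lemma Good_Nil: "(w, []) \<in> Good \<longleftrightarrow> w \<in> verts Q"
  by (auto simp: good_paths_def quiver_paths_def Q.awalk_Nil_iff)

lemma Good_Cons: "(u, a # p) \<in> Good \<longleftrightarrow> a \<in> arcs Q \<and> u = tail Q a \<and> (head Q a, p) \<in> Good \<and>
    (p \<noteq> [] \<longrightarrow> \<not> bad a (hd p))"
  by (cases p) (auto simp: good_paths_def quiver_paths_def Q.awalk_Cons_iff)

lemma Good_arc: "a \<in> arcs Q \<Longrightarrow> (tail Q a, [a]) \<in> Good"
  by (simp add: Good_Cons Good_Nil)

lemma awlast_Cons: "Q.awlast u (a # p) = Q.awlast (head Q a) p"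
  by (cases p) (auto simp: Q.awalk_verts_conv)

abbreviation vert :: "'v \<Rightarrow> 'a" where "vert w \<equiv> pel (w, [])"
abbreviation arc :: "'e \<Rightarrow> 'a" where "arc a \<equiv> pel (tail Q a, [a])"

lemma vert_closed: "w \<in> verts Q \<Longrightarrow> vert w \<in> carrier A"
  by (simp add: pel Good_Nil)

lemma arc_closed: "a \<in> arcs Q \<Longrightarrow> arc a \<in> carrier A"
  by (simp add: pel Good_arc)

lemma \<rho>_vert_mult:
  assumes "w \<in> verts Q" "y \<in> carrier A"
  shows "\<rho> (vert w \<otimes> y) (u, p) = (if u = w then \<rho> y (u, p) else \<zero>\<^bsub>K\<^esub>)"
proof (cases "(u, p) \<in> Good")
  case True
  have "\<rho> (vert w \<otimes> y) (u, p) = (\<Oplus>\<^bsub>K\<^esub>i\<in>{..length p}. if 0 = i then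
      (if u = w then \<rho> y (u, p) else \<zero>\<^bsub>K\<^esub>) else \<zero>\<^bsub>K\<^esub>)"
    unfolding \<rho>_mult[OF vert_closed[OF assms(1)] assms(2) True] using assms
    by (intro K.finsum_cong') (auto simp: pel Good_Nil path_elem_def)
  also have "\<dots> = (if u = w then \<rho> y (u, p) else \<zero>\<^bsub>K\<^esub>)"
    using assms K.finsum_singleton[of 0 "{..length p}" "\<lambda>_. if u = w then \<rho> y (u, p) else \<zero>\<^bsub>K\<^esub>"] by auto
  finally show ?thesis .
qed (use assms vert_closed in \<open>auto simp: \<rho>_out\<close>)

lemma \<rho>_mult_vert:
  assumes "w \<in> verts Q" "y \<in> carrier A"
  shows "\<rho> (y \<otimes> vert w) (u, p) = (if Q.awlast u p = w then \<rho> y (u, p) else \<zero>\<^bsub>K\<^esub>)"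
proof (cases "(u, p) \<in> Good")
  case True
  have "\<rho> (y \<otimes> vert w) (u, p) = (\<Oplus>\<^bsub>K\<^esub>i\<in>{..length p}. if length p = i then
      (if Q.awlast u p = w then \<rho> y (u, p) else \<zero>\<^bsub>K\<^esub>) else \<zero>\<^bsub>K\<^esub>)"
    unfolding \<rho>_mult[OF assms(2) vert_closed[OF assms(1)] True] using assms
    by (intro K.finsum_cong') (auto simp: pel Good_Nil path_elem_def)
  also have "\<dots> = (if Q.awlast u p = w then \<rho> y (u, p) else \<zero>\<^bsub>K\<^esub>)"
    using assms K.finsum_singleton[of "length p" "{..length p}"
        "\<lambda>_. if Q.awlast u p = w then \<rho> y (u, p) else \<zero>\<^bsub>K\<^esub>"] by auto
  finally show ?thesis .
qed (use assms vert_closed in \<open>auto simp: \<rho>_out\<close>)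

text \<open>Left multiplication by an arrow prepends it to paths: in the sum over all splittings
  only the one after the first arrow survives.\<close>

lemma \<rho>_arc_mult:
  assumes "a \<in> arcs Q" "y \<in> carrier A" "(u, p) \<in> Good"
  shows "\<rho> (arc a \<otimes> y) (u, p) =
    (if p \<noteq> [] \<and> hd p = a then \<rho> y (head Q a, tl p) else \<zero>\<^bsub>K\<^esub>)" (is "_ = ?r")
proof -
  have eq: "\<rho> (arc a) (u, take i p) \<otimes>\<^bsub>K\<^esub> \<rho> y (Q.awlast u (take i p), drop i p) =
      (if 1 = i then ?r else \<zero>\<^bsub>K\<^esub>)" if "i \<le> length p" for i
  proof (cases p)
    case Nil
    then show ?thesis using assms that by (simp add: pel Good_arc path_elem_def)
  next
    case (Cons b q)
    have "u = tail Q b" using assms(3) Cons by (simp add: Good_Cons)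
    then show ?thesis using assms that Cons
      by (cases i; cases "i - 1"; cases q) (auto simp: pel Good_arc path_elem_def awlast_Cons)
  qed
  have "\<rho> (arc a \<otimes> y) (u, p) = (\<Oplus>\<^bsub>K\<^esub>i\<in>{..length p}. if 1 = i then ?r else \<zero>\<^bsub>K\<^esub>)"
    unfolding \<rho>_mult[OF arc_closed[OF assms(1)] assms(2,3)] using assms eq
    by (intro K.finsum_cong') auto
  also have "\<dots> = ?r"
  proof (cases "p = []")
    case False
    then have "1 \<in> {..length p}" by (cases p) auto
    then show ?thesis using assms K.finsum_singleton[of 1 "{..length p}" "\<lambda>_. ?r"] by auto
  next
    case True
    then show ?thesis by simp
  qed
  finally show ?thesis .
qed

lemma vert_idem: "w \<in> verts Q \<Longrightarrow> vert w \<otimes> vert w = vert w"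
  by (rule \<rho>_eqI) (auto simp: vert_closed \<rho>_vert_mult, auto simp: pel Good_Nil path_elem_def)

section \<open>Right ideals generated by vertices and arrows, in coordinates\<close>

lemma vert_mult_image: "w \<in> verts Q \<Longrightarrow>
    (\<otimes>) (vert w) ` carrier A = {x \<in> carrier A. \<forall>u p. \<rho> x (u, p) \<noteq> \<zero>\<^bsub>K\<^esub> \<longrightarrow> u = w}"
proof (intro equalityI subsetI)
  assume w: "w \<in> verts Q"
  { fix x assume "x \<in> (\<otimes>) (vert w) ` carrier A"
    then show "x \<in> {x \<in> carrier A. \<forall>u p. \<rho> x (u, p) \<noteq> \<zero>\<^bsub>K\<^esub> \<longrightarrow> u = w}"
      using w vert_closed by (auto simp: \<rho>_vert_mult split: if_splits) }
  { fix x assume x: "x \<in> {x \<in> carrier A. \<forall>u p. \<rho> x (u, p) \<noteq> \<zero>\<^bsub>K\<^esub> \<longrightarrow> u = w}"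
    then have c: "x \<in> carrier A" and 0: "\<And>u p. u \<noteq> w \<Longrightarrow> \<rho> x (u, p) = \<zero>\<^bsub>K\<^esub>" by blast+
    have "x = vert w \<otimes> x"
      using w c 0 by (intro \<rho>_eqI) (auto simp: vert_closed \<rho>_vert_mult)
    then show "x \<in> (\<otimes>) (vert w) ` carrier A" using c by (rule image_eqI) }
qed

text \<open>For a set \<open>S\<close> of arrows this is the direct sum of the right ideals aA with
  a in \<open>S\<close>; for all arrows out of \<open>w\<close> it is the radical of eA, with e the
  idempotent at \<open>w\<close>.\<close>

definition starting :: "'e set \<Rightarrow> 'a set" where
  "starting S = {x \<in> carrier A. \<forall>u p. \<rho> x (u, p) \<noteq> \<zero>\<^bsub>K\<^esub> \<longrightarrow> p \<noteq> [] \<and> hd p \<in> S}"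

text \<open>Right multiplication extends paths at their end and so preserves the first arrow; every
  nonempty prefix of a path has the first arrow of that path.\<close>

lemma right_ideal_starting: "right_ideal A (starting S)"
  unfolding right_ideal_def
proof (intro conjI ballI)
  fix x y assume xy: "x \<in> starting S" "y \<in> starting S"
  then have c: "x \<in> carrier A" "y \<in> carrier A" by (simp_all add: starting_def)
  have "\<rho> x (u, p) \<noteq> \<zero>\<^bsub>K\<^esub> \<or> \<rho> y (u, p) \<noteq> \<zero>\<^bsub>K\<^esub>" if "\<rho> (x \<oplus> y) (u, p) \<noteq> \<zero>\<^bsub>K\<^esub>" for u p
    using that c by (auto simp: \<rho>_add)
  then show "x \<oplus> y \<in> starting S" using xy c unfolding starting_def by blast
next
  fix x a assume x: "x \<in> starting S" and a: "a \<in> carrier A"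
  have xc: "x \<in> carrier A" using x by (simp add: starting_def)
  have "p \<noteq> [] \<and> hd p \<in> S" if nz: "\<rho> (x \<otimes> a) (u, p) \<noteq> \<zero>\<^bsub>K\<^esub>" for u p
  proof (rule ccontr)
    assume n: "\<not> (p \<noteq> [] \<and> hd p \<in> S)"
    have z: "\<rho> x (u, take i p) = \<zero>\<^bsub>K\<^esub>" for i
    proof -
      have "\<not> (take i p \<noteq> [] \<and> hd (take i p) \<in> S)" using n by (cases p; cases i) auto
      then show ?thesis using x unfolding starting_def by blast
    qed
    have g: "(u, p) \<in> Good" using nz xc a by (meson A.m_closed \<rho>_out)
    have "\<rho> (x \<otimes> a) (u, p) = \<zero>\<^bsub>K\<^esub>"
      unfolding \<rho>_mult[OF xc a g] using a by (intro K.add.finprod_one_eqI) (simp add: z)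
    then show False using nz by simp
  qed
  then show "x \<otimes> a \<in> starting S" using xc a by (auto simp: starting_def)
qed (auto simp: starting_def)

text \<open>aA is written as a(eA), with e the idempotent at the head of a, so that
  \<open>acyclic_ideal_mult_image\<close> applies with Z = eA.\<close>

lemma starting_singleton:
  assumes a: "a \<in> arcs Q"
  shows "starting {a} = (\<otimes>) (arc a) ` (\<otimes>) (vert (head Q a)) ` carrier A"
proof (intro equalityI subsetI)
  note h = Q.head_in_verts[OF a]
  fix x assume "x \<in> (\<otimes>) (arc a) ` (\<otimes>) (vert (head Q a)) ` carrier A"
  then obtain y where y: "y \<in> carrier A" "x = arc a \<otimes> y"
    using vert_closed[OF h] A.m_closed by blast
  have x: "x \<in> carrier A" using y arc_closed[OF a] by simp
  have "p \<noteq> [] \<and> hd p = a" if nz: "\<rho> x (u, p) \<noteq> \<zero>\<^bsub>K\<^esub>" for u p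
  proof -
    have "(u, p) \<in> Good" using nz x \<rho>_out by blast
    then show ?thesis using nz \<rho>_arc_mult[OF a y(1)] y(2) by (auto split: if_splits)
  qed
  then show "x \<in> starting {a}" using x by (auto simp: starting_def)
next
  note h = Q.head_in_verts[OF a]
  fix x assume "x \<in> starting {a}"
  then have x: "x \<in> carrier A" "\<And>u p. \<rho> x (u, p) \<noteq> \<zero>\<^bsub>K\<^esub> \<Longrightarrow> p \<noteq> [] \<and> hd p = a"
    by (auto simp: starting_def)
  \<comment> \<open>\<open>f\<close> strips the leading a from every path of x. The condition on the
    starting vertex puts the resulting element into eA.\<close>
  define f where "f = (\<lambda>(u, q). if u = head Q a then \<rho> x (tail Q a, a # q) else \<zero>\<^bsub>K\<^esub>)"
  have "{z. f z \<noteq> \<zero>\<^bsub>K\<^esub>} \<subseteq> (\<lambda>(u, p). (head Q a, tl p)) ` {z. \<rho> x z \<noteq> \<zero>\<^bsub>K\<^esub>}"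
  proof
    fix z assume "z \<in> {z. f z \<noteq> \<zero>\<^bsub>K\<^esub>}"
    then obtain q where "z = (head Q a, q)" "\<rho> x (tail Q a, a # q) \<noteq> \<zero>\<^bsub>K\<^esub>"
      by (cases z) (auto simp: f_def split: if_splits)
    then show "z \<in> (\<lambda>(u, p). (head Q a, tl p)) ` {z. \<rho> x z \<noteq> \<zero>\<^bsub>K\<^esub>}"
      by (intro image_eqI[of _ _ "(tail Q a, a # q)"]) simp_all
  qed
  then have fin: "finite {z. f z \<noteq> \<zero>\<^bsub>K\<^esub>}"
    using \<rho>_finite[OF x(1)] by (rule finite_subset[OF _ finite_imageI])
  have fK: "f z \<in> carrier K" for z using x(1) by (cases z) (simp add: f_def)
  have out: "f z = \<zero>\<^bsub>K\<^esub>" if "z \<notin> Good" for z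
    using that \<rho>_out[OF x(1)] by (cases z) (auto simp: f_def Good_Cons)
  note y = elt[of f, OF fK out fin]
  have "elt f \<in> (\<otimes>) (vert (head Q a)) ` carrier A"
    unfolding vert_mult_image[OF h] using y by (auto simp: f_def split: if_splits)
  moreover have "x = arc a \<otimes> elt f"
  proof (rule \<rho>_eqI)
    fix u p assume g: "(u, p) \<in> Good"
    have "\<rho> (arc a \<otimes> elt f) (u, p) = (if p \<noteq> [] \<and> hd p = a then f (head Q a, tl p) else \<zero>\<^bsub>K\<^esub>)"
      using \<rho>_arc_mult[OF a y(1) g] y(2) by simp
    also have "\<dots> = \<rho> x (u, p)"
    proof (cases "p \<noteq> [] \<and> hd p = a")
      case True
      then obtain q where "p = a # q" by (cases p) auto
      then show ?thesis using g by (simp add: f_def Good_Cons)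
    next
      case False
      then have "\<rho> x (u, p) = \<zero>\<^bsub>K\<^esub>" using x(2) by blast
      then show ?thesis unfolding if_not_P[OF False] by simp
    qed
    finally show "\<rho> x (u, p) = \<rho> (arc a \<otimes> elt f) (u, p)" by simp
  qed (use x y a arc_closed in auto)
  ultimately show "x \<in> (\<otimes>) (arc a) ` (\<otimes>) (vert (head Q a)) ` carrier A" by blast
qed

text \<open>Relations have length two, so whether ap vanishes depends only on the first arrow of p,
  and prepending a maps the surviving paths injectively to nonzero paths. Trivial paths survive,
  which is why the annihilator contains only paths of positive length.\<close>

lemma arc_annihilator:
  assumes a: "a \<in> arcs Q"
  shows "{z \<in> (\<otimes>) (vert (head Q a)) ` carrier A. arc a \<otimes> z = \<zero>} =
    starting {b \<in> arcs Q. tail Q b = head Q a \<and> bad a b}"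
proof (intro equalityI subsetI)
  note h = Q.head_in_verts[OF a]
  fix z assume "z \<in> {z \<in> (\<otimes>) (vert (head Q a)) ` carrier A. arc a \<otimes> z = \<zero>}"
  then have z: "z \<in> carrier A" "\<And>u p. \<rho> z (u, p) \<noteq> \<zero>\<^bsub>K\<^esub> \<Longrightarrow> u = head Q a" "arc a \<otimes> z = \<zero>"
    unfolding vert_mult_image[OF h] by auto
  have "p \<noteq> [] \<and> hd p \<in> {b \<in> arcs Q. tail Q b = head Q a \<and> bad a b}"
    if nz: "\<rho> z (u, p) \<noteq> \<zero>\<^bsub>K\<^esub>" for u p
  proof -
    have g: "(u, p) \<in> Good" and u: "u = head Q a" using nz z \<rho>_out by blast+
    have "(tail Q a, a # p) \<notin> Good"
    proof
      assume g': "(tail Q a, a # p) \<in> Good"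
      have "\<rho> (arc a \<otimes> z) (tail Q a, a # p) = \<rho> z (u, p)"
        unfolding \<rho>_arc_mult[OF a z(1) g'] by (simp add: u)
      then show False using z(3) nz by simp
    qed
    then show ?thesis using g u a by (cases p) (auto simp: Good_Cons)
  qed
  then show "z \<in> starting {b \<in> arcs Q. tail Q b = head Q a \<and> bad a b}"
    using z(1) by (simp add: starting_def)
next
  note h = Q.head_in_verts[OF a]
  fix z assume "z \<in> starting {b \<in> arcs Q. tail Q b = head Q a \<and> bad a b}"
  then have z: "z \<in> carrier A"
    "\<And>u p. \<rho> z (u, p) \<noteq> \<zero>\<^bsub>K\<^esub> \<Longrightarrow> p \<noteq> [] \<and> tail Q (hd p) = head Q a \<and> bad a (hd p)"
    by (auto simp: starting_def)
  have "u = head Q a" if nz: "\<rho> z (u, p) \<noteq> \<zero>\<^bsub>K\<^esub>" for u p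
  proof -
    have "(u, p) \<in> Good" using nz z \<rho>_out by blast
    then show ?thesis using z(2)[OF nz] by (cases p) (auto simp: Good_Cons)
  qed
  then have "z \<in> (\<otimes>) (vert (head Q a)) ` carrier A"
    unfolding vert_mult_image[OF h] using z(1) by blast
  moreover have "arc a \<otimes> z = \<zero>"
  proof (rule \<rho>_eqI)
    fix u p assume g: "(u, p) \<in> Good"
    then show "\<rho> (arc a \<otimes> z) (u, p) = \<rho> \<zero> (u, p)"
      unfolding \<rho>_arc_mult[OF a z(1) g] using z(2)[of "head Q a" "tl p"] by (cases p) (auto simp: Good_Cons)
  qed (use z a arc_closed in auto)
  ultimately show "z \<in> {z \<in> (\<otimes>) (vert (head Q a)) ` carrier A. arc a \<otimes> z = \<zero>}" by blast
qed

text \<open>The projection of a direct sum of ideals aA onto some of its summands. It is linear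
  because right multiplication does not change the first arrow.\<close>

lemma ideal_lin_filter:
  assumes "S \<subseteq> T"
  shows "ideal_lin A (starting T) (starting S)
    (\<lambda>x. elt (\<lambda>z. if hd (snd z) \<in> S then \<rho> x z else \<zero>\<^bsub>K\<^esub>))" (is "ideal_lin _ _ _ ?h")
  unfolding ideal_lin_def
proof (intro conjI ballI Pi_I)
  have c: "x \<in> carrier A" if "x \<in> starting T" for x using that by (simp add: starting_def)
  note f = elt_filter[OF c, of _ "\<lambda>z. hd (snd z) \<in> S"]
  fix x assume x: "x \<in> starting T"
  have nN: "p \<noteq> []" if "\<rho> x (u, p) \<noteq> \<zero>\<^bsub>K\<^esub>" for u p using x that unfolding starting_def by blast
  show "?h x \<in> starting S"
    using f[OF x] nN by (simp add: starting_def)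
  {
    fix y assume y: "y \<in> starting T"
    have xy: "x \<oplus> y \<in> starting T" by (rule A.right_idealD(4)[OF right_ideal_starting x y])
    show "?h (x \<oplus> y) = ?h x \<oplus> ?h y"
      by (rule \<rho>_eqI) (use f[OF x] f[OF y] f[OF xy] c x y in \<open>auto simp: \<rho>_add\<close>)
  }
  fix a assume a: "a \<in> carrier A"
  have xa: "x \<otimes> a \<in> starting T" by (rule A.right_idealD(5)[OF right_ideal_starting x a])
  show "?h (x \<otimes> a) = ?h x \<otimes> a"
  proof (rule \<rho>_eqI)
    fix u p assume g: "(u, p) \<in> Good"
    have n0: "\<rho> x (u, []) = \<zero>\<^bsub>K\<^esub>" using nN by blast
    \<comment> \<open>For i = 0 the prefix is empty and its \<open>hd\<close> is unspecified; this
      is harmless because the coefficients at trivial paths vanish.\<close>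
    have *: "(if hd (take i p) \<in> S then \<rho> x (u, take i p) else \<zero>\<^bsub>K\<^esub>) =
        (if hd p \<in> S then \<rho> x (u, take i p) else \<zero>\<^bsub>K\<^esub>)" for i
      using n0 by (cases i; cases p) auto
    have "\<rho> (?h x \<otimes> a) (u, p) = (\<Oplus>\<^bsub>K\<^esub>i\<in>{..length p}.
        (if hd p \<in> S then \<rho> x (u, take i p) else \<zero>\<^bsub>K\<^esub>) \<otimes>\<^bsub>K\<^esub> \<rho> a (Q.awlast u (take i p), drop i p))"
      unfolding \<rho>_mult[OF f(1)[OF x] a g] f(2)[OF x] snd_conv * ..
    also have "\<dots> = (if hd p \<in> S then \<rho> (x \<otimes> a) (u, p) else \<zero>\<^bsub>K\<^esub>)"
      using \<rho>_mult[OF c[OF x] a g] a by simp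
    finally show "\<rho> (?h (x \<otimes> a)) (u, p) = \<rho> (?h x \<otimes> a) (u, p)" by (simp add: f(2)[OF xa])
  qed (use f[OF x] f[OF xa] a in auto)
qed

lemma filter_sum:
  assumes "x \<in> starting T" "S \<inter> S' = {}" "T = S \<union> S'"
  shows "x = elt (\<lambda>z. if hd (snd z) \<in> S then \<rho> x z else \<zero>\<^bsub>K\<^esub>) \<oplus>
    elt (\<lambda>z. if hd (snd z) \<in> S' then \<rho> x z else \<zero>\<^bsub>K\<^esub>)"
proof (rule \<rho>_eqI)
  have c: "x \<in> carrier A" using assms(1) by (simp add: starting_def)
  note f = elt_filter[OF c]
  fix u p
  have "\<rho> x (u, p) \<noteq> \<zero>\<^bsub>K\<^esub> \<Longrightarrow> hd p \<in> T" using assms(1) unfolding starting_def by blast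
  then show "\<rho> x (u, p) = \<rho> (elt (\<lambda>z. if hd (snd z) \<in> S then \<rho> x z else \<zero>\<^bsub>K\<^esub>) \<oplus>
    elt (\<lambda>z. if hd (snd z) \<in> S' then \<rho> x z else \<zero>\<^bsub>K\<^esub>)) (u, p)"
    using f c assms(2,3) by (auto simp: \<rho>_add)
qed (use elt_filter assms in \<open>auto simp: starting_def\<close>)

end

section \<open>Acyclic right ideals of a gentle algebra\<close>

text \<open>\<open>bounded\<close> is what remains of admissibility in coordinates: it says that the
  arrow ideal of \<open>A\<close> is nilpotent, and it starts the downward induction in
  \<open>carrier_zero\<close>.\<close>

locale gentle_coords = path_coords K A Q bad \<rho>
  for K :: "('k, 'c) ring_scheme" and A :: "('k, 'a) module" (structure)
    and Q :: "('v, 'e) pre_digraph" and bad \<rho> +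
  assumes bad_fwd: "\<lbrakk>a \<in> arcs Q; b \<in> arcs Q; b' \<in> arcs Q; tail Q b = head Q a; tail Q b' = head Q a;
      bad a b; bad a b'\<rbrakk> \<Longrightarrow> b = b'"
    and bad_bwd: "\<lbrakk>b \<in> arcs Q; a \<in> arcs Q; a' \<in> arcs Q; head Q a = tail Q b; head Q a' = tail Q b;
      bad a b; bad a' b\<rbrakk> \<Longrightarrow> a = a'"
    and not_bad_bwd: "\<lbrakk>b \<in> arcs Q; a \<in> arcs Q; a' \<in> arcs Q; head Q a = tail Q b; head Q a' = tail Q b;
      \<not> bad a b; \<not> bad a' b\<rbrakk> \<Longrightarrow> a = a'"
    and bounded: "\<exists>m. \<forall>(u, p)\<in>good_paths Q bad. length p < m"
begin

definition rel :: "'e \<Rightarrow> 'e \<Rightarrow> bool" where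
  "rel a b \<longleftrightarrow> a \<in> arcs Q \<and> b \<in> arcs Q \<and> tail Q b = head Q a \<and> bad a b"

text \<open>The arrows that do not lie on an oriented cycle with full relations.\<close>

inductive noncyclic :: "'e \<Rightarrow> bool" where
  noncyclicI: "(\<And>b. rel a b \<Longrightarrow> noncyclic b) \<Longrightarrow> noncyclic a"

text \<open>By \<open>bad_bwd\<close>, an injective choice of successors; on a finite set it is onto.\<close>

lemma rel_predecessor:
  assumes "a \<in> arcs Q" "\<not> noncyclic a"
  shows "\<exists>b. rel b a"
proof -
  let ?C = "{a \<in> arcs Q. \<not> noncyclic a}"
  have "\<forall>a\<in>?C. \<exists>b. b \<in> ?C \<and> rel a b"
  proof
    fix a assume "a \<in> ?C"
    then obtain b where "rel a b" "\<not> noncyclic b" using noncyclicI[of a] by blast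
    then show "\<exists>b. b \<in> ?C \<and> rel a b" by (auto simp: rel_def)
  qed
  from bchoice[OF this] obtain g where "\<forall>a\<in>?C. g a \<in> ?C \<and> rel a (g a)" ..
  then have g: "\<And>a. a \<in> ?C \<Longrightarrow> g a \<in> ?C" "\<And>a. a \<in> ?C \<Longrightarrow> rel a (g a)"
    by simp_all
  have "inj_on g ?C"
  proof (rule inj_onI)
    fix a a' assume a: "a \<in> ?C" "a' \<in> ?C" and eq: "g a = g a'"
    have "rel a (g a)" "rel a' (g a)" using g(2)[OF a(1)] g(2)[OF a(2)] eq by simp_all
    then show "a = a'" unfolding rel_def by (intro bad_bwd[of "g a"]) simp_all
  qed
  moreover have "g ` ?C \<subseteq> ?C" using g(1) by blast
  ultimately have "g ` ?C = ?C" by (intro endo_inj_surj) simp_all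
  moreover have "a \<in> ?C" using assms by simp
  ultimately obtain b where "b \<in> ?C" "a = g b" by blast
  then show ?thesis using g(2)[of b] by blast
qed

lemma starting_disjoint:
  assumes "x \<in> starting S" "x \<in> starting T" "S \<inter> T = {}"
  shows "x = \<zero>"
proof (rule \<rho>_eqI)
  fix u p show "\<rho> x (u, p) = \<rho> \<zero> (u, p)"
    using assms unfolding starting_def by (simp, blast)
qed (use assms in \<open>auto simp: starting_def\<close>)

lemma starting_mono: "S \<subseteq> T \<Longrightarrow> starting S \<subseteq> starting T"
  by (auto simp: starting_def)

abbreviation out :: "'v \<Rightarrow> 'e set" where "out w \<equiv> {b \<in> arcs Q. tail Q b = w}"

lemma starting_subset_vert:
  assumes "w \<in> verts Q" "S \<subseteq> out w"
  shows "starting S \<subseteq> (\<otimes>) (vert w) ` carrier A"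
proof
  fix x assume x: "x \<in> starting S"
  have "u = w" if nz: "\<rho> x (u, p) \<noteq> \<zero>\<^bsub>K\<^esub>" for u p
  proof -
    have "(u, p) \<in> Good" "p \<noteq> []" "hd p \<in> S" using nz x \<rho>_out unfolding starting_def by blast+
    then show ?thesis using assms(2) by (cases p) (auto simp: Good_Cons)
  qed
  moreover have "x \<in> carrier A" using x by (simp add: starting_def)
  ultimately show "x \<in> (\<otimes>) (vert w) ` carrier A"
    unfolding vert_mult_image[OF assms(1)] by blast
qed

section \<open>Generators of simple modules modulo suitable right ideals\<close>

text \<open>\<open>lam w\<close> is the character by which \<open>A\<close> acts on the simple module at \<open>w\<close>.\<close>

definition lam :: "'v \<Rightarrow> 'a \<Rightarrow> 'k" where "lam w a = \<rho> a (w, [])"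

lemma lam_closed [simp]: "a \<in> carrier A \<Longrightarrow> lam w a \<in> carrier K"
  by (simp add: lam_def)

text \<open>The class of e modulo the radical of eA spans the simple module at \<open>w\<close>:
  subtracting the multiple of e removes the coefficient at the trivial path, and only paths of
  positive length out of \<open>w\<close> are left.\<close>

lemma vert_eigen:
  assumes "w \<in> verts Q" "a \<in> carrier A"
  shows "vert w \<otimes> a \<ominus> lam w a \<odot>\<^bsub>A\<^esub> vert w \<in> starting (out w)"
proof -
  note v = vert_closed[OF assms(1)]
  have c: "vert w \<otimes> a \<in> carrier A" "lam w a \<odot>\<^bsub>A\<^esub> vert w \<in> carrier A"
    using assms v by auto
  have "p \<noteq> [] \<and> hd p \<in> out w" if nz: "\<rho> (vert w \<otimes> a \<ominus> lam w a \<odot>\<^bsub>A\<^esub> vert w) (u, p) \<noteq> \<zero>\<^bsub>K\<^esub>" for u p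
  proof -
    have "(u, p) \<in> Good" using nz c \<rho>_out by blast
    have "\<rho> (vert w \<otimes> a \<ominus> lam w a \<odot>\<^bsub>A\<^esub> vert w) (u, p) = (if u = w then \<rho> a (u, p) else \<zero>\<^bsub>K\<^esub>) \<ominus>\<^bsub>K\<^esub>
        lam w a \<otimes>\<^bsub>K\<^esub> (if (u, p) = (w, []) then \<one>\<^bsub>K\<^esub> else \<zero>\<^bsub>K\<^esub>)"
      using c assms v by (simp add: \<rho>_minus \<rho>_smult \<rho>_vert_mult pel(2) Good_Nil path_elem_def)
    then have "u = w" "p \<noteq> []"
      using nz assms by (auto simp: lam_def a_minus_def K.r_neg split: if_splits)
    then show ?thesis using \<open>(u, p) \<in> Good\<close> by (cases p) (auto simp: Good_Cons)
  qed
  then show ?thesis using c by (simp add: starting_def)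
qed

lemma arc_mult_filter:
  assumes a: "a \<in> arcs Q" and z: "z \<in> starting (out (head Q a))"
  shows "\<exists>z'\<in>starting {b \<in> out (head Q a). \<not> bad a b}. arc a \<otimes> z = arc a \<otimes> z'"
proof -
  let ?S = "{b \<in> out (head Q a). \<not> bad a b}"
  let ?z = "elt (\<lambda>y. if hd (snd y) \<in> ?S then \<rho> z y else \<zero>\<^bsub>K\<^esub>)"
  have zc: "z \<in> carrier A" and z0: "\<rho> z (u, []) = \<zero>\<^bsub>K\<^esub>" for u
    using z unfolding starting_def by blast+
  note f = elt_filter[OF zc, of "\<lambda>y. hd (snd y) \<in> ?S"]
  have "ideal_lin A (starting (out (head Q a))) (starting ?S)
      (\<lambda>x. elt (\<lambda>y. if hd (snd y) \<in> ?S then \<rho> x y else \<zero>\<^bsub>K\<^esub>))"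
    by (rule ideal_lin_filter) blast
  then have "?z \<in> starting ?S"
    unfolding ideal_lin_def by (elim conjE) (rule funcset_mem[OF _ z])
  moreover have "arc a \<otimes> z = arc a \<otimes> ?z"
  proof (rule \<rho>_eqI)
    fix u p assume g: "(u, p) \<in> Good"
    have "\<rho> z (head Q a, q) = \<rho> ?z (head Q a, q)" if "p = a # q" for q
      using g that z0[of "head Q a"] unfolding f(2) by (cases q) (auto simp: Good_Cons)
    then show "\<rho> (arc a \<otimes> z) (u, p) = \<rho> (arc a \<otimes> ?z) (u, p)"
      unfolding \<rho>_arc_mult[OF a zc g] \<rho>_arc_mult[OF a f(1) g] by (cases p) auto
  qed (use zc f(1) a arc_closed in auto)
  ultimately show ?thesis by blast
qed

text \<open>This is \<open>vert_eigen\<close> multiplied by a from the left, using ae = a. It shows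
  that a spans the simple module at its head modulo the radical of aA.\<close>

lemma arc_eigen:
  assumes a: "a \<in> arcs Q" and x: "x \<in> carrier A"
  shows "\<exists>z\<in>starting {b \<in> out (head Q a). \<not> bad a b}.
    arc a \<otimes> x \<ominus> lam (head Q a) x \<odot>\<^bsub>A\<^esub> arc a = arc a \<otimes> z"
proof -
  let ?w = "head Q a"
  have w: "?w \<in> verts Q" using a by simp
  note c = arc_closed[OF a] vert_closed[OF w]
  have av: "arc a \<otimes> vert ?w = arc a"
  proof (rule \<rho>_eqI)
    fix u p assume "(u, p) \<in> Good"
    show "\<rho> (arc a \<otimes> vert ?w) (u, p) = \<rho> (arc a) (u, p)"
      unfolding \<rho>_mult_vert[OF w c(1)] using a w
      by (auto simp: pel Good_arc path_elem_def awlast_Cons Q.awalk_verts_conv)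
  qed (use c in auto)
  have "arc a \<otimes> (vert ?w \<otimes> x \<ominus> lam ?w x \<odot>\<^bsub>A\<^esub> vert ?w) = arc a \<otimes> x \<ominus> lam ?w x \<odot>\<^bsub>A\<^esub> arc a"
    using c x by (simp add: a_minus_def A.r_distr A.r_minus A.m_assoc[symmetric] av V.smult_mult_right)
  then show ?thesis using arc_mult_filter[OF a vert_eigen[OF w x]] by simp
qed

text \<open>By \<open>arc_annihilator\<close> the elements killed by a involve only first arrows b
  with ab = 0, and those of z are all of the opposite kind.\<close>

lemma arc_inj:
  assumes "a \<in> arcs Q" "z \<in> starting {b \<in> out (head Q a). \<not> bad a b}" "arc a \<otimes> z = \<zero>"
  shows "z = \<zero>"
proof (rule starting_disjoint[OF assms(2)])
  have "z \<in> (\<otimes>) (vert (head Q a)) ` carrier A"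
    using starting_subset_vert[of "head Q a" "{b \<in> out (head Q a). \<not> bad a b}"] assms by auto
  then show "z \<in> starting {b \<in> arcs Q. tail Q b = head Q a \<and> bad a b}"
    using arc_annihilator[OF assms(1)] assms(3) by blast
qed blast

end

locale gentle_resolution = gentle_coords K A Q bad \<rho> + R: resolution A M F d \<epsilon>
  for K :: "('k, 'c) ring_scheme" and A :: "('k, 'a) module" (structure)
    and Q :: "('v, 'e) pre_digraph" and bad \<rho> and M F d \<epsilon> +
  assumes acyclic_carrier: "R.acyclic_ideal (carrier A)"
begin

section \<open>Acyclic ideals generated by arrows, and the embedding of simple modules\<close>

lemma starting_empty: "starting {} = {\<zero>}"
  using starting_disjoint[of _ "{}" "{}"] by (auto simp: starting_def)

text \<open>The direct sum decomposition by first arrows, split off one arrow at a time.\<close>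

lemma acyclic_starting:
  assumes "finite S" "\<And>b. b \<in> S \<Longrightarrow> R.acyclic_ideal (starting {b})"
  shows "R.acyclic_ideal (starting S)"
  using assms
proof (induction S)
  case empty
  then show ?case by (simp add: starting_empty R.acyclic_ideal_zero)
next
  case (insert b S)
  show ?case
  proof (rule R.acyclic_ideal_sum[OF right_ideal_starting right_ideal_starting _ right_ideal_starting])
    show "R.acyclic_ideal (starting {b})" "R.acyclic_ideal (starting S)" using insert by auto
    show "starting {b} \<subseteq> starting (insert b S)" "starting S \<subseteq> starting (insert b S)"
      by (auto intro!: starting_mono)
    show "ideal_lin A (starting (insert b S)) (starting {b})
        (\<lambda>x. elt (\<lambda>z. if hd (snd z) \<in> {b} then \<rho> x z else \<zero>\<^bsub>K\<^esub>))"
      "ideal_lin A (starting (insert b S)) (starting S)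
        (\<lambda>x. elt (\<lambda>z. if hd (snd z) \<in> S then \<rho> x z else \<zero>\<^bsub>K\<^esub>))"
      by (rule ideal_lin_filter, blast)+
    show "x = elt (\<lambda>z. if hd (snd z) \<in> {b} then \<rho> x z else \<zero>\<^bsub>K\<^esub>) \<oplus>
        elt (\<lambda>z. if hd (snd z) \<in> S then \<rho> x z else \<zero>\<^bsub>K\<^esub>)" if "x \<in> starting (insert b S)" for x
      using that insert.hyps by (intro filter_sum) auto
  qed
qed

lemma vert_ideal:
  assumes "w \<in> verts Q"
  shows "right_ideal A ((\<otimes>) (vert w) ` carrier A)" "R.acyclic_ideal ((\<otimes>) (vert w) ` carrier A)"
  using A.right_ideal_image[OF A.right_ideal_carrier vert_closed[OF assms]]
    R.acyclic_ideal_idem[OF acyclic_carrier vert_closed[OF assms] vert_idem[OF assms]] by auto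

text \<open>\<open>0 \<rightarrow> bA \<rightarrow> eA \<rightarrow> aA \<rightarrow> 0\<close> is exact, where \<open>e\<close> is the idempotent at the head of \<open>a\<close> and \<open>b\<close>
  is the arrow with \<open>ab = 0\<close>, if there is one.\<close>

lemma acyclic_noncyclic:
  assumes "noncyclic a" "a \<in> arcs Q"
  shows "R.acyclic_ideal (starting {a})"
  using assms
proof induction
  case (noncyclicI a)
  have h: "head Q a \<in> verts Q" using noncyclicI by simp
  have "R.acyclic_ideal (starting {b \<in> arcs Q. tail Q b = head Q a \<and> bad a b})"
    by (rule acyclic_starting) (use noncyclicI in \<open>auto simp: rel_def\<close>)
  then show ?case
    using R.acyclic_ideal_mult_image[OF vert_ideal(1)[OF h] arc_closed vert_ideal(2)[OF h]]
      noncyclicI.prems by (simp add: starting_singleton arc_annihilator)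
qed

text \<open>The simple module at \<open>w\<close> embeds into \<open>A / Y\<close>, generated by the class of \<open>x\<close>.\<close>

lemma simple_in_quotient:
  assumes w: "w \<in> verts Q"
  shows "\<exists>Y x. right_ideal A Y \<and> R.acyclic_ideal Y \<and> x \<in> carrier A \<and> x \<notin> Y \<and>
    (\<forall>a\<in>carrier A. x \<otimes> a \<ominus> lam w a \<odot>\<^bsub>A\<^esub> x \<in> Y)"
proof (cases "\<forall>b\<in>out w. noncyclic b")
  case True
  \<comment> \<open>The trivial path has coefficient 1 in e and 0 in every element of the radical,
    so e is not in \<open>Y\<close>.\<close>
  have "\<rho> (vert w) (w, []) \<noteq> \<zero>\<^bsub>K\<^esub>" using w by (simp add: pel Good_Nil path_elem_def)
  then have "vert w \<notin> starting (out w)" unfolding starting_def by blast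
  moreover have "R.acyclic_ideal (starting (out w))"
    by (rule acyclic_starting, simp, rule acyclic_noncyclic) (use True in auto)
  ultimately show ?thesis
    using right_ideal_starting vert_closed[OF w] vert_eigen[OF w] by blast
next
  case False
  then obtain b where b: "b \<in> arcs Q" "tail Q b = w" "\<not> noncyclic b" by blast
  then obtain a where "rel a b" using rel_predecessor by blast
  then have a: "a \<in> arcs Q" "head Q a = w" "bad a b" using b by (auto simp: rel_def)
  note ac = arc_closed[OF a(1)]
  let ?S = "{b \<in> out w. \<not> bad a b}"
  show ?thesis
  proof (cases "\<forall>b\<in>?S. noncyclic b")
    case True
    let ?Y = "(\<otimes>) (arc a) ` starting ?S"
    have "R.acyclic_ideal (starting ?S)"
      by (rule acyclic_starting, simp, rule acyclic_noncyclic) (use True in auto)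
    \<comment> \<open>Left multiplication by a identifies \<open>starting ?S\<close> with the
      radical of aA, so the kernel in the exact sequence is zero.\<close>
    moreover have "{z \<in> starting ?S. arc a \<otimes> z = \<zero>} = {\<zero>}"
      using arc_inj[OF a(1)] a(2) ac A.right_idealD(3)[OF right_ideal_starting] by auto
    ultimately have "R.acyclic_ideal ?Y"
      using R.acyclic_ideal_zero by (intro R.acyclic_ideal_mult_image right_ideal_starting ac) auto
    moreover have "right_ideal A ?Y" by (intro A.right_ideal_image right_ideal_starting ac)
    moreover have "arc a \<notin> ?Y"
    proof
      assume "arc a \<in> ?Y"
      then obtain z where z: "z \<in> starting ?S" "arc a = arc a \<otimes> z" by blast
      then have zc: "z \<in> carrier A" "\<rho> z (w, []) = \<zero>\<^bsub>K\<^esub>" unfolding starting_def by blast+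
      have "\<rho> (arc a) (tail Q a, [a]) = \<rho> (arc a \<otimes> z) (tail Q a, [a])" using z(2) by simp
      then show False
        using zc a by (simp add: \<rho>_arc_mult Good_arc) (simp add: pel Good_arc path_elem_def)
    qed
    moreover have "arc a \<otimes> x \<ominus> lam w x \<odot>\<^bsub>A\<^esub> arc a \<in> ?Y" if "x \<in> carrier A" for x
      using arc_eigen[OF a(1) that] a(2) by auto
    ultimately show ?thesis using ac by blast
  next
    case False
    then obtain b' where b': "b' \<in> arcs Q" "tail Q b' = w" "\<not> bad a b'" "\<not> noncyclic b'" by blast
    then obtain a' where "rel a' b'" using rel_predecessor by blast
    then have a': "a' \<in> arcs Q" "head Q a' = w" "bad a' b'" using b' by (auto simp: rel_def)
    have ne: "a \<noteq> a'" using a' b' by blast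
    note ac' = arc_closed[OF a'(1)]
    let ?D = "arc a' \<ominus> arc a" and ?P = "(\<otimes>) (vert w) ` carrier A"
    have D: "?D \<in> carrier A" using ac ac' by simp
    have Dz: "?D \<otimes> z = arc a' \<otimes> z \<ominus> arc a \<otimes> z" if "z \<in> carrier A" for z
      using ac ac' that by (simp add: a_minus_def A.l_distr A.l_minus)
    have Pc: "z \<in> carrier A" if "z \<in> ?P" for z
      using that A.right_idealD(2)[OF vert_ideal(1)[OF w]] by blast
    have mem: "arc c \<otimes> z \<in> starting {c}" if "c \<in> arcs Q" "head Q c = w" "z \<in> ?P" for c z
      using that starting_singleton by blast
    \<comment> \<open>az and a'z have different first arrows, so they can agree only if both vanish.
      Then every first arrow in z is killed by both a and a', which \<open>bad_bwd\<close> excludes.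
      Hence eA is isomorphic to (a' - a)A.\<close>
    have "z = \<zero>" if z: "z \<in> ?P" "?D \<otimes> z = \<zero>" for z
    proof -
      have eq: "arc a' \<otimes> z = arc a \<otimes> z"
        using z Dz[OF Pc] Pc[OF z(1)] ac ac' A.r_right_minus_eq by simp
      then have "arc a' \<otimes> z = \<zero>"
        using mem[OF a(1,2) z(1)] mem[OF a'(1,2) z(1)] ne by (intro starting_disjoint[of _ "{a}" "{a'}"]) auto
      then have z': "z \<in> starting {b \<in> arcs Q. tail Q b = w \<and> bad a b}"
          "z \<in> starting {b \<in> arcs Q. tail Q b = w \<and> bad a' b}"
        using arc_annihilator[OF a(1)] arc_annihilator[OF a'(1)] eq z(1) a(2) a'(2) by auto
      have False if "b \<in> arcs Q" "tail Q b = w" "bad a b" "bad a' b" for b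
        using bad_bwd[of b a a'] that a a' ne by simp
      then show ?thesis by (intro starting_disjoint[OF z']) blast
    qed
    moreover have "\<zero> \<in> ?P" by (rule A.right_idealD(3)[OF vert_ideal(1)[OF w]])
    moreover have "?D \<otimes> \<zero> = \<zero>" using D by simp
    ultimately have "{z \<in> ?P. ?D \<otimes> z = \<zero>} = {\<zero>}" by blast
    then have "R.acyclic_ideal ((\<otimes>) ?D ` ?P)"
      using R.acyclic_ideal_mult_image[OF vert_ideal(1)[OF w] D vert_ideal(2)[OF w]] R.acyclic_ideal_zero
      by simp
    moreover have "right_ideal A ((\<otimes>) ?D ` ?P)" by (intro A.right_ideal_image vert_ideal w D)
    moreover have "arc a' \<notin> (\<otimes>) ?D ` ?P"
    proof
      assume "arc a' \<in> (\<otimes>) ?D ` ?P"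
      then obtain z where z: "z \<in> ?P" "arc a' = ?D \<otimes> z" by blast
      have zc: "z \<in> carrier A" using z Pc by blast
      \<comment> \<open>Coefficients are compared in a' = (a' - a)z: at the path a' they force the
        coefficient of z at the trivial path to be 1, at the path a they force it to be 0.\<close>
      have coef: "\<rho> (arc a') (u, p) = \<rho> (arc a' \<otimes> z) (u, p) \<ominus>\<^bsub>K\<^esub> \<rho> (arc a \<otimes> z) (u, p)" for u p
        by (subst z(2)) (use Dz[OF zc] zc ac ac' in \<open>simp add: \<rho>_minus\<close>)
      have "\<one>\<^bsub>K\<^esub> = \<rho> z (w, [])"
        using coef[of "tail Q a'" "[a']"] zc a a' ne
        by (simp add: \<rho>_arc_mult Good_arc a_minus_def) (simp add: pel Good_arc path_elem_def)
      moreover have "\<zero>\<^bsub>K\<^esub> = \<ominus>\<^bsub>K\<^esub> \<rho> z (w, [])"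
        using coef[of "tail Q a" "[a]"] zc a a' ne
        by (simp add: \<rho>_arc_mult Good_arc a_minus_def) (simp add: pel Good_arc path_elem_def)
      ultimately have "\<zero>\<^bsub>K\<^esub> = \<ominus>\<^bsub>K\<^esub> \<one>\<^bsub>K\<^esub>" by simp
      then have "\<ominus>\<^bsub>K\<^esub> \<zero>\<^bsub>K\<^esub> = \<one>\<^bsub>K\<^esub>" using K.minus_minus[OF K.one_closed] by simp
      then show False by simp
    qed
    moreover have "arc a' \<otimes> x \<ominus> lam w x \<odot>\<^bsub>A\<^esub> arc a' \<in> (\<otimes>) ?D ` ?P" if x: "x \<in> carrier A" for x
    proof -
      obtain z where z: "z \<in> starting {b \<in> out w. \<not> bad a' b}"
          "arc a' \<otimes> x \<ominus> lam w x \<odot>\<^bsub>A\<^esub> arc a' = arc a' \<otimes> z"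
        using arc_eigen[OF a'(1) x] a'(2) by auto
      have zP: "z \<in> ?P" using starting_subset_vert[OF w, of "{b \<in> out w. \<not> bad a' b}"] z(1) by blast
      \<comment> \<open>Since a and a' differ, \<open>not_bad_bwd\<close> shows that each arrow out
        of \<open>w\<close> that survives after a' is killed by a. Hence (a' - a)z = a'z, which puts
        the error term of \<open>arc_eigen\<close> into \<open>Y\<close>.\<close>
      have "{b \<in> out w. \<not> bad a' b} \<subseteq> {b \<in> arcs Q. tail Q b = w \<and> bad a b}"
      proof
        fix b assume "b \<in> {b \<in> out w. \<not> bad a' b}"
        then show "b \<in> {b \<in> arcs Q. tail Q b = w \<and> bad a b}"
          using not_bad_bwd[of b a a'] a a' ne by auto
      qed
      then have "z \<in> starting {b \<in> arcs Q. tail Q b = w \<and> bad a b}" using z(1) starting_mono by blast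
      then have "arc a \<otimes> z = \<zero>" using arc_annihilator[OF a(1)] a(2) by blast
      then have "?D \<otimes> z = arc a' \<otimes> z" using Dz[OF Pc[OF zP]] ac' Pc[OF zP] by (simp add: a_minus_def)
      then show ?thesis using zP z(2) by (metis image_eqI)
    qed
    ultimately show ?thesis using ac' by blast
  qed
qed

end

section \<open>Simple quotients\<close>

context path_coords
begin

abbreviation scal :: "'k \<Rightarrow> 'a" where "scal c \<equiv> c \<odot>\<^bsub>A\<^esub> \<one>"

lemma mult_scal: "\<lbrakk>a \<in> carrier A; c \<in> carrier K\<rbrakk> \<Longrightarrow> a \<otimes> scal c = c \<odot>\<^bsub>A\<^esub> a"
  by (simp add: V.smult_mult_right)

lemma scal_mult: "\<lbrakk>a \<in> carrier A; c \<in> carrier K\<rbrakk> \<Longrightarrow> scal c \<otimes> a = c \<odot>\<^bsub>A\<^esub> a"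
  by (simp add: V.smult_mult_left)

lemma scal_scal: "\<lbrakk>b \<in> carrier K; c \<in> carrier K\<rbrakk> \<Longrightarrow> scal (b \<otimes>\<^bsub>K\<^esub> c) = scal b \<otimes> scal c"
  by (simp add: scal_mult V.smult_assoc1)

lemma right_ideal_smult:
  "right_ideal A Y \<Longrightarrow> y \<in> Y \<Longrightarrow> c \<in> carrier K \<Longrightarrow> c \<odot>\<^bsub>A\<^esub> y \<in> Y"
  using A.right_idealD(5)[of Y y "scal c"] A.right_idealD(2)[of Y y] by (simp add: mult_scal)

text \<open>Subspaces of \<open>M\<close> over \<open>K\<close>, where a scalar acts through its
  multiple of the unit of \<open>A\<close>.\<close>

definition ksub :: "('a, 'x) right_mod \<Rightarrow> 'x set \<Rightarrow> bool" where
  "ksub M L \<longleftrightarrow> L \<subseteq> carrier M \<and> \<zero>\<^bsub>M\<^esub> \<in> L \<and> (\<forall>x\<in>L. \<forall>y\<in>L. x \<oplus>\<^bsub>M\<^esub> y \<in> L) \<and>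
     (\<forall>x\<in>L. \<forall>c\<in>carrier K. x \<triangleleft>\<^bsub>M\<^esub> scal c \<in> L)"

text \<open>A subspace \<open>N\<close> maximal among those that contain \<open>L\<close> but not
  \<open>m\<close> is a complement of the line through \<open>m\<close>, and \<phi> reads off the
  coefficient of \<open>m\<close> modulo \<open>N\<close>.\<close>

lemma exists_functional:
  assumes "right_module A M" and L: "ksub M L" and m: "m \<in> carrier M" "m \<notin> L"
  shows "\<exists>\<phi>. (\<forall>x\<in>carrier M. \<phi> x \<in> carrier K) \<and>
    (\<forall>x\<in>carrier M. \<forall>y\<in>carrier M. \<phi> (x \<oplus>\<^bsub>M\<^esub> y) = \<phi> x \<oplus>\<^bsub>K\<^esub> \<phi> y) \<and>
    (\<forall>x\<in>carrier M. \<forall>c\<in>carrier K. \<phi> (x \<triangleleft>\<^bsub>M\<^esub> scal c) = \<phi> x \<otimes>\<^bsub>K\<^esub> c) \<and>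
    (\<forall>x\<in>L. \<phi> x = \<zero>\<^bsub>K\<^esub>) \<and> \<phi> m = \<one>\<^bsub>K\<^esub>"
proof -
  interpret M: right_module A M by fact
  define S where "S = {N. ksub M N \<and> L \<subseteq> N \<and> m \<notin> N}"
  have "\<exists>N\<in>S. \<forall>T\<in>S. N \<subseteq> T \<longrightarrow> T = N"
  proof (rule subset_Zorn_nonempty)
    show "S \<noteq> {}" unfolding S_def using L m by blast
  next
    fix C assume ne: "C \<noteq> {}" and chain: "subset.chain S C"
    have C: "ksub M N" "L \<subseteq> N" "m \<notin> N" if "N \<in> C" for N
      using chain that unfolding subset.chain_def S_def by auto
    have "x \<oplus>\<^bsub>M\<^esub> y \<in> \<Union>C" if xy: "x \<in> \<Union>C" "y \<in> \<Union>C" for x y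
    proof -
      obtain N N' where N: "N \<in> C" "x \<in> N" "N' \<in> C" "y \<in> N'" using xy by blast
      then have "N \<subseteq> N' \<or> N' \<subseteq> N" using chain unfolding subset.chain_def by blast
      then show ?thesis using N C(1) unfolding ksub_def by blast
    qed
    moreover have "\<Union>C \<subseteq> carrier M" "\<zero>\<^bsub>M\<^esub> \<in> \<Union>C" "\<And>x c. x \<in> \<Union>C \<Longrightarrow> c \<in> carrier K \<Longrightarrow> x \<triangleleft>\<^bsub>M\<^esub> scal c \<in> \<Union>C"
      using C(1) ne unfolding ksub_def by blast+
    ultimately have "ksub M (\<Union>C)" by (simp add: ksub_def)
    then show "\<Union>C \<in> S" unfolding S_def using C(2,3) ne by blast
  qed
  then obtain N where NS: "N \<in> S" and "\<forall>T\<in>S. N \<subseteq> T \<longrightarrow> T = N" by (rule bexE)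
  then have max: "T = N" if "ksub M T" "N \<subseteq> T" "m \<notin> T" for T
    using that unfolding S_def by auto
  have N: "ksub M N" "L \<subseteq> N" "m \<notin> N" using NS unfolding S_def by simp_all
  have Nc: "x \<in> carrier M" if "x \<in> N" for x using N(1) that by (auto simp: ksub_def)
  have N0: "\<zero>\<^bsub>M\<^esub> \<in> N" and Nadd: "\<And>x y. x \<in> N \<Longrightarrow> y \<in> N \<Longrightarrow> x \<oplus>\<^bsub>M\<^esub> y \<in> N"
    and Nscal: "\<And>x c. x \<in> N \<Longrightarrow> c \<in> carrier K \<Longrightarrow> x \<triangleleft>\<^bsub>M\<^esub> scal c \<in> N"
    using N(1) by (simp_all add: ksub_def)
  have scc: "scal c \<in> carrier A" if "c \<in> carrier K" for c using that by simp
  have act_minus: "x \<triangleleft>\<^bsub>M\<^esub> scal (\<ominus>\<^bsub>K\<^esub> c) = \<ominus>\<^bsub>M\<^esub> (x \<triangleleft>\<^bsub>M\<^esub> scal c)"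
    if "x \<in> carrier M" "c \<in> carrier K" for x c
  proof -
    have "x \<triangleleft>\<^bsub>M\<^esub> scal (\<ominus>\<^bsub>K\<^esub> c) \<oplus>\<^bsub>M\<^esub> x \<triangleleft>\<^bsub>M\<^esub> scal c = x \<triangleleft>\<^bsub>M\<^esub> scal (\<ominus>\<^bsub>K\<^esub> c \<oplus>\<^bsub>K\<^esub> c)"
      using that by (simp add: M.act_add_right[symmetric] V.smult_l_distr)
    also have "\<dots> = \<zero>\<^bsub>M\<^esub>" using that by (simp add: K.l_neg)
    finally show ?thesis using that by (simp add: M.M.minus_equality)
  qed
  have ex: "\<exists>c\<in>carrier K. \<exists>n\<in>N. x = m \<triangleleft>\<^bsub>M\<^esub> scal c \<oplus>\<^bsub>M\<^esub> n" if x: "x \<in> carrier M" for x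
  proof (cases "x \<in> N")
    case True
    then show ?thesis using m x by (intro bexI[of _ "\<zero>\<^bsub>K\<^esub>"] bexI[of _ x]) auto
  next
    case False
    \<comment> \<open>N + Kx is strictly larger than \<open>N\<close>, so by maximality it contains
      \<open>m\<close>. The coefficient of x in \<open>m\<close> is nonzero because \<open>m\<close>
      is not in \<open>N\<close>, and the equation can be solved for x.\<close>
    let ?X = "{n \<oplus>\<^bsub>M\<^esub> x \<triangleleft>\<^bsub>M\<^esub> scal c | n c. n \<in> N \<and> c \<in> carrier K}"
    have "ksub M ?X" unfolding ksub_def
    proof (intro conjI ballI)
      show "?X \<subseteq> carrier M" using Nc x by auto
      have "\<zero>\<^bsub>M\<^esub> = \<zero>\<^bsub>M\<^esub> \<oplus>\<^bsub>M\<^esub> x \<triangleleft>\<^bsub>M\<^esub> scal \<zero>\<^bsub>K\<^esub>" using x by simp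
      then show "\<zero>\<^bsub>M\<^esub> \<in> ?X" using N0 K.zero_closed by blast
    next
      fix y z assume "y \<in> ?X" "z \<in> ?X"
      then obtain n c n' c' where *: "n \<in> N" "c \<in> carrier K" "y = n \<oplus>\<^bsub>M\<^esub> x \<triangleleft>\<^bsub>M\<^esub> scal c"
        "n' \<in> N" "c' \<in> carrier K" "z = n' \<oplus>\<^bsub>M\<^esub> x \<triangleleft>\<^bsub>M\<^esub> scal c'" by blast
      then have "y \<oplus>\<^bsub>M\<^esub> z = (n \<oplus>\<^bsub>M\<^esub> n') \<oplus>\<^bsub>M\<^esub> x \<triangleleft>\<^bsub>M\<^esub> scal (c \<oplus>\<^bsub>K\<^esub> c')"
        using x Nc by (simp add: V.smult_l_distr M.act_add_right M.M.a_ac)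
      then show "y \<oplus>\<^bsub>M\<^esub> z \<in> ?X" using * Nadd K.a_closed by blast
    next
      fix y b assume "y \<in> ?X" and b: "b \<in> carrier K"
      then obtain n c where *: "n \<in> N" "c \<in> carrier K" "y = n \<oplus>\<^bsub>M\<^esub> x \<triangleleft>\<^bsub>M\<^esub> scal c" by blast
      then have "y \<triangleleft>\<^bsub>M\<^esub> scal b = n \<triangleleft>\<^bsub>M\<^esub> scal b \<oplus>\<^bsub>M\<^esub> x \<triangleleft>\<^bsub>M\<^esub> scal (c \<otimes>\<^bsub>K\<^esub> b)"
        using x b Nc by (simp add: scal_scal M.act_add_left M.act_mult)
      then show "y \<triangleleft>\<^bsub>M\<^esub> scal b \<in> ?X" using * b Nscal K.m_closed by blast
    qed
    moreover have "N \<subseteq> ?X"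
    proof
      fix n assume n: "n \<in> N"
      then have "n = n \<oplus>\<^bsub>M\<^esub> x \<triangleleft>\<^bsub>M\<^esub> scal \<zero>\<^bsub>K\<^esub>" using x Nc by simp
      then show "n \<in> ?X" using n K.zero_closed by blast
    qed
    moreover have "x \<in> ?X"
    proof -
      have "x = \<zero>\<^bsub>M\<^esub> \<oplus>\<^bsub>M\<^esub> x \<triangleleft>\<^bsub>M\<^esub> scal \<one>\<^bsub>K\<^esub>" using x by (simp add: V.smult_one)
      then show ?thesis using N0 K.one_closed by blast
    qed
    ultimately have "m \<in> ?X" using max False by blast
    then obtain n c where nc: "n \<in> N" "c \<in> carrier K" "m = n \<oplus>\<^bsub>M\<^esub> x \<triangleleft>\<^bsub>M\<^esub> scal c" by blast
    have "c \<noteq> \<zero>\<^bsub>K\<^esub>" using nc N(3) x Nc by auto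
    then have i: "inv\<^bsub>K\<^esub> c \<in> carrier K" "c \<otimes>\<^bsub>K\<^esub> inv\<^bsub>K\<^esub> c = \<one>\<^bsub>K\<^esub>"
      using nc(2) K.field_Units by auto
    have "m \<triangleleft>\<^bsub>M\<^esub> scal (inv\<^bsub>K\<^esub> c) = n \<triangleleft>\<^bsub>M\<^esub> scal (inv\<^bsub>K\<^esub> c) \<oplus>\<^bsub>M\<^esub> x \<triangleleft>\<^bsub>M\<^esub> (scal c \<otimes> scal (inv\<^bsub>K\<^esub> c))"
      using nc x i Nc by (simp add: M.act_add_left M.act_mult)
    also have "scal c \<otimes> scal (inv\<^bsub>K\<^esub> c) = \<one>"
      using nc i by (simp add: scal_scal[symmetric] V.smult_one)
    finally have "x = m \<triangleleft>\<^bsub>M\<^esub> scal (inv\<^bsub>K\<^esub> c) \<oplus>\<^bsub>M\<^esub> n \<triangleleft>\<^bsub>M\<^esub> scal (\<ominus>\<^bsub>K\<^esub> (inv\<^bsub>K\<^esub> c))"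
      using x i nc(1) Nc by (simp add: act_minus M.M.a_ac M.M.r_neg1 M.M.r_neg)
    then show ?thesis using i nc(1) Nscal K.a_inv_closed by blast
  qed
  \<comment> \<open>Two different coefficients would put a nonzero multiple of \<open>m\<close>, and
    hence \<open>m\<close> itself, into \<open>N\<close>.\<close>
  have uniq: "b = c" if "b \<in> carrier K" "c \<in> carrier K" "n \<in> N" "k \<in> N"
      "m \<triangleleft>\<^bsub>M\<^esub> scal b \<oplus>\<^bsub>M\<^esub> n = m \<triangleleft>\<^bsub>M\<^esub> scal c \<oplus>\<^bsub>M\<^esub> k" for b c n k
  proof (rule ccontr)
    assume "b \<noteq> c"
    let ?e = "b \<ominus>\<^bsub>K\<^esub> c"
    have e: "?e \<in> carrier K" "?e \<noteq> \<zero>\<^bsub>K\<^esub>" using that \<open>b \<noteq> c\<close> by auto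
    then have i: "inv\<^bsub>K\<^esub> ?e \<in> carrier K" "?e \<otimes>\<^bsub>K\<^esub> inv\<^bsub>K\<^esub> ?e = \<one>\<^bsub>K\<^esub>"
      using K.field_Units by auto
    have minusN: "\<ominus>\<^bsub>M\<^esub> n \<in> N"
      using act_minus[of n "\<one>\<^bsub>K\<^esub>"] Nscal[of n "\<ominus>\<^bsub>K\<^esub> \<one>\<^bsub>K\<^esub>"] that(3) Nc by (simp add: V.smult_one)
    have cM: "m \<triangleleft>\<^bsub>M\<^esub> scal b \<in> carrier M" "m \<triangleleft>\<^bsub>M\<^esub> scal c \<in> carrier M" "n \<in> carrier M" "k \<in> carrier M"
      using m that Nc by auto
    have "m \<triangleleft>\<^bsub>M\<^esub> scal ?e = m \<triangleleft>\<^bsub>M\<^esub> scal b \<oplus>\<^bsub>M\<^esub> \<ominus>\<^bsub>M\<^esub> (m \<triangleleft>\<^bsub>M\<^esub> scal c)"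
      using m that by (simp add: a_minus_def V.smult_l_distr M.act_add_right act_minus)
    also have "m \<triangleleft>\<^bsub>M\<^esub> scal b = (m \<triangleleft>\<^bsub>M\<^esub> scal c \<oplus>\<^bsub>M\<^esub> k) \<oplus>\<^bsub>M\<^esub> \<ominus>\<^bsub>M\<^esub> n"
      using cM by (simp add: that(5)[symmetric] M.M.a_assoc M.M.r_neg)
    also have "\<dots> \<oplus>\<^bsub>M\<^esub> \<ominus>\<^bsub>M\<^esub> (m \<triangleleft>\<^bsub>M\<^esub> scal c) = k \<oplus>\<^bsub>M\<^esub> \<ominus>\<^bsub>M\<^esub> n"
      using cM by (simp add: M.M.a_ac M.M.r_neg M.M.r_neg2 M.M.r_neg1)
    finally have "m \<triangleleft>\<^bsub>M\<^esub> scal ?e \<in> N" using Nadd that(4) minusN by simp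
    then have "(m \<triangleleft>\<^bsub>M\<^esub> scal ?e) \<triangleleft>\<^bsub>M\<^esub> scal (inv\<^bsub>K\<^esub> ?e) \<in> N" using Nscal i(1) by blast
    moreover have "(m \<triangleleft>\<^bsub>M\<^esub> scal ?e) \<triangleleft>\<^bsub>M\<^esub> scal (inv\<^bsub>K\<^esub> ?e) = m \<triangleleft>\<^bsub>M\<^esub> scal (?e \<otimes>\<^bsub>K\<^esub> inv\<^bsub>K\<^esub> ?e)"
      using m e(1) i(1) by (simp add: scal_scal M.act_mult)
    ultimately show False using N(3) m(1) by (simp add: i(2) V.smult_one)
  qed
  define \<phi> where "\<phi> x = (SOME c. c \<in> carrier K \<and> (\<exists>n\<in>N. x = m \<triangleleft>\<^bsub>M\<^esub> scal c \<oplus>\<^bsub>M\<^esub> n))" for x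
  have \<phi>: "\<phi> x \<in> carrier K" "\<exists>n\<in>N. x = m \<triangleleft>\<^bsub>M\<^esub> scal (\<phi> x) \<oplus>\<^bsub>M\<^esub> n" if "x \<in> carrier M" for x
    using someI_ex[of "\<lambda>c. c \<in> carrier K \<and> (\<exists>n\<in>N. x = m \<triangleleft>\<^bsub>M\<^esub> scal c \<oplus>\<^bsub>M\<^esub> n)"] ex[OF that]
    unfolding \<phi>_def by blast+
  have \<phi>_eq: "\<phi> x = c" if "x \<in> carrier M" "c \<in> carrier K" "n \<in> N" "x = m \<triangleleft>\<^bsub>M\<^esub> scal c \<oplus>\<^bsub>M\<^esub> n" for x c n
    using \<phi>[OF that(1)] uniq[of "\<phi> x" c _ n] that by metis
  show ?thesis
  proof (intro exI[of _ \<phi>] conjI ballI)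
    fix x y assume x: "x \<in> carrier M" and y: "y \<in> carrier M"
    obtain n k where n: "n \<in> N" "x = m \<triangleleft>\<^bsub>M\<^esub> scal (\<phi> x) \<oplus>\<^bsub>M\<^esub> n"
        and k: "k \<in> N" "y = m \<triangleleft>\<^bsub>M\<^esub> scal (\<phi> y) \<oplus>\<^bsub>M\<^esub> k" using \<phi>(2) x y by metis
    have "x \<oplus>\<^bsub>M\<^esub> y = (m \<triangleleft>\<^bsub>M\<^esub> scal (\<phi> x) \<oplus>\<^bsub>M\<^esub> n) \<oplus>\<^bsub>M\<^esub> (m \<triangleleft>\<^bsub>M\<^esub> scal (\<phi> y) \<oplus>\<^bsub>M\<^esub> k)"
      using n(2) k(2) by simp
    also have "\<dots> = m \<triangleleft>\<^bsub>M\<^esub> scal (\<phi> x \<oplus>\<^bsub>K\<^esub> \<phi> y) \<oplus>\<^bsub>M\<^esub> (n \<oplus>\<^bsub>M\<^esub> k)"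
      using \<phi>(1)[OF x] \<phi>(1)[OF y] n(1) k(1) Nc m(1)
      by (simp add: V.smult_l_distr M.act_add_right M.M.a_ac)
    finally show "\<phi> (x \<oplus>\<^bsub>M\<^esub> y) = \<phi> x \<oplus>\<^bsub>K\<^esub> \<phi> y"
      by (rule \<phi>_eq[OF M.M.a_closed[OF x y] K.a_closed[OF \<phi>(1)[OF x] \<phi>(1)[OF y]] Nadd[OF n(1) k(1)]])
  next
    fix x c assume x: "x \<in> carrier M" and c: "c \<in> carrier K"
    obtain n where n: "n \<in> N" "x = m \<triangleleft>\<^bsub>M\<^esub> scal (\<phi> x) \<oplus>\<^bsub>M\<^esub> n" using \<phi>(2) x by metis
    have "x \<triangleleft>\<^bsub>M\<^esub> scal c = (m \<triangleleft>\<^bsub>M\<^esub> scal (\<phi> x) \<oplus>\<^bsub>M\<^esub> n) \<triangleleft>\<^bsub>M\<^esub> scal c" using n(2) by simp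
    also have "\<dots> = m \<triangleleft>\<^bsub>M\<^esub> scal (\<phi> x \<otimes>\<^bsub>K\<^esub> c) \<oplus>\<^bsub>M\<^esub> n \<triangleleft>\<^bsub>M\<^esub> scal c"
      using \<phi>(1)[OF x] n(1) Nc m(1) c by (simp add: scal_scal M.act_add_left M.act_mult)
    finally show "\<phi> (x \<triangleleft>\<^bsub>M\<^esub> scal c) = \<phi> x \<otimes>\<^bsub>K\<^esub> c"
      by (rule \<phi>_eq[OF M.act_closed[OF x scc[OF c]] K.m_closed[OF \<phi>(1)[OF x] c] Nscal[OF n(1) c]])
  next
    fix x assume "x \<in> L"
    then have "x \<in> N" using N(2) by blast
    then show "\<phi> x = \<zero>\<^bsub>K\<^esub>" using Nc m(1) by (intro \<phi>_eq[of x _ x]) auto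
  next
    show "\<phi> m = \<one>\<^bsub>K\<^esub>" using m(1) N0 by (intro \<phi>_eq) (auto simp: V.smult_one)
  qed (use \<phi>(1) in auto)
qed

end

section \<open>Vanishing of \<open>M\<close> from the absence of simple quotients\<close>

context gentle_resolution
begin

text \<open>\<phi> is a homomorphism from \<open>M\<close> to the simple module at \<open>w\<close>.
  Followed by the embedding into A / Y it becomes the map from x to the class of \<phi> x times e,
  which \<open>hom_quotient_eq_0\<close> forces to be zero; as e is not in \<open>Y\<close>, the
  scalar vanishes.\<close>

lemma character_zero:
  assumes w: "w \<in> verts Q" and \<phi>: "\<And>x. x \<in> carrier M \<Longrightarrow> \<phi> x \<in> carrier K"
    "\<And>x y. x \<in> carrier M \<Longrightarrow> y \<in> carrier M \<Longrightarrow> \<phi> (x \<oplus>\<^bsub>M\<^esub> y) = \<phi> x \<oplus>\<^bsub>K\<^esub> \<phi> y"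
    "\<And>x a. x \<in> carrier M \<Longrightarrow> a \<in> carrier A \<Longrightarrow> \<phi> (x \<triangleleft>\<^bsub>M\<^esub> a) = \<phi> x \<otimes>\<^bsub>K\<^esub> lam w a"
    and x: "x \<in> carrier M"
  shows "\<phi> x = \<zero>\<^bsub>K\<^esub>"
proof (rule ccontr)
  assume nz: "\<phi> x \<noteq> \<zero>\<^bsub>K\<^esub>"
  obtain Y e where Y: "right_ideal A Y" "R.acyclic_ideal Y" and e: "e \<in> carrier A" "e \<notin> Y"
    "\<And>a. a \<in> carrier A \<Longrightarrow> e \<otimes> a \<ominus> lam w a \<odot>\<^bsub>A\<^esub> e \<in> Y"
    using simple_in_quotient[OF w] by blast
  have \<phi>0: "\<phi> \<zero>\<^bsub>M\<^esub> = \<zero>\<^bsub>K\<^esub>"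
    using \<phi>(2)[of "\<zero>\<^bsub>M\<^esub>" "\<zero>\<^bsub>M\<^esub>"] \<phi>(1)[of "\<zero>\<^bsub>M\<^esub>"] by simp
  have "\<phi> x \<odot>\<^bsub>A\<^esub> e \<in> Y"
  proof (rule R.hom_quotient_eq_0[OF acyclic_carrier Y, where h = "\<lambda>x. \<phi> x \<odot>\<^bsub>A\<^esub> e"])
    fix y a assume y: "y \<in> carrier M" and a: "a \<in> carrier A"
    have "(\<phi> y \<odot>\<^bsub>A\<^esub> e) \<otimes> a \<ominus> \<phi> (y \<triangleleft>\<^bsub>M\<^esub> a) \<odot>\<^bsub>A\<^esub> e = \<phi> y \<odot>\<^bsub>A\<^esub> (e \<otimes> a \<ominus> lam w a \<odot>\<^bsub>A\<^esub> e)"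
      using y a e(1) \<phi>(1) lam_closed[OF a, of w]
      by (simp add: \<phi>(3) V.smult_mult_left a_minus_def V.smult_r_distr V.smult_assoc1 V.smult_r_minus)
    then show "(\<phi> y \<odot>\<^bsub>A\<^esub> e) \<otimes> a \<ominus> \<phi> (y \<triangleleft>\<^bsub>M\<^esub> a) \<odot>\<^bsub>A\<^esub> e \<in> Y"
      using right_ideal_smult[OF Y(1) e(3)[OF a] \<phi>(1)[OF y]] by simp
  qed (use \<phi>(1,2) \<phi>0 e(1) x in \<open>simp_all add: V.smult_l_distr\<close>)
  moreover have i: "inv\<^bsub>K\<^esub> \<phi> x \<in> carrier K" "inv\<^bsub>K\<^esub> \<phi> x \<otimes>\<^bsub>K\<^esub> \<phi> x = \<one>\<^bsub>K\<^esub>"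
    using nz \<phi>(1)[OF x] K.field_Units by auto
  ultimately have "inv\<^bsub>K\<^esub> \<phi> x \<odot>\<^bsub>A\<^esub> (\<phi> x \<odot>\<^bsub>A\<^esub> e) \<in> Y"
    using right_ideal_smult[OF Y(1)] by blast
  moreover have "inv\<^bsub>K\<^esub> \<phi> x \<odot>\<^bsub>A\<^esub> (\<phi> x \<odot>\<^bsub>A\<^esub> e) = e"
    using V.smult_assoc1[OF i(1) \<phi>(1)[OF x] e(1)] i(2) e(1) by (simp add: V.smult_one)
  ultimately show False using e(2) by simp
qed

text \<open>Otherwise some nonzero functional kills \<open>L\<close>. Since \<open>L\<close>
  contains the differences in \<open>D\<close>, that functional turns the action of b into
  multiplication by \<open>lam w b\<close>, contrary to \<open>character_zero\<close>.\<close>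

lemma ksub_eq_carrier:
  assumes w: "w \<in> verts Q" and L: "ksub M L"
    and D: "\<And>y b. y \<in> carrier M \<Longrightarrow> b \<in> carrier A \<Longrightarrow> y \<triangleleft>\<^bsub>M\<^esub> b \<ominus>\<^bsub>M\<^esub> y \<triangleleft>\<^bsub>M\<^esub> scal (lam w b) \<in> L"
  shows "L = carrier M"
proof (rule ccontr)
  assume "L \<noteq> carrier M"
  then obtain m where m: "m \<in> carrier M" "m \<notin> L" using L by (auto simp: ksub_def)
  obtain \<phi> where \<phi>: "\<And>x. x \<in> carrier M \<Longrightarrow> \<phi> x \<in> carrier K"
    "\<And>x y. x \<in> carrier M \<Longrightarrow> y \<in> carrier M \<Longrightarrow> \<phi> (x \<oplus>\<^bsub>M\<^esub> y) = \<phi> x \<oplus>\<^bsub>K\<^esub> \<phi> y"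
    "\<And>x c. x \<in> carrier M \<Longrightarrow> c \<in> carrier K \<Longrightarrow> \<phi> (x \<triangleleft>\<^bsub>M\<^esub> scal c) = \<phi> x \<otimes>\<^bsub>K\<^esub> c"
    "\<And>x. x \<in> L \<Longrightarrow> \<phi> x = \<zero>\<^bsub>K\<^esub>" "\<phi> m = \<one>\<^bsub>K\<^esub>"
    using exists_functional[OF R.M.right_module_axioms L m] by blast
  have "\<phi> m = \<zero>\<^bsub>K\<^esub>"
  proof (rule character_zero[OF w])
    fix y b assume y: "y \<in> carrier M" and b: "b \<in> carrier A"
    have c: "y \<triangleleft>\<^bsub>M\<^esub> b \<in> carrier M" "y \<triangleleft>\<^bsub>M\<^esub> scal (lam w b) \<in> carrier M" using y b by simp_all
    have "y \<triangleleft>\<^bsub>M\<^esub> b = (y \<triangleleft>\<^bsub>M\<^esub> b \<ominus>\<^bsub>M\<^esub> y \<triangleleft>\<^bsub>M\<^esub> scal (lam w b)) \<oplus>\<^bsub>M\<^esub> y \<triangleleft>\<^bsub>M\<^esub> scal (lam w b)"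
      using c by (simp add: a_minus_def R.M.M.a_assoc R.M.M.l_neg)
    then have "\<phi> (y \<triangleleft>\<^bsub>M\<^esub> b) = \<phi> (y \<triangleleft>\<^bsub>M\<^esub> b \<ominus>\<^bsub>M\<^esub> y \<triangleleft>\<^bsub>M\<^esub> scal (lam w b)) \<oplus>\<^bsub>K\<^esub> \<phi> (y \<triangleleft>\<^bsub>M\<^esub> scal (lam w b))"
      using c \<phi>(2)[of "y \<triangleleft>\<^bsub>M\<^esub> b \<ominus>\<^bsub>M\<^esub> y \<triangleleft>\<^bsub>M\<^esub> scal (lam w b)" "y \<triangleleft>\<^bsub>M\<^esub> scal (lam w b)"] by simp
    then show "\<phi> (y \<triangleleft>\<^bsub>M\<^esub> b) = \<phi> y \<otimes>\<^bsub>K\<^esub> lam w b"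
      using \<phi>(4)[OF D[OF y b]] \<phi>(3)[OF y lam_closed[OF b]] \<phi>(1)[OF y] b by simp
  qed (use m \<phi>(1,2) in auto)
  then show False using \<phi>(5) by simp
qed

text \<open>In the coordinates, membership in the n-th power of the arrow ideal of \<open>A\<close>.
  For n = 0 it is no condition.\<close>

definition deep :: "nat \<Rightarrow> 'a \<Rightarrow> bool" where
  "deep n a \<longleftrightarrow> (\<forall>u p. \<rho> a (u, p) \<noteq> \<zero>\<^bsub>K\<^esub> \<longrightarrow> n \<le> length p)"

lemma deep_mult:
  assumes "a \<in> carrier A" "b \<in> carrier A" "deep 1 a" "deep n b"
  shows "deep (Suc n) (a \<otimes> b)"
  unfolding deep_def
proof (intro allI impI)
  fix u p assume nz: "\<rho> (a \<otimes> b) (u, p) \<noteq> \<zero>\<^bsub>K\<^esub>"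
  have g: "(u, p) \<in> Good" using nz assms \<rho>_out[of "a \<otimes> b"] by auto
  show "Suc n \<le> length p"
  proof (rule ccontr)
    assume n: "\<not> Suc n \<le> length p"
    have "\<rho> a (u, take i p) \<otimes>\<^bsub>K\<^esub> \<rho> b (Q.awlast u (take i p), drop i p) = \<zero>\<^bsub>K\<^esub>" if "i \<le> length p" for i
    proof (cases i)
      case 0
      have "\<rho> a (u, []) = \<zero>\<^bsub>K\<^esub>" using assms(3) unfolding deep_def by fastforce
      then show ?thesis using assms 0 by simp
    next
      case (Suc j)
      then have "\<not> n \<le> length (drop i p)" using n that by simp
      then have "\<rho> b (Q.awlast u (take i p), drop i p) = \<zero>\<^bsub>K\<^esub>"
        using assms(4) unfolding deep_def by blast
      then show ?thesis using assms by simp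
    qed
    then have "\<rho> (a \<otimes> b) (u, p) = \<zero>\<^bsub>K\<^esub>"
      unfolding \<rho>_mult[OF assms(1,2) g] by (intro K.add.finprod_one_eqI) simp
    then show False using nz by simp
  qed
qed

text \<open>Downward induction on n shows that elements of the n-th power of the arrow ideal J
  annihilate \<open>M\<close>. It starts where the power is zero and ends with the unit of
  \<open>A\<close>. The step amounts to M = MJ: if J^(n+1) kills \<open>M\<close>, then so does
  J^n.\<close>

lemma carrier_zero: "carrier M = {\<zero>\<^bsub>M\<^esub>}"
proof -
  obtain m where m: "\<And>u p. (u, p) \<in> Good \<Longrightarrow> length p < m" using bounded by blast
  have step: "x \<triangleleft>\<^bsub>M\<^esub> a = \<zero>\<^bsub>M\<^esub>"
    if IH: "\<And>x a. x \<in> carrier M \<Longrightarrow> a \<in> carrier A \<Longrightarrow> deep (Suc n) a \<Longrightarrow> x \<triangleleft>\<^bsub>M\<^esub> a = \<zero>\<^bsub>M\<^esub>"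
      and x: "x \<in> carrier M" and a: "a \<in> carrier A" "deep n a" for n x a
  proof -
    have vert: "x \<triangleleft>\<^bsub>M\<^esub> (vert w \<otimes> a) = \<zero>\<^bsub>M\<^esub>" if w: "w \<in> verts Q" and a: "a \<in> carrier A" "deep n a" for w a
    proof -
      let ?L = "{x \<in> carrier M. x \<triangleleft>\<^bsub>M\<^esub> (vert w \<otimes> a) = \<zero>\<^bsub>M\<^esub>}"
      note v = vert_closed[OF w]
      have va: "vert w \<otimes> a \<in> carrier A" using v a by simp
      have "ksub M ?L" unfolding ksub_def
      proof (intro conjI ballI)
        fix y c assume y: "y \<in> ?L" and c: "c \<in> carrier K"
        have "(y \<triangleleft>\<^bsub>M\<^esub> scal c) \<triangleleft>\<^bsub>M\<^esub> (vert w \<otimes> a) = y \<triangleleft>\<^bsub>M\<^esub> (scal c \<otimes> (vert w \<otimes> a))"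
          using y c va by (intro R.M.act_mult[symmetric]) simp_all
        also have "scal c \<otimes> (vert w \<otimes> a) = (vert w \<otimes> a) \<otimes> scal c"
          by (simp only: scal_mult[OF va c] mult_scal[OF va c])
        also have "y \<triangleleft>\<^bsub>M\<^esub> \<dots> = (y \<triangleleft>\<^bsub>M\<^esub> (vert w \<otimes> a)) \<triangleleft>\<^bsub>M\<^esub> scal c"
          using y c va by (intro R.M.act_mult) simp_all
        finally show "y \<triangleleft>\<^bsub>M\<^esub> scal c \<in> ?L" using y c by simp
      qed (use va R.M.act_add_left in auto)
      then have "?L = carrier M"
      proof (rule ksub_eq_carrier[OF w])
        fix y b assume y: "y \<in> carrier M" and b: "b \<in> carrier A"
        let ?l = "lam w b"
        have l: "?l \<in> carrier K" using b by simp
        \<comment> \<open>be - lam(b)e has no trivial path in it and lies in the arrow ideal, so its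
          product with a is one level deeper and kills \<open>M\<close> by \<open>IH\<close>. This
          is exactly the hypothesis of \<open>ksub_eq_carrier\<close> for the subspace killed by
          ea.\<close>
        let ?g = "b \<otimes> vert w \<ominus> ?l \<odot>\<^bsub>A\<^esub> vert w"
        have gc: "?g \<in> carrier A" using b v l by simp
        have "\<rho> ?g (u, []) = \<zero>\<^bsub>K\<^esub>" for u
        proof -
          have "\<rho> ?g (u, []) = (if u = w then \<rho> b (u, []) else \<zero>\<^bsub>K\<^esub>) \<ominus>\<^bsub>K\<^esub>
              ?l \<otimes>\<^bsub>K\<^esub> (if u = w then \<one>\<^bsub>K\<^esub> else \<zero>\<^bsub>K\<^esub>)"
            using b v l w
            by (simp add: \<rho>_minus \<rho>_smult \<rho>_mult_vert pel(2) Good_Nil path_elem_def Q.awalk_verts_conv)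
          then show ?thesis using b by (simp add: lam_def a_minus_def K.r_neg)
        qed
        then have "deep 1 ?g" unfolding deep_def by (metis length_0_conv less_one not_le)
        then have "deep (Suc n) (?g \<otimes> a)" by (intro deep_mult gc a)
        then have 0: "y \<triangleleft>\<^bsub>M\<^esub> (?g \<otimes> a) = \<zero>\<^bsub>M\<^esub>" using IH y gc a(1) by simp
        have cM: "y \<triangleleft>\<^bsub>M\<^esub> b \<in> carrier M" "y \<triangleleft>\<^bsub>M\<^esub> scal ?l \<in> carrier M" using y b l by simp_all
        have g: "?g \<otimes> a = b \<otimes> (vert w \<otimes> a) \<ominus> scal ?l \<otimes> (vert w \<otimes> a)"
          using b v l a(1) by (simp add: a_minus_def A.l_distr A.l_minus A.m_assoc scal_mult V.smult_mult_left)
        have "(y \<triangleleft>\<^bsub>M\<^esub> b \<ominus>\<^bsub>M\<^esub> y \<triangleleft>\<^bsub>M\<^esub> scal ?l) \<triangleleft>\<^bsub>M\<^esub> (vert w \<otimes> a) \<oplus>\<^bsub>M\<^esub> y \<triangleleft>\<^bsub>M\<^esub> (scal ?l \<otimes> (vert w \<otimes> a)) =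
            y \<triangleleft>\<^bsub>M\<^esub> (b \<otimes> (vert w \<otimes> a))"
          using cM y b l va
          by (simp add: R.M.act_mult R.M.act_add_left[symmetric] a_minus_def R.M.M.a_assoc R.M.M.l_neg)
        also have "b \<otimes> (vert w \<otimes> a) = ?g \<otimes> a \<oplus> scal ?l \<otimes> (vert w \<otimes> a)"
          unfolding g using b l va by (simp add: a_minus_def A.a_assoc A.l_neg)
        also have "y \<triangleleft>\<^bsub>M\<^esub> \<dots> = y \<triangleleft>\<^bsub>M\<^esub> (scal ?l \<otimes> (vert w \<otimes> a))"
          using 0 y gc a(1) l va by (simp add: R.M.act_add_right)
        finally have "(y \<triangleleft>\<^bsub>M\<^esub> b \<ominus>\<^bsub>M\<^esub> y \<triangleleft>\<^bsub>M\<^esub> scal ?l) \<triangleleft>\<^bsub>M\<^esub> (vert w \<otimes> a) = \<zero>\<^bsub>M\<^esub>"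
          using cM va y l R.M.M.add.r_cancel_one by simp
        then show "y \<triangleleft>\<^bsub>M\<^esub> b \<ominus>\<^bsub>M\<^esub> y \<triangleleft>\<^bsub>M\<^esub> scal ?l \<in> ?L" using cM by simp
      qed
      then show ?thesis using x by blast
    qed
    \<comment> \<open>A general a is the sum of the parts ea over the vertices; they are split off
      one by one, and \<open>W\<close> contains the starting vertices that may still occur.\<close>
    have "x \<triangleleft>\<^bsub>M\<^esub> a = \<zero>\<^bsub>M\<^esub>"
      if "finite W" "W \<subseteq> verts Q" "a \<in> carrier A" "deep n a" "\<And>u p. u \<notin> W \<Longrightarrow> \<rho> a (u, p) = \<zero>\<^bsub>K\<^esub>" for W a
      using that
    proof (induction W arbitrary: a)
      case empty
      then have "a = \<zero>" by (intro \<rho>_eqI) simp_all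
      then show ?case using x by simp
    next
      case (insert w W)
      have w: "w \<in> verts Q" using insert.prems by simp
      let ?b = "a \<ominus> vert w \<otimes> a"
      have c: "vert w \<otimes> a \<in> carrier A" "?b \<in> carrier A" using insert.prems vert_closed[OF w] by simp_all
      have \<rho>b: "\<rho> ?b (u, p) = (if u = w then \<zero>\<^bsub>K\<^esub> else \<rho> a (u, p))" for u p
        using insert.prems c w by (simp add: \<rho>_minus \<rho>_vert_mult) (simp add: a_minus_def K.r_neg)
      have "x \<triangleleft>\<^bsub>M\<^esub> ?b = \<zero>\<^bsub>M\<^esub>"
      proof (rule insert.IH)
        show "deep n ?b" using insert.prems(3) unfolding deep_def \<rho>b by simp
        show "\<rho> ?b (u, p) = \<zero>\<^bsub>K\<^esub>" if "u \<notin> W" for u p using insert.prems(4) that unfolding \<rho>b by simp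
      qed (use c insert.prems in auto)
      moreover have "x \<triangleleft>\<^bsub>M\<^esub> (vert w \<otimes> a) = \<zero>\<^bsub>M\<^esub>" by (rule vert[OF w insert.prems(2,3)])
      moreover have "a = ?b \<oplus> vert w \<otimes> a" using c insert.prems(2) by (simp add: a_minus_def A.a_assoc A.l_neg)
      ultimately show ?case using x c by (metis R.M.act_add_right R.M.M.l_zero R.M.M.zero_closed)
    qed
    moreover have "\<rho> a (u, p) = \<zero>\<^bsub>K\<^esub>" if "u \<notin> verts Q" for u p
    proof (rule \<rho>_out[OF a(1)])
      show "(u, p) \<notin> Good" using that by (cases p) (auto simp: Good_Nil Good_Cons)
    qed
    ultimately show ?thesis using a by (metis Q.finite_verts order_refl)
  qed
  \<comment> \<open>The depth m - k decreases as k grows. The subtraction is truncated, so beyond k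
    = m the claim merely repeats itself.\<close>
  have "x \<triangleleft>\<^bsub>M\<^esub> a = \<zero>\<^bsub>M\<^esub>" if "x \<in> carrier M" "a \<in> carrier A" "deep (m - k) a" for x a k
    using that
  proof (induction k arbitrary: x a)
    case 0
    have "a = \<zero>"
    proof (rule \<rho>_eqI)
      fix u p assume "(u, p) \<in> Good"
      then show "\<rho> a (u, p) = \<rho> \<zero> (u, p)" using m[of u p] 0(3) unfolding deep_def by (simp, fastforce)
    qed (use 0 in simp_all)
    then show ?case using 0(1) by simp
  next
    case (Suc k)
    show ?case
    proof (cases "m \<le> k")
      case True
      then show ?thesis using Suc by simp
    next
      case False
      then have "m - k = Suc (m - Suc k)" by simp
      then show ?thesis using step[of "m - Suc k"] Suc by metis
    qed
  qed
  \<comment> \<open>For k = m the depth is 0, so the unit qualifies, and it acts as the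
    identity.\<close>
  from this[of _ \<one> m] have "x = \<zero>\<^bsub>M\<^esub>" if "x \<in> carrier M" for x
    using that by (simp add: deep_def)
  then show ?thesis by blast
qed

end

section \<open>Coordinates of a bound quiver algebra\<close>

locale bound_quiver = K: field K + Q: fin_digraph Q
  for K :: "('k, 'c) ring_scheme" and Q :: "('v, 'e) pre_digraph" +
  fixes I :: "('v \<times> 'e list \<Rightarrow> 'k) set"
  assumes adm: "admissible_ideal K Q I"
    and monomial: "\<exists>S. S \<subseteq> {x \<in> quiver_paths Q. length (snd x) = 2} \<and>
      I = genideal (path_algebra K Q) (path_elem K ` S)"
begin

abbreviation P where "P \<equiv> path_algebra K Q"

definition bad :: "'e \<Rightarrow> 'e \<Rightarrow> bool" where
  "bad a b \<longleftrightarrow> path_elem K (tail Q a, [a, b]) \<in> I"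

abbreviation "Good \<equiv> good_paths Q bad"

lemma ring_P: "ring P"
  by (rule path_algebra_ring) unfold_locales

lemma ideal_I: "ideal I P"
  using adm by (simp add: admissible_ideal_def)

lemma mem_P: "f \<in> carrier P \<longleftrightarrow> (\<forall>x. f x \<in> carrier K) \<and> (\<forall>x. x \<notin> quiver_paths Q \<longrightarrow> f x = \<zero>\<^bsub>K\<^esub>) \<and>
    finite {x. f x \<noteq> \<zero>\<^bsub>K\<^esub>}"
  by (simp add: path_algebra_def)

lemma P_add: "(f \<oplus>\<^bsub>P\<^esub> g) x = f x \<oplus>\<^bsub>K\<^esub> g x"
  and P_zero: "\<zero>\<^bsub>P\<^esub> x = \<zero>\<^bsub>K\<^esub>"
  and P_smult: "(c \<odot>\<^bsub>P\<^esub> f) x = c \<otimes>\<^bsub>K\<^esub> f x"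
  and P_mult: "(f \<otimes>\<^bsub>P\<^esub> g) (u, p) =
    (\<Oplus>\<^bsub>K\<^esub>i\<in>{..length p}. f (u, take i p) \<otimes>\<^bsub>K\<^esub> g (Q.awlast u (take i p), drop i p))"
  by (simp_all add: path_algebra_def)

lemma P_closed: "f \<in> carrier P \<Longrightarrow> f x \<in> carrier K"
  unfolding mem_P by blast

lemma P_uminus: "f \<in> carrier P \<Longrightarrow> (\<ominus>\<^bsub>P\<^esub> f) x = \<ominus>\<^bsub>K\<^esub> f x"
proof -
  interpret P: ring P by (rule ring_P)
  assume f: "f \<in> carrier P"
  have "(\<ominus>\<^bsub>P\<^esub> f) x \<oplus>\<^bsub>K\<^esub> f x = \<zero>\<^bsub>K\<^esub>"
    using P.l_neg[OF f] P_add[of "\<ominus>\<^bsub>P\<^esub> f" f x] P_zero[of x] by simp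
  then show ?thesis using f P.a_inv_closed[OF f] by (simp add: P_closed K.minus_equality)
qed

definition single :: "'k \<Rightarrow> 'v \<times> 'e list \<Rightarrow> 'v \<times> 'e list \<Rightarrow> 'k" where
  "single c x = (\<lambda>y. if y = x then c else \<zero>\<^bsub>K\<^esub>)"

lemma path_elem_single: "path_elem K x = single \<one>\<^bsub>K\<^esub> x"
  by (simp add: path_elem_def single_def)

lemma single_closed: "c \<in> carrier K \<Longrightarrow> x \<in> quiver_paths Q \<Longrightarrow> single c x \<in> carrier P"
  unfolding mem_P using finite_subset[of "{y. single c x y \<noteq> \<zero>\<^bsub>K\<^esub>}" "{x}"]
  by (auto simp: single_def)

lemma single_mult:
  assumes "b \<in> carrier K" "c \<in> carrier K"
  shows "single b (u, p) \<otimes>\<^bsub>P\<^esub> single c (Q.awlast u p, q) = single (b \<otimes>\<^bsub>K\<^esub> c) (u, p @ q)"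
proof
  fix z show "(single b (u, p) \<otimes>\<^bsub>P\<^esub> single c (Q.awlast u p, q)) z = single (b \<otimes>\<^bsub>K\<^esub> c) (u, p @ q) z"
  proof (cases z)
    case (Pair v r)
    let ?r = "if v = u \<and> r = p @ q then b \<otimes>\<^bsub>K\<^esub> c else \<zero>\<^bsub>K\<^esub>"
    have eq: "single b (u, p) (v, take i r) \<otimes>\<^bsub>K\<^esub> single c (Q.awlast u p, q) (Q.awlast v (take i r), drop i r) =
        (if length p = i then ?r else \<zero>\<^bsub>K\<^esub>)" if "i \<le> length r" for i
    proof (cases "v = u \<and> take i r = p \<and> drop i r = q")
      case True
      then have r: "r = p @ q" using append_take_drop_id[of i r] by simp
      have "length (take i r) = i" using that by simp
      then have "length p = i" using True by simp
      then show ?thesis using r True by (simp add: single_def)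
    next
      case False
      then have "\<not> (v = u \<and> r = p @ q \<and> length p = i)" by auto
      then have "?r = \<zero>\<^bsub>K\<^esub> \<or> length p \<noteq> i" by simp
      moreover have "single b (u, p) (v, take i r) = \<zero>\<^bsub>K\<^esub> \<or>
          single c (Q.awlast u p, q) (Q.awlast v (take i r), drop i r) = \<zero>\<^bsub>K\<^esub>"
        using False by (cases "v = u \<and> take i r = p") (simp_all add: single_def)
      moreover have "single b x y \<in> carrier K" "single c x y \<in> carrier K" for x y
        using assms by (simp_all add: single_def)
      ultimately show ?thesis by (metis K.l_null K.r_null)
    qed
    have "(single b (u, p) \<otimes>\<^bsub>P\<^esub> single c (Q.awlast u p, q)) (v, r) =
        (\<Oplus>\<^bsub>K\<^esub>i\<in>{..length r}. if length p = i then ?r else \<zero>\<^bsub>K\<^esub>)"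
      unfolding P_mult using assms by (intro K.finsum_cong') (simp_all add: eq)
    also have "\<dots> = ?r"
    proof (cases "length p \<le> length r")
      case True
      then show ?thesis using assms K.finsum_singleton[of "length p" "{..length r}" "\<lambda>_. ?r"] by auto
    next
      case False
      then have "?r = \<zero>\<^bsub>K\<^esub>" by auto
      then show ?thesis by (simp only: if_cancel K.finsum_zero)
    qed
    finally show ?thesis by (simp add: Pair single_def)
  qed
qed

lemma Good_path: "x \<in> Good \<Longrightarrow> x \<in> quiver_paths Q"
  by (simp add: good_paths_def)

lemma Good_split:
  assumes "(u, p) \<in> Good" "i \<le> length p"
  shows "(u, take i p) \<in> Good" "(Q.awlast u (take i p), drop i p) \<in> Good"
proof -
  have "successively (\<lambda>a b. \<not> bad a b) (take i p @ drop i p)"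
    using assms(1) by (simp add: good_paths_def)
  then show "(u, take i p) \<in> Good" "(Q.awlast u (take i p), drop i p) \<in> Good"
    using assms Q.quiver_paths_split[OF assms(2), of u]
    unfolding good_paths_def successively_append_iff by auto
qed

lemma not_good_split:
  assumes "(u, p) \<in> quiver_paths Q" "(u, p) \<notin> Good"
  shows "\<exists>q a b r. p = q @ [a, b] @ r \<and> bad a b"
proof -
  have "\<not> successively (\<lambda>a b. \<not> bad a b) p" using assms by (simp add: good_paths_def)
  then show ?thesis
  proof (induction p rule: induct_list012)
    case (3 a b p)
    show ?case
    proof (cases "bad a b")
      case True
      then show ?thesis by (intro exI[of _ "[]"]) auto
    next
      case False
      then obtain q a' b' r where "b # p = q @ [a', b'] @ r" "bad a' b'" using 3 by auto
      then show ?thesis by (intro exI[of _ "a # q"]) auto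
    qed
  qed auto
qed

text \<open>A path that is not good factors as q, then a bad pair ab, then r. The middle factor lies
  in \<open>I\<close>, and \<open>I\<close> absorbs the other two.\<close>

lemma single_bad:
  assumes "c \<in> carrier K" "x \<in> quiver_paths Q" "x \<notin> Good"
  shows "single c x \<in> I"
proof -
  interpret I: ideal I P by (rule ideal_I)
  obtain u p where x: "x = (u, p)" by fastforce
  obtain q a b r where p: "p = q @ [a, b] @ r" "bad a b"
    using not_good_split[of u p] assms x by blast
  let ?w = "Q.awlast u q"
  have "(u, q) \<in> quiver_paths Q" "(?w, [a, b] @ r) \<in> quiver_paths Q"
    using Q.quiver_paths_split[of "length q" p u] assms(2) x p by auto
  moreover from this have "(?w, [a, b]) \<in> quiver_paths Q"
      "(Q.awlast ?w [a, b], r) \<in> quiver_paths Q"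
    using Q.quiver_paths_split[of 2 "[a, b] @ r" ?w] by auto
  moreover from this have "?w = tail Q a" by (auto simp: quiver_paths_def Q.awalk_Cons_iff)
  ultimately have c: "single c (u, q) \<in> carrier P" "single \<one>\<^bsub>K\<^esub> (Q.awlast ?w [a, b], r) \<in> carrier P"
      "single \<one>\<^bsub>K\<^esub> (?w, [a, b]) \<in> I"
    using p(2) assms(1) by (auto simp: single_closed bad_def path_elem_single)
  have "single c (u, q) \<otimes>\<^bsub>P\<^esub> (single \<one>\<^bsub>K\<^esub> (?w, [a, b]) \<otimes>\<^bsub>P\<^esub> single \<one>\<^bsub>K\<^esub> (Q.awlast ?w [a, b], r)) \<in> I"
    using c by (intro I.I_l_closed I.I_r_closed)
  moreover have "single \<one>\<^bsub>K\<^esub> (?w, [a, b]) \<otimes>\<^bsub>P\<^esub> single \<one>\<^bsub>K\<^esub> (Q.awlast ?w [a, b], r) =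
      single \<one>\<^bsub>K\<^esub> (?w, [a, b] @ r)"
    by (simp only: single_mult K.one_closed K.r_one)
  ultimately show ?thesis using assms(1)
    by (simp only: single_mult K.one_closed K.r_one x p(1))
qed

text \<open>Both halves of a splitting of a good path are good, so every term of a product at a good
  path contains a vanishing factor.\<close>

lemma vanishing_ideal: "ideal {f \<in> carrier P. \<forall>x\<in>Good. f x = \<zero>\<^bsub>K\<^esub>} P" (is "ideal ?N P")
proof (rule idealI[OF ring_P])
  interpret P: ring P by (rule ring_P)
  show "subgroup ?N (add_monoid P)"
  proof (rule group.subgroupI[OF P.a_group])
    show "?N \<noteq> {}" using P.zero_closed P_zero by blast
  next
    fix f assume f: "f \<in> ?N"
    then have fc: "f \<in> carrier P" by simp
    have "inv\<^bsub>add_monoid P\<^esub> f = \<ominus>\<^bsub>P\<^esub> f" by (simp add: a_inv_def)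
    then show "inv\<^bsub>add_monoid P\<^esub> f \<in> ?N" using f P_uminus[OF fc] P.a_inv_closed[OF fc] by simp
  next
    fix f g assume "f \<in> ?N" "g \<in> ?N"
    then show "f \<otimes>\<^bsub>add_monoid P\<^esub> g \<in> ?N" using P.a_closed[of f g] by (simp add: P_add)
  qed auto
next
  interpret P: ring P by (rule ring_P)
  fix f g assume f: "f \<in> ?N" and g: "g \<in> carrier P"
  have fc: "f \<in> carrier P" using f by simp
  have "(g \<otimes>\<^bsub>P\<^esub> f) (u, p) = \<zero>\<^bsub>K\<^esub>" if "(u, p) \<in> Good" for u p
    unfolding P_mult using Good_split(2)[OF that] f P_closed[OF g]
    by (intro K.add.finprod_one_eqI) auto
  then show "g \<otimes>\<^bsub>P\<^esub> f \<in> ?N" using P.m_closed[OF g fc] by auto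
  have "(f \<otimes>\<^bsub>P\<^esub> g) (u, p) = \<zero>\<^bsub>K\<^esub>" if "(u, p) \<in> Good" for u p
    unfolding P_mult using Good_split(1)[OF that] f P_closed[OF g]
    by (intro K.add.finprod_one_eqI) auto
  then show "f \<otimes>\<^bsub>P\<^esub> g \<in> ?N" using P.m_closed[OF fc g] by auto
qed

text \<open>The ideal is monomial. The functions that vanish on good paths form an ideal that
  contains the generators; conversely such a function is a finite combination of paths that are not
  good, and these lie in \<open>I\<close> by \<open>single_bad\<close>.\<close>

lemma I_eq: "I = {f \<in> carrier P. \<forall>x\<in>Good. f x = \<zero>\<^bsub>K\<^esub>}" (is "_ = ?N")
proof
  interpret P: ring P by (rule ring_P)
  interpret I: ideal I P by (rule ideal_I)
  obtain S where S: "S \<subseteq> {x \<in> quiver_paths Q. length (snd x) = 2}"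
    and IS: "I = genideal P (path_elem K ` S)" using monomial by blast
  have PS: "path_elem K ` S \<subseteq> carrier P" using S by (auto simp: path_elem_single intro: single_closed)
  have "genideal P (path_elem K ` S) \<subseteq> ?N"
  proof (rule P.genideal_minimal[OF vanishing_ideal], rule image_subsetI)
    fix x assume x: "x \<in> S"
    obtain u p where up: "x = (u, p)" by fastforce
    have "x \<in> quiver_paths Q" "length p = 2" using S x up by auto
    then obtain a b where p: "p = [a, b]" "u = tail Q a"
      by (auto simp: up quiver_paths_def length_Suc_conv numeral_2_eq_2 Q.awalk_Cons_iff)
    have "path_elem K x \<in> I" using IS x P.genideal_self[OF PS] by blast
    then have "x \<notin> Good" by (simp add: up p good_paths_def bad_def)
    then show "path_elem K x \<in> ?N" using PS x by (auto simp: path_elem_def)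
  qed
  then show "I \<subseteq> ?N" by (simp only: IS[symmetric])
  have supp: "f \<in> I" if "finite T" "T \<subseteq> quiver_paths Q" "T \<inter> Good = {}" "f \<in> carrier P" "{x. f x \<noteq> \<zero>\<^bsub>K\<^esub>} \<subseteq> T" for T f
    using that
  proof (induction T arbitrary: f)
    case empty
    then have "f = \<zero>\<^bsub>P\<^esub>" by (auto simp: fun_eq_iff P_zero)
    then show ?case using I.zero_closed by simp
  next
    case (insert x T)
    have fx: "f x \<in> carrier K" using insert.prems P_closed by blast
    let ?g = "\<lambda>y. if y = x then \<zero>\<^bsub>K\<^esub> else f y"
    have "?g \<in> I"
    proof (rule insert.IH)
      have "{y. ?g y \<noteq> \<zero>\<^bsub>K\<^esub>} \<subseteq> {y. f y \<noteq> \<zero>\<^bsub>K\<^esub>}" by auto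
      then have "finite {y. ?g y \<noteq> \<zero>\<^bsub>K\<^esub>}"
        by (rule finite_subset) (use insert.prems(3) in \<open>simp add: mem_P\<close>)
      then show "?g \<in> carrier P" using insert.prems(3) unfolding mem_P by simp
    qed (use insert.prems in auto)
    moreover have "single (f x) x \<in> I" using single_bad[OF fx] insert.prems by auto
    ultimately have "?g \<oplus>\<^bsub>P\<^esub> single (f x) x \<in> I" by simp
    moreover have "?g \<oplus>\<^bsub>P\<^esub> single (f x) x = f"
      using insert.prems(3) P_closed by (auto simp: fun_eq_iff P_add single_def)
    ultimately show ?case by simp
  qed
  show "?N \<subseteq> I"
  proof
    fix f assume f: "f \<in> ?N"
    then have fP: "f \<in> carrier P" by simp
    show "f \<in> I"
    proof (rule supp[OF _ _ _ fP order_refl])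
      show "finite {x. f x \<noteq> \<zero>\<^bsub>K\<^esub>}" using fP unfolding mem_P by blast
      show "{x. f x \<noteq> \<zero>\<^bsub>K\<^esub>} \<subseteq> quiver_paths Q" using fP unfolding mem_P by blast
    qed (use f in blast)
  qed
qed

text \<open>Some power m of the arrow ideal lies in \<open>I\<close>. A good path of length at least
  m would have a good prefix of length exactly m, which lies in that power and hence in
  \<open>I\<close>, against \<open>I_eq\<close>.\<close>

lemma Good_bounded: "\<exists>m. \<forall>(u, p)\<in>Good. length p < m"
proof -
  interpret P: ring P by (rule ring_P)
  let ?J = "arrow_ideal K Q"
  obtain m where m: "?J [^]\<^bsub>ideals_set P\<^esub> (m::nat) \<subseteq> I" using adm by (auto simp: admissible_ideal_def)
  have arc: "(tail Q a, [a]) \<in> quiver_paths Q" if "a \<in> arcs Q" for a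
    using that by (auto simp: quiver_paths_def Q.awalk_Cons_iff Q.awalk_Nil_iff)
  then have arcs: "(\<lambda>a. path_elem K (tail Q a, [a])) ` arcs Q \<subseteq> carrier P"
    by (auto simp: path_elem_single intro: single_closed)
  have pow: "path_elem K (u, p) \<in> ?J [^]\<^bsub>ideals_set P\<^esub> length p" if "(u, p) \<in> quiver_paths Q" for u p
    using that
  proof (induction p rule: rev_induct)
    case Nil
    then show ?case by (simp add: ideals_set_def path_elem_single single_closed nat_pow_def)
  next
    case (snoc a p)
    have p: "(u, p) \<in> quiver_paths Q" "(Q.awlast u p, [a]) \<in> quiver_paths Q"
      using Q.quiver_paths_split[of "length p" "p @ [a]" u] snoc.prems by auto
    then have a: "a \<in> arcs Q" "Q.awlast u p = tail Q a" by (auto simp: quiver_paths_def Q.awalk_Cons_iff)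
    have "path_elem K (tail Q a, [a]) \<in> ?J"
      using P.genideal_self[OF arcs] a(1) unfolding arrow_ideal_def by blast
    then have "path_elem K (u, p) \<otimes>\<^bsub>P\<^esub> path_elem K (tail Q a, [a]) \<in>
        ideal_prod P (?J [^]\<^bsub>ideals_set P\<^esub> length p) ?J"
      using snoc.IH[OF p(1)] by (intro ideal_prod.prod)
    moreover have "path_elem K (u, p) \<otimes>\<^bsub>P\<^esub> path_elem K (tail Q a, [a]) = path_elem K (u, p @ [a])"
      unfolding path_elem_single a(2)[symmetric] by (simp add: single_mult)
    ultimately show ?case by (simp add: ideals_set_def nat_pow_def)
  qed
  have "length p < m" if "(u, p) \<in> Good" for u p
  proof (rule ccontr)
    assume "\<not> length p < m"
    then have g: "(u, take m p) \<in> Good" "length (take m p) = m" using Good_split(1)[OF that, of m] by auto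
    then have "path_elem K (u, take m p) \<in> I" using pow[OF Good_path[OF g(1)]] m by auto
    then have "path_elem K (u, take m p) (u, take m p) = \<zero>\<^bsub>K\<^esub>" using I_eq g(1) by blast
    then show False by (simp add: path_elem_def)
  qed
  then show ?thesis by blast
qed

text \<open>By \<open>I_eq\<close> the values on good paths are constant on a coset of
  \<open>I\<close> and determine it; this makes the coordinates on the quotient well
  defined.\<close>

lemma coset_eq_iff:
  assumes f: "f \<in> carrier P" and g: "g \<in> carrier P"
  shows "g \<in> I +>\<^bsub>P\<^esub> f \<longleftrightarrow> (\<forall>x\<in>Good. g x = f x)"
    and "I +>\<^bsub>P\<^esub> f = I +>\<^bsub>P\<^esub> g \<longleftrightarrow> (\<forall>x\<in>Good. f x = g x)"
proof -
  interpret P: ring P by (rule ring_P)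
  interpret I: ideal I P by (rule ideal_I)
  have *: "g \<in> I +>\<^bsub>P\<^esub> f \<longleftrightarrow> (\<forall>x\<in>Good. g x = f x)" if f: "f \<in> carrier P" and g: "g \<in> carrier P" for f g
  proof
    assume "g \<in> I +>\<^bsub>P\<^esub> f"
    then obtain i where i: "i \<in> I" "g = i \<oplus>\<^bsub>P\<^esub> f" by (auto simp: a_r_coset_def r_coset_def)
    have "i x = \<zero>\<^bsub>K\<^esub>" if "x \<in> Good" for x using i(1) I_eq that by blast
    then show "\<forall>x\<in>Good. g x = f x" using P_closed[OF f] by (simp add: i(2) P_add)
  next
    assume eq: "\<forall>x\<in>Good. g x = f x"
    have "g \<ominus>\<^bsub>P\<^esub> f \<in> carrier P" using f g by (intro P.minus_closed)
    moreover have "(g \<ominus>\<^bsub>P\<^esub> f) x = \<zero>\<^bsub>K\<^esub>" if "x \<in> Good" for x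
      unfolding a_minus_def P_add P_uminus[OF f] using eq that P_closed[OF f] by (simp add: K.r_neg)
    ultimately have "g \<ominus>\<^bsub>P\<^esub> f \<in> I" using I_eq by blast
    then have "(g \<ominus>\<^bsub>P\<^esub> f) \<oplus>\<^bsub>P\<^esub> f \<in> I +>\<^bsub>P\<^esub> f" using f I.a_subset by (intro P.a_rcosI)
    moreover have "(g \<ominus>\<^bsub>P\<^esub> f) \<oplus>\<^bsub>P\<^esub> f = g" using f g by (simp add: a_minus_def P.a_assoc P.l_neg)
    ultimately show "g \<in> I +>\<^bsub>P\<^esub> f" by simp
  qed
  show "g \<in> I +>\<^bsub>P\<^esub> f \<longleftrightarrow> (\<forall>x\<in>Good. g x = f x)" by (rule *[OF f g])
  show "I +>\<^bsub>P\<^esub> f = I +>\<^bsub>P\<^esub> g \<longleftrightarrow> (\<forall>x\<in>Good. f x = g x)"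
    using *[OF g f] *[OF f g] I.a_rcos_self[OF f] P.a_repr_independence[OF _ g I.a_subgroup] by auto
qed

text \<open>The coordinates of x are the values on good paths of any representative of the coset h
  x. Setting them to zero elsewhere selects a canonical representative, which gives injectivity and
  the description of the range.\<close>

lemma path_coords_exists:
  assumes A: "assoc_algebra K A" and h: "h \<in> algebra_iso K A (quotient_algebra P I)"
  shows "\<exists>\<rho>. path_coords K A Q bad \<rho>"
proof -
  interpret A: assoc_algebra K A by (rule A)
  interpret P: ring P by (rule ring_P)
  interpret I: ideal I P by (rule ideal_I)
  have hom: "h \<in> ring_hom A (quotient_algebra P I)" and bij: "bij_betw h (carrier A) (a_rcosets\<^bsub>P\<^esub> I)"
    and smult: "\<And>c x. c \<in> carrier K \<Longrightarrow> x \<in> carrier A \<Longrightarrow>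
      h (c \<odot>\<^bsub>A\<^esub> x) = (\<Union>y\<in>h x. I +>\<^bsub>P\<^esub> (c \<odot>\<^bsub>P\<^esub> y))"
    using h by (auto simp: algebra_iso_def ring_iso_def quotient_algebra_def FactRing_def)
  have "\<exists>f. f \<in> carrier P \<and> h x = I +>\<^bsub>P\<^esub> f" if "x \<in> carrier A" for x
    using bij_betwE[OF bij] that by (auto simp: A_RCOSETS_def' )
  then obtain r where r: "\<And>x. x \<in> carrier A \<Longrightarrow> r x \<in> carrier P" "\<And>x. x \<in> carrier A \<Longrightarrow> h x = I +>\<^bsub>P\<^esub> r x"
    by metis
  define \<rho> where "\<rho> x z = (if z \<in> Good then r x z else \<zero>\<^bsub>K\<^esub>)" for x z
  have \<rho>_eq: "\<rho> x z = f z" if "x \<in> carrier A" "f \<in> carrier P" "h x = I +>\<^bsub>P\<^esub> f" "z \<in> Good" for x f z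
    using coset_eq_iff(2)[OF r(1)[OF that(1)] that(2)] r(2)[OF that(1)] that by (simp add: \<rho>_def)
  have \<rho>_P: "\<rho> x \<in> carrier P" if "x \<in> carrier A" for x
  proof -
    have "{z. \<rho> x z \<noteq> \<zero>\<^bsub>K\<^esub>} \<subseteq> {z. r x z \<noteq> \<zero>\<^bsub>K\<^esub>}" by (auto simp: \<rho>_def)
    then have "finite {z. \<rho> x z \<noteq> \<zero>\<^bsub>K\<^esub>}"
      by (rule finite_subset) (use r(1)[OF that] in \<open>simp add: mem_P\<close>)
    moreover have "\<rho> x z \<in> carrier K" "z \<notin> quiver_paths Q \<Longrightarrow> \<rho> x z = \<zero>\<^bsub>K\<^esub>" for z
      using P_closed[OF r(1)[OF that]] Good_path[of z] by (auto simp: \<rho>_def)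
    ultimately show ?thesis unfolding mem_P by blast
  qed
  have "path_coords K A Q bad \<rho>"
  proof (unfold_locales, goal_cases)
    case 1
    show ?case
    proof (rule inj_onI)
      fix x y assume x: "x \<in> carrier A" and y: "y \<in> carrier A" and eq: "\<rho> x = \<rho> y"
      have "r x z = r y z" if "z \<in> Good" for z using fun_cong[OF eq, of z] that by (simp add: \<rho>_def)
      then have "h x = h y" using coset_eq_iff(2) r x y by simp
      then show "x = y" using bij x y by (auto simp: bij_betw_def inj_on_def)
    qed
  next
    case 2
    show ?case
    proof (intro equalityI subsetI)
      fix f assume "f \<in> \<rho> ` carrier A"
      then obtain x where x: "x \<in> carrier A" "f = \<rho> x" by blast
      then show "f \<in> {f. (\<forall>z. f z \<in> carrier K) \<and> (\<forall>z. z \<notin> Good \<longrightarrow> f z = \<zero>\<^bsub>K\<^esub>) \<and> finite {z. f z \<noteq> \<zero>\<^bsub>K\<^esub>}}"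
        using \<rho>_P[OF x(1)] by (auto simp: mem_P \<rho>_def)
    next
      fix f assume f: "f \<in> {f. (\<forall>z. f z \<in> carrier K) \<and> (\<forall>z. z \<notin> Good \<longrightarrow> f z = \<zero>\<^bsub>K\<^esub>) \<and> finite {z. f z \<noteq> \<zero>\<^bsub>K\<^esub>}}"
      then have f0: "f z = \<zero>\<^bsub>K\<^esub>" if "z \<notin> Good" for z using that by blast
      from f have fP: "f \<in> carrier P" using Good_path unfolding mem_P by blast
      then have "I +>\<^bsub>P\<^esub> f \<in> h ` carrier A" using bij by (auto simp: bij_betw_def A_RCOSETS_def')
      then obtain x where x: "x \<in> carrier A" "h x = I +>\<^bsub>P\<^esub> f" by auto
      have "f = \<rho> x"
      proof
        fix z show "f z = \<rho> x z"
          using \<rho>_eq[OF x(1) fP x(2), of z] f0[of z] by (cases "z \<in> Good") (simp_all add: \<rho>_def)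
      qed
      then show "f \<in> \<rho> ` carrier A" using x(1) by blast
    qed
  next
    case (3 x y z)
    have "h (x \<oplus>\<^bsub>A\<^esub> y) = I +>\<^bsub>P\<^esub> (r x \<oplus>\<^bsub>P\<^esub> r y)"
      using hom r 3 I.a_rcos_sum by (simp add: ring_hom_def quotient_algebra_def FactRing_def)
    then show ?case
      using \<rho>_eq[of "x \<oplus>\<^bsub>A\<^esub> y" "r x \<oplus>\<^bsub>P\<^esub> r y" z] r(1) 3 P.a_closed by (simp add: P_add \<rho>_def)
  next
    case (4 c x z)
    have cx: "c \<odot>\<^bsub>A\<^esub> x \<in> carrier A" using 4 by simp
    have cP: "c \<odot>\<^bsub>P\<^esub> r x \<in> carrier P"
    proof -
      have "{y. (c \<odot>\<^bsub>P\<^esub> r x) y \<noteq> \<zero>\<^bsub>K\<^esub>} \<subseteq> {y. r x y \<noteq> \<zero>\<^bsub>K\<^esub>}" using 4 by (auto simp: P_smult)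
      then have "finite {y. (c \<odot>\<^bsub>P\<^esub> r x) y \<noteq> \<zero>\<^bsub>K\<^esub>}"
        by (rule finite_subset) (use r(1)[OF 4(2)] in \<open>simp add: mem_P\<close>)
      then show ?thesis using r(1)[OF 4(2)] 4(1) by (simp add: mem_P P_smult)
    qed
    have "r x \<in> h x" using r 4 I.a_rcos_self by simp
    \<comment> \<open>Scalar multiplication on the quotient is defined as a union over all
      representatives; it suffices to exhibit one member and to compare its values on good
      paths.\<close>
    then have "c \<odot>\<^bsub>P\<^esub> r x \<in> h (c \<odot>\<^bsub>A\<^esub> x)" unfolding smult[OF 4] using I.a_rcos_self[OF cP] by blast
    then have "\<forall>z\<in>Good. (c \<odot>\<^bsub>P\<^esub> r x) z = r (c \<odot>\<^bsub>A\<^esub> x) z"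
      using coset_eq_iff(1)[OF r(1)[OF cx] cP] r(2)[OF cx] by simp
    then show ?case using 4 by (auto simp: \<rho>_def P_smult)
  next
    case (5 x y u p)
    have "h (x \<otimes>\<^bsub>A\<^esub> y) = I +>\<^bsub>P\<^esub> (r x \<otimes>\<^bsub>P\<^esub> r y)"
      using hom r 5 I.rcoset_mult_add by (simp add: ring_hom_def quotient_algebra_def FactRing_def)
    then have "\<rho> (x \<otimes>\<^bsub>A\<^esub> y) (u, p) = (r x \<otimes>\<^bsub>P\<^esub> r y) (u, p)"
      using \<rho>_eq[of "x \<otimes>\<^bsub>A\<^esub> y" "r x \<otimes>\<^bsub>P\<^esub> r y" "(u, p)"] r(1) 5 P.m_closed by simp
    also have "\<dots> = (\<Oplus>\<^bsub>K\<^esub>i\<in>{..length p}. \<rho> x (u, take i p) \<otimes>\<^bsub>K\<^esub> \<rho> y (Q.awlast u (take i p), drop i p))"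
      unfolding P_mult using 5 Good_split[OF 5(3)] P_closed[OF r(1)]
      by (intro K.finsum_cong') (auto simp: \<rho>_def)
    finally show ?case .
  qed
  then show ?thesis by blast
qed

end

lemma gentle_coords_exists:
  fixes K :: "('k, 'c) ring_scheme" and A :: "('k, 'a) module"
  assumes "field K" "gentle_algebra K A"
  shows "\<exists>(Q :: (nat, nat) pre_digraph) bad \<rho>. gentle_coords K A Q bad \<rho>"
proof -
  obtain Q :: "(nat, nat) pre_digraph" and I h where pres: "gentle_presentation K Q I"
    and h: "h \<in> algebra_iso K A (quotient_algebra (path_algebra K Q) I)" and A: "assoc_algebra K A"
    using assms(2) by (auto simp: gentle_algebra_def)
  interpret K: field K by fact
  interpret Q: fin_digraph Q using pres by (simp add: gentle_presentation_def)
  interpret B: bound_quiver K Q I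
    using pres by unfold_locales (auto simp: gentle_presentation_def)
  obtain \<rho> where "path_coords K A Q B.bad \<rho>" using B.path_coords_exists[OF A h] by blast
  then interpret C: path_coords K A Q B.bad \<rho> .
  have fwd: "b = b'" if "a \<in> arcs Q" "b \<in> arcs Q" "b' \<in> arcs Q" "tail Q b = head Q a" "tail Q b' = head Q a"
      "B.bad a b" "B.bad a b'" for a b b'
  proof -
    have "\<exists>\<^sub>\<le>\<^sub>1b. b \<in> arcs Q \<and> tail Q b = head Q a \<and> path_elem K (tail Q a, [a, b]) \<in> I"
      using pres that(1) unfolding gentle_presentation_def by blast
    then show ?thesis using that by (auto simp: Uniq_def B.bad_def)
  qed
  \<comment> \<open>With equal truth values as the hypothesis, one statement covers both
    \<open>bad_bwd\<close> and \<open>not_bad_bwd\<close>.\<close>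
  have bwd: "a = a'" if "b \<in> arcs Q" "a \<in> arcs Q" "a' \<in> arcs Q" "head Q a = tail Q b" "head Q a' = tail Q b"
      "B.bad a b = B.bad a' b" for a a' b
  proof -
    have "\<exists>\<^sub>\<le>\<^sub>1a. a \<in> arcs Q \<and> head Q a = tail Q b \<and> path_elem K (tail Q a, [a, b]) \<in> I"
      "\<exists>\<^sub>\<le>\<^sub>1a. a \<in> arcs Q \<and> head Q a = tail Q b \<and> path_elem K (tail Q a, [a, b]) \<notin> I"
      using pres that(1) unfolding gentle_presentation_def by blast+
    then show ?thesis using that unfolding Uniq_def B.bad_def by blast
  qed
  have "gentle_coords K A Q B.bad \<rho>"
    by unfold_locales (use fwd bwd B.Good_bounded in blast)+
  then show ?thesis by blast
qed

theorem theorem6p8: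
  fixes K :: "('k, 'c) ring_scheme" and A :: "('k, 'a) module" and M :: "('a, 'x) right_mod"
  assumes "algebraically_closed K"
    and "gentle_algebra K A"
    and "right_module A M"
    and "vectorspace.fin_dim K (underlying_vectorspace A M)"
  shows "(\<forall>d. trivial_group (Ext A d M (regular_module A))) \<longleftrightarrow> carrier M = {\<zero>\<^bsub>M\<^esub>}"
proof -
  obtain F d \<epsilon> where R: "chosen_resolution A M = (F, d, \<epsilon>)" using prod_cases3 by blast
  interpret resolution A M F d \<epsilon> by (rule chosen_resolution_locale) fact+
  note Ext = trivial_Ext_iff[OF assms(3) right_module_regular R]
  show ?thesis
  proof
    assume "\<forall>d. trivial_group (Ext A d M (regular_module A))"
    then have acyc: "acyclic_ideal (carrier A)" by (intro acyclic_ideal_carrier) (simp add: Ext)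
    have "field K" using assms(1) by (simp add: algebraically_closed_def)
    then obtain Q :: "(nat, nat) pre_digraph" and bad \<rho> where "gentle_coords K A Q bad \<rho>"
      using gentle_coords_exists assms(2) by blast
    then interpret G: gentle_coords K A Q bad \<rho> .
    interpret G: gentle_resolution K A Q bad \<rho> M F d \<epsilon> by unfold_locales (rule acyc)
    show "carrier M = {\<zero>\<^bsub>M\<^esub>}" by (rule G.carrier_zero)
  next
    assume "carrier M = {\<zero>\<^bsub>M\<^esub>}"
    then show "\<forall>d. trivial_group (Ext A d M (regular_module A))"
      using cocycles_subset_of_zero[OF _ right_module_regular] by (simp add: Ext)
  qed
qed

end
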